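(* For each nonnegative integer $k$, $$\#\{n \leq x : g(n) = k\} = \frac{Bx(\log\log x)^k}{k!\log x}\left(1 + O_k\left(\frac{1}{\log\log x}\right)\right)$$ for all real $x \geq 3$, where the implied constant depends only on $k$.
   Context: For a natural number $n > 1$ with prime factorization $n = p_1^{a_1}\cdots p_s^{a_s}$ ($p_1 < \cdots < p_s$ primes, $a_1,\dots,a_s$ positive integers), $f(n) := \#\{a_1,\dots,a_s\}$ is the number of distinct exponents; also $f(1) := 0$. $\omega(n)$ is the number of distinct prime factors of $n$, and $g(n) := \omega(n) - f(n)$ for all positive integers $n$ (so $g(n)\ge 0$). In the counting set, $n$ runs over positive integers. A positive integer $n$ is special if $f(n) = \omega(n)$, i.e. all exponents in its prime factorization are distinct; it is powerful if, for all primes $p$, $p \mid n$ implies $p^2 \mid n$. The number $1$ is both special and powerful. The constant $B$ is $B := \sum_\ell \frac{1}{\ell}$, where the sum is over all positive integers $\ell$ (including $\ell = 1$) that are both powerful and special. *)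

theory Defs
  imports Complex_Main "HOL-Computational_Algebra.Primes" "HOL-Analysis.Infinite_Sum"
begin

definition prime_omega :: "nat \<Rightarrow> nat" where
  "prime_omega n = card (prime_factors n)"

definition num_exps :: "nat \<Rightarrow> nat" where
  "num_exps n = card ((\<lambda>p. multiplicity p n) ` prime_factors n)"

lemma num_exps_1: "num_exps 1 = 0"
  by (simp add: num_exps_def)

lemma num_exps_le_prime_omega: "num_exps n \<le> prime_omega n"
  unfolding num_exps_def prime_omega_def by (rule card_image_le) simp

text \<open>The subtraction below never truncates, by \<open>num_exps_le_prime_omega\<close>.\<close>

definition exp_defect :: "nat \<Rightarrow> nat" where
  "exp_defect n = prime_omega n - num_exps n"

definition special :: "nat \<Rightarrow> bool" where
  "special n \<longleftrightarrow> n > 0 \<and> num_exps n = prime_omega n"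

definition powerful :: "nat \<Rightarrow> bool" where
  "powerful n \<longleftrightarrow> n > 0 \<and> (\<forall>p. prime p \<longrightarrow> p dvd n \<longrightarrow> p\<^sup>2 dvd n)"

lemma special_1: "special 1" and powerful_1: "powerful 1"
  by (simp_all add: special_def powerful_def prime_omega_def num_exps_def)

definition B_const :: real where
  "B_const = (\<Sum>\<^sub>\<infinity>l | powerful l \<and> special l. 1 / real l)"

definition defect_count :: "nat \<Rightarrow> real \<Rightarrow> nat" where
  "defect_count k x = card {n::nat. n > 0 \<and> real n \<le> x \<and> exp_defect n = k}"

end

theory Submission
  imports Defs "HOL-Complex_Analysis.Complex_Analysis" "HOL-Number_Theory.Prime_Powers"
    "HOL-Probability.Characteristic_Functions" "HOL-Real_Asymp.Real_Asymp"
begin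

text \<open>The idea is to strip from n a prime p that divides it exactly once. If n = p m with p
  not dividing m, then the defect g(n) depends on m only: passing from m to n adds one prime
  factor and puts 1 among the exponents. Call this value \<open>next_defect m\<close>. Hence
  (\<open>simple_log_sum_eq\<close>) the sum of log p over all pairs (n, p) with n \<le> x, g(n) = k and p dividing
  n exactly once equals the sum, over m \<le> x with \<open>next_defect m = k\<close>, of log p over the
  primes p \<le> x/m that do not divide m. By the prime number theorem the inner sum is about x/m,
  so the total is x times the logarithmic sum of 1/m, up to a relative error of order 1/log log x
  (\<open>simple_log_sum_asymptotic\<close>). On the other side the total weight that n receives is log n
  minus the logarithm of its powerful part; outside a negligible set of n it is therefore
  log x + O(log log x), and dividing by log x gives the count (\<open>defect_count_asymptotic\<close>).

  The logarithmic sum is evaluated by writing m = q l with q squarefree, l powerful and q, l coprime.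
  Then \<open>next_defect m\<close> is the number of prime factors of q plus g(l) (\<open>next_defect_compose\<close>). For
  fixed l the sum of 1/q over the q with j prime factors is essentially the j-th elementary symmetric
  function of the reciprocals of the primes, which by Mertens is (log log x)^j / j! with a relative
  error of order 1/log log x. The leading power j = k occurs exactly when g(l) = 0, that is, when l is
  special, and the sum of 1/l over the special powerful l is B (\<open>log_density_asymptotic\<close>).

  The relative error 1/log log x in the result requires the prime number theorem with an error term
  of order x / log log x at worst. It is proved here with a saving of a small power of log x
  (\<open>prime_number_theorem_psi\<close>). The inequality of type 3-4-1 bounds (s - 1) zeta(s) from below by a negative
  power of |Im s| + 3, uniformly for 1 < Re s \<le> 2 (\<open>zeta_reg_lower_bound\<close>). Consequently the
  Laplace transform of the function that is psi(exp u) exp(-u) - 1 for u \<ge> 0 and 0 for u < 0, and its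
  derivative, grow at most polynomially on vertical lines, again uniformly up to Re s = 1
  (\<open>psi_laplace_bounds\<close>). Convolving with a narrow Gaussian
  makes Fourier inversion absolutely convergent, and a single integration by parts yields the decay
  (\<open>gaussian_smoothing_bound\<close>); the monotonicity of psi removes the convolution
  (\<open>psi_ratio_asymptotic\<close>). No contour is shifted: the continuation of (s - 1) zeta(s) to Re s > 0 only
  serves to bound its derivatives near Re s = 1. Together with a bound for the series of the von Mangoldt
  function, the bounds for (s - 1) zeta(s) at s = 1 + 1/log x give the theorem of Mertens
  (\<open>mertens_second\<close>).\<close>

section \<open>Dirichlet series with coefficients of logarithmic growth\<close>

text \<open>The summation may start at n = 0 because \<open>0 powr (- s)\<close> is 0.\<close>

definition dirichlet_sum :: "(nat \<Rightarrow> real) \<Rightarrow> complex \<Rightarrow> complex" where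
  "dirichlet_sum a s = (\<Sum>n. of_real (a n) * of_nat n powr (- s))"

lemma norm_of_nat_powr: "norm (of_nat n powr (s::complex)) = real n powr Re s"
  using norm_powr_real_powr[of "of_nat n" s] by (cases "n = 0") (auto)

text \<open>The bound 1 + ln n for the coefficients covers the constant 1, the von Mangoldt function, the
  logarithm and the coefficients of log zeta, so that one convergence statement serves all the series below.\<close>

lemma summable_log_powr:
  assumes "\<sigma> > (1::real)"
  shows "summable (\<lambda>n. (1 + ln (real n)) * real n powr (-\<sigma>))"
proof -
  define d where "d = (\<sigma> - 1) / 2"
  have d: "d > 0" "\<sigma> - d > 1" using assms by (auto simp: d_def field_simps)
  have "summable (\<lambda>n. (1 + 1/d) * real n powr (-(\<sigma> - d)))"
    using d by (intro summable_mult) (simp add: summable_real_powr_iff)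
  then show ?thesis
  proof (rule summable_comparison_test'[where N = 1])
    fix n :: nat assume n: "n \<ge> 1"
    have "ln (real n) \<le> real n powr d / d" using ln_powr_bound[of n d] n d by auto
    moreover have "1 \<le> real n powr d" using n d by (simp add: ge_one_powr_ge_zero)
    ultimately have "1 + ln (real n) \<le> (1 + 1/d) * real n powr d" by (simp add: field_simps)
    then have "(1 + ln (real n)) * real n powr (-\<sigma>) \<le> (1 + 1/d) * real n powr d * real n powr (-\<sigma>)"
      by (intro mult_right_mono) auto
    also have "\<dots> = (1 + 1/d) * real n powr (-(\<sigma> - d))" by (simp add: powr_add[symmetric])
    finally show "norm ((1 + ln (real n)) * real n powr (-\<sigma>)) \<le> (1 + 1/d) * real n powr (-(\<sigma> - d))"
      using n by simp
  qed
qed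

lemma summable_norm_dirichlet:
  assumes "\<And>n. \<bar>a n\<bar> \<le> 1 + ln (real n)" "Re s > 1"
  shows "summable (\<lambda>n. norm (of_real (a n) * of_nat n powr (- s) :: complex))"
  by (rule summable_comparison_test'[OF summable_log_powr[OF assms(2)], of 0])
     (auto simp: norm_mult norm_of_nat_powr intro!: mult_right_mono assms(1))

lemma dirichlet_sum_sums:
  assumes "\<And>n. \<bar>a n\<bar> \<le> 1 + ln (real n)" "Re s > 1"
  shows "(\<lambda>n. of_real (a n) * of_nat n powr (- s)) sums dirichlet_sum a s"
  using summable_norm_cancel[OF summable_norm_dirichlet[OF assms]]
  unfolding dirichlet_sum_def by (rule summable_sums)

text \<open>On the ball of radius (Re s - 1)/2 around s all terms are dominated by those of a convergent series
  of constants, so the series may be differentiated term by term.\<close>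

lemma dirichlet_sum_deriv:
  assumes a: "\<And>n. \<bar>a n\<bar> \<le> 1 + ln (real n)" and s: "Re s > 1"
  shows "(dirichlet_sum a has_field_derivative - dirichlet_sum (\<lambda>n. a n * ln (real n)) s) (at s)"
proof -
  define S where "S = {s. Re s > 1}"
  have S: "open S" unfolding S_def by (rule open_halfspace_Re_gt)
  define f where "f = (\<lambda>n s. of_real (a n) * of_nat n powr (- s) :: complex)"
  define f' where "f' = (\<lambda>n s. - (of_real (a n * ln (real n)) * of_nat n powr (- s)) :: complex)"
  have "\<exists>g g'. \<forall>x \<in> S. ((\<lambda>n. f n x) sums g x) \<and> ((\<lambda>n. f' n x) sums g' x) \<and> (g has_field_derivative g' x) (at x)"
  proof (rule series_and_derivative_comparison_complex[OF S])
    show "(f n has_field_derivative f' n x) (at x)" for n x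
    proof (cases "n = 0")
      case False
      then have "((\<lambda>x. of_nat n powr (- x)) has_field_derivative Ln (of_nat n) * of_nat n powr (- x) * (-1)) (at x)"
        by (intro DERIV_chain2[OF has_field_derivative_powr_right]) (auto intro!: derivative_eq_intros)
      from DERIV_cmult[OF this, of "of_real (a n)"] False show ?thesis
        unfolding f_def f'_def by (simp add: mult_ac)
    qed (auto simp: f_def f'_def)
    fix x assume x: "x \<in> S"
    define d where "d = (Re x - 1) / 2"
    have d: "d > 0" using x by (auto simp: d_def S_def)
    define h where "h = (\<lambda>n. complex_of_real ((1 + ln (real n)) * real n powr (- (1 + d))))"
    have ln0: "1 + ln (real n) \<ge> 0" for n by (cases n) auto
    have "summable h" unfolding h_def
      using summable_log_powr[of "1 + d"] d by (simp only: summable_of_real)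
    moreover have "range h \<subseteq> \<real>\<^sub>\<ge>\<^sub>0" using ln0 by (auto simp: h_def simp del: of_real_mult of_real_add)
    moreover have "cmod (f n y) \<le> cmod (h n)" if y: "y \<in> ball x d" for n y
    proof (cases "n = 0")
      case False
      have "\<bar>Re (x - y)\<bar> < d" using y abs_Re_le_cmod[of "x - y"] by (simp add: dist_norm)
      then have "- Re y \<le> - (1 + d)" by (auto simp: d_def abs_if field_simps split: if_splits)
      then have "real n powr (- Re y) \<le> real n powr (- (1 + d))" using False by (intro powr_mono) auto
      then have "cmod (f n y) \<le> (1 + ln (real n)) * real n powr (- (1 + d))"
        unfolding f_def norm_mult norm_of_nat_powr norm_of_real using a ln0 by (intro mult_mono) auto
      then show ?thesis unfolding h_def norm_of_real by linarith
    qed (auto simp: f_def)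
    ultimately show "\<exists>d h. 0 < d \<and> summable h \<and> range h \<subseteq> \<real>\<^sub>\<ge>\<^sub>0 \<and>
        (\<forall>\<^sub>F n in sequentially. \<forall>y\<in>ball x d \<inter> S. cmod (f n y) \<le> cmod (h n))"
      using d by (intro exI[of _ d] exI[of _ h]) (auto intro!: always_eventually)
  qed
  then obtain g g' where g: "\<And>x. x \<in> S \<Longrightarrow> (\<lambda>n. f n x) sums g x" "\<And>x. x \<in> S \<Longrightarrow> (\<lambda>n. f' n x) sums g' x"
     "\<And>x. x \<in> S \<Longrightarrow> (g has_field_derivative g' x) (at x)" by blast
  have sS: "s \<in> S" using s by (simp add: S_def)
  have eq: "g x = dirichlet_sum a x" if "x \<in> S" for x
    using g(1)[OF that] unfolding f_def dirichlet_sum_def by (simp add: sums_iff)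
  have "g' s = - dirichlet_sum (\<lambda>n. a n * ln (real n)) s"
    using g(2)[OF sS] sums_minus[OF g(2)[OF sS]]
    unfolding f'_def dirichlet_sum_def by (simp add: sums_iff)
  with g(3)[OF sS] have "(g has_field_derivative - dirichlet_sum (\<lambda>n. a n * ln (real n)) s) (at s)" by simp
  then show ?thesis by (rule has_field_derivative_transform_within_open[OF _ S sS eq])
qed

text \<open>Absolute convergence allows the double series to be regrouped according to the product of the two indices.\<close>

lemma dirichlet_sum_mult:
  assumes a: "\<And>n. \<bar>a n\<bar> \<le> 1 + ln (real n)" and b: "\<And>n. \<bar>b n\<bar> \<le> 1 + ln (real n)" and s: "Re s > 1"
    and c: "\<And>n. n > 0 \<Longrightarrow> c n = (\<Sum>d | d dvd n. a d * b (n div d))"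
    and c0: "c 0 = 0"
  shows "dirichlet_sum a s * dirichlet_sum b s = dirichlet_sum c s"
proof -
  define u where "u = (\<lambda>n. of_real (a n) * of_nat n powr (- s) :: complex)"
  define v where "v = (\<lambda>n. of_real (b n) * of_nat n powr (- s) :: complex)"
  have u0: "u 0 = 0" and v0: "v 0 = 0" by (auto simp: u_def v_def)
  have su: "(u has_sum dirichlet_sum a s) UNIV"
    unfolding u_def using summable_norm_dirichlet[OF a s] dirichlet_sum_sums[OF a s]
    by (rule norm_summable_imp_has_sum)
  have sv: "(v has_sum dirichlet_sum b s) UNIV"
    unfolding v_def using summable_norm_dirichlet[OF b s] dirichlet_sum_sums[OF b s]
    by (rule norm_summable_imp_has_sum)
  have au: "(\<lambda>n. norm (u n)) summable_on UNIV"
    using summable_norm_dirichlet[OF a s] unfolding u_def by (subst summable_on_UNIV_nonneg_real_iff) auto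
  have av: "(\<lambda>n. norm (v n)) summable_on UNIV"
    using summable_norm_dirichlet[OF b s] unfolding v_def by (subst summable_on_UNIV_nonneg_real_iff) auto
  have "(\<lambda>x. norm ((\<lambda>(m,n). u m * v n) x)) summable_on UNIV \<times> UNIV"
    unfolding Infinite_Sum.abs_summable_on_Sigma_iff
    using au av by (auto simp: norm_mult infsum_cmult_right' abs_mult intro!: summable_on_cmult_right summable_on_cmult_left)
  then have sp: "(\<lambda>(m,n). u m * v n) summable_on UNIV \<times> UNIV" by (rule abs_summable_summable)
  have "((\<lambda>(m,n). u m * v n) has_sum (dirichlet_sum a s * dirichlet_sum b s)) (UNIV \<times> UNIV)"
    by (rule has_sum_SigmaI[OF _ _ sp, where g = "\<lambda>m. u m * dirichlet_sum b s"])
       (use has_sum_cmult_right[OF sv] has_sum_cmult_left[OF su] in auto)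
  then have "((\<lambda>(m,n). u m * v n) has_sum (dirichlet_sum a s * dirichlet_sum b s)) ({0<..} \<times> {0<..})"
    by (rule has_sum_cong_neutral[THEN iffD1, rotated 3]) (auto simp: u0 v0 intro!: gr0I)
  also have "?this \<longleftrightarrow> ((\<lambda>(n,d). u d * v (n div d)) has_sum (dirichlet_sum a s * dirichlet_sum b s)) (SIGMA n:{0<..}. {d. d dvd n})"
    by (rule has_sum_reindex_bij_witness[where i = "\<lambda>(n,d). (d, n div d)" and j = "\<lambda>(m,n). (m * n, m)"])
       (auto elim!: dvdE)
  finally have "((\<lambda>(n,d). u d * v (n div d)) has_sum (dirichlet_sum a s * dirichlet_sum b s)) (SIGMA n:{0<..}. {d. d dvd n})" .
  moreover have "((\<lambda>d. u d * v (n div d)) has_sum (of_real (c n) * of_nat n powr (-s))) {d. d dvd n}" if "n \<in> {0<..}" for n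
  proof (rule has_sum_finiteI)
    show "finite {d. d dvd n}" using that by auto
    have "(of_nat d * of_nat (n div d) :: complex) powr (- s) = of_nat d powr (-s) * of_nat (n div d) powr (-s)" if "d dvd n" for d
      by (rule powr_times_real) auto
    then have "u d * v (n div d) = of_real (a d * b (n div d)) * of_nat n powr (-s)" if "d dvd n" for d
      using that by (simp add: u_def v_def mult_ac flip: of_nat_mult)
    then show "of_real (c n) * of_nat n powr - s = (\<Sum>d\<in>{d. d dvd n}. u d * v (n div d))"
      using c[of n] that by (simp add: sum_distrib_right)
  qed
  ultimately have "((\<lambda>n. of_real (c n) * of_nat n powr (-s) :: complex) has_sum (dirichlet_sum a s * dirichlet_sum b s)) {0<..}"
    by (rule has_sum_SigmaD[where f = "\<lambda>(n,d). u d * v (n div d)", simplified]) 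
  then have "((\<lambda>n. of_real (c n) * of_nat n powr (-s) :: complex) has_sum (dirichlet_sum a s * dirichlet_sum b s)) UNIV"
    by (rule has_sum_cong_neutral[THEN iffD1, rotated 3]) (auto simp: c0)
  then show ?thesis unfolding dirichlet_sum_def by (simp add: has_sum_imp_sums sums_unique)
qed

section \<open>The zeta function and its logarithm\<close>

lemma mangoldt_le_ln: "(mangoldt n :: real) \<le> ln (real n)"
proof (cases "n = 0")
  case False
  have "(mangoldt n :: real) \<le> (\<Sum>d | d dvd n. mangoldt d)"
    using False by (intro member_le_sum) (auto simp: mangoldt_nonneg)
  then show ?thesis using mangoldt_sum[of n, where 'a = real] False by simp
qed auto

lemma ln_of_nat_nonneg: "ln (real n) \<ge> 0"
  by (cases n) auto

abbreviation zeta_sum :: "complex \<Rightarrow> complex" where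
  "zeta_sum \<equiv> dirichlet_sum (\<lambda>_. 1)"

abbreviation mangoldt_series :: "complex \<Rightarrow> complex" where
  "mangoldt_series \<equiv> dirichlet_sum mangoldt"

abbreviation log_zeta :: "complex \<Rightarrow> complex" where
  "log_zeta \<equiv> dirichlet_sum (\<lambda>n. mangoldt n / ln (real n))"

lemma coeff_bounds:
  "\<bar>1 :: real\<bar> \<le> 1 + ln (real n)" "\<bar>mangoldt n\<bar> \<le> 1 + ln (real n)"
  "\<bar>mangoldt n / ln (real n)\<bar> \<le> 1 + ln (real n)" "\<bar>ln (real n)\<bar> \<le> 1 + ln (real n)"
proof -
  have *: "mangoldt n / ln (real n) \<le> 1"
    using mangoldt_le_ln[of n] ln_of_nat_nonneg[of n] by (cases "ln (real n) = 0") (auto simp: divide_le_eq_1)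
  have **: "mangoldt n / ln (real n) \<ge> 0"
    using mangoldt_nonneg[of n] ln_of_nat_nonneg[of n] by simp
  show "\<bar>1 :: real\<bar> \<le> 1 + ln (real n)" "\<bar>mangoldt n\<bar> \<le> 1 + ln (real n)"
     "\<bar>ln (real n)\<bar> \<le> 1 + ln (real n)"
    using mangoldt_le_ln[of n] ln_of_nat_nonneg[of n] by auto
  show "\<bar>mangoldt n / ln (real n)\<bar> \<le> 1 + ln (real n)"
    using * ** ln_of_nat_nonneg[of n] by linarith
qed

lemma mangoldt_div_ln_mult: "mangoldt n / ln (real n) * ln (real n) = mangoldt n"
proof (cases "ln (real n) = 0")
  case True
  then have "n = 0 \<or> n = 1" by (cases "n = 0") auto
  then show ?thesis by auto
qed auto

text \<open>The convolution of the von Mangoldt function with 1 is the logarithm, which makes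
  \<open>mangoldt_series\<close> minus the logarithmic derivative of zeta.\<close>

lemma zeta_sum_deriv:
  assumes "Re s > 1"
  shows "(zeta_sum has_field_derivative - (mangoldt_series s * zeta_sum s)) (at s)"
proof -
  have "mangoldt_series s * zeta_sum s = dirichlet_sum (\<lambda>n. ln (real n)) s"
    using assms coeff_bounds
    by (intro dirichlet_sum_mult) (auto simp: mangoldt_sum)
  then show ?thesis
    using dirichlet_sum_deriv[OF coeff_bounds(1) assms] by simp
qed

lemma log_zeta_deriv:
  assumes "Re s > 1"
  shows "(log_zeta has_field_derivative - mangoldt_series s) (at s)"
  using dirichlet_sum_deriv[OF coeff_bounds(3) assms]
  unfolding mangoldt_div_ln_mult .

text \<open>For n \<ge> 2 and N \<ge> 2 the factor n^(-N) is at most 2^(2 - N) n^(-2), so the terms beyond the first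
  disappear uniformly.\<close>

lemma dirichlet_sum_tendsto_first:
  assumes a: "\<And>n. \<bar>a n\<bar> \<le> 1 + ln (real n)"
  shows "(\<lambda>N. dirichlet_sum a (of_nat N)) \<longlonglongrightarrow> of_real (a 1)"
proof -
  define a' where "a' = (\<lambda>n. if n \<le> 1 then 0 else a n)"
  have a': "\<bar>a' n\<bar> \<le> 1 + ln (real n)" for n using a[of n] by (cases n) (auto simp: a'_def)
  define K where "K = (\<Sum>n. (1 + ln (real n)) * real n powr (-2))"
  have bd: "norm (dirichlet_sum a (of_nat N) - of_real (a 1)) \<le> K * 2 powr (2 - real N)" if N: "N \<ge> 2" for N
  proof -
    have N1: "Re (of_nat N) > 1" using N by simp
    have "(\<lambda>n. if n = 1 then of_real (a 1) * (1::complex) else 0) sums (of_real (a 1))"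
      using sums_single[of 1 "\<lambda>n. of_real (a 1) * (1::complex)"] by simp
    from sums_diff[OF dirichlet_sum_sums[OF a N1] this]
    have "(\<lambda>n. of_real (a n) * of_nat n powr (- of_nat N) - (if n = 1 then of_real (a 1) * 1 else 0)) sums
        (dirichlet_sum a (of_nat N) - of_real (a 1))" .
    also have "(\<lambda>n. of_real (a n) * of_nat n powr (- of_nat N) - (if n = 1 then of_real (a 1) * 1 else 0)) =
       (\<lambda>n. of_real (a' n) * of_nat n powr (- of_nat N :: complex))"
      by (auto simp: a'_def fun_eq_iff le_Suc_eq)
    finally have s: "(\<lambda>n. of_real (a' n) * of_nat n powr (- of_nat N :: complex)) sums
        (dirichlet_sum a (of_nat N) - of_real (a 1))" .
    have le: "norm (of_real (a' n) * of_nat n powr (- of_nat N :: complex)) \<le>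
        ((1 + ln (real n)) * real n powr (-2)) * 2 powr (2 - real N)" for n
    proof (cases "n \<le> 1")
      case False
      have "real n powr (- real N) = real n powr (-2) * real n powr (2 - real N)"
        by (simp flip: powr_add)
      also have "\<dots> \<le> real n powr (-2) * 2 powr (2 - real N)"
        using False N by (intro mult_left_mono powr_mono2') auto
      finally show ?thesis
        using a'[of n] by (auto simp: norm_mult norm_of_nat_powr mult.assoc intro!: mult_mono)
    qed (auto simp: a'_def mult_nonneg_nonneg ln_of_nat_nonneg)
    have sm: "summable (\<lambda>n. ((1 + ln (real n)) * real n powr (-2)) * 2 powr (2 - real N))"
      by (intro summable_mult2 summable_log_powr) auto
    have "norm (\<Sum>n. of_real (a' n) * of_nat n powr (- of_nat N :: complex)) \<le>
       (\<Sum>n. ((1 + ln (real n)) * real n powr (-2)) * 2 powr (2 - real N))"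
      by (rule norm_suminf_le[OF le sm])
    then show ?thesis using s summable_log_powr[of 2] unfolding K_def
      by (simp add: sums_iff suminf_mult2)
  qed
  have "(\<lambda>N. K * 2 powr (2 - real N)) \<longlonglongrightarrow> 0" by real_asymp
  then have "(\<lambda>N. dirichlet_sum a (of_nat N) - of_real (a 1)) \<longlonglongrightarrow> 0"
    by (rule Lim_null_comparison[rotated]) (rule eventually_sequentiallyI[of 2], rule bd)
  then show ?thesis by (simp add: LIM_zero_iff)
qed

text \<open>Both sides have the same logarithmic derivative, so their quotient is constant on the half-plane; it
  tends to 1 along the positive integers. This replaces the Euler product: it shows that zeta has no zeros
  with Re s > 1 and expresses its absolute value through a series with nonnegative coefficients.\<close>

lemma zeta_sum_eq_exp:
  assumes "Re s > 1"
  shows "zeta_sum s = exp (log_zeta s)"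
proof -
  define S where "S = {s. Re s > 1}"
  have "\<exists>c. \<forall>x\<in>S. zeta_sum x * exp (- log_zeta x) = c"
  proof (rule has_field_derivative_zero_constant)
    show "convex S" unfolding S_def by (rule convex_halfspace_Re_gt)
    fix x assume "x \<in> S"
    then have x: "Re x > 1" by (simp add: S_def)
    show "((\<lambda>x. zeta_sum x * exp (- log_zeta x)) has_field_derivative 0) (at x within S)"
      by (rule has_field_derivative_at_within)
         (auto intro!: derivative_eq_intros zeta_sum_deriv[OF x] log_zeta_deriv[OF x])
  qed
  then obtain c where c: "\<And>x. x \<in> S \<Longrightarrow> zeta_sum x * exp (- log_zeta x) = c" by blast
  have "(\<lambda>N. zeta_sum (of_nat N) * exp (- log_zeta (of_nat N))) \<longlonglongrightarrow> of_real 1 * exp (- of_real (mangoldt 1 / ln (real 1)))"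
    by (intro tendsto_intros dirichlet_sum_tendsto_first coeff_bounds)
  moreover have "(\<lambda>N. zeta_sum (of_nat N) * exp (- log_zeta (of_nat N))) \<longlonglongrightarrow> c"
    by (rule tendsto_eventually) (auto intro!: eventually_sequentiallyI[of 2] c simp: S_def)
  ultimately have "c = 1" by (auto dest: LIMSEQ_unique)
  with c[of s] assms have "zeta_sum s * exp (- log_zeta s) = 1" by (auto simp: S_def)
  then show ?thesis by (simp add: exp_minus field_simps)
qed

lemma Re_dirichlet_sum_sums:
  assumes "\<And>n. \<bar>a n\<bar> \<le> 1 + ln (real n)" "Re s > 1"
  shows "(\<lambda>n. a n * real n powr (- Re s) * cos (Im s * ln (real n))) sums Re (dirichlet_sum a s)"
proof -
  have *: "Re (of_real (a n) * of_nat n powr (- s)) = a n * real n powr (- Re s) * cos (Im s * ln (real n))" for n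
  proof (cases "n = 0")
    case False
    have "of_nat n powr (- s) = exp (- s * of_real (ln (real n)))" using False by (simp add: powr_def Ln_of_nat)
    then have "Re (of_nat n powr (- s)) = real n powr (- Re s) * cos (Im s * ln (real n))"
      using False by (simp add: Re_exp powr_def)
    then show ?thesis by simp
  qed auto
  show ?thesis using sums_Re[OF dirichlet_sum_sums[OF assms]] unfolding * .
qed

text \<open>The logarithm of the left-hand side is a series with nonnegative coefficients in front of
  3 + 4 cos v + cos (2 v) = 2 (1 + cos v)^2.\<close>

lemma zeta_3_4_1:
  assumes "\<sigma> > 1"
  shows "norm (zeta_sum (of_real \<sigma>)) ^ 3 * norm (zeta_sum (Complex \<sigma> t)) ^ 4 * norm (zeta_sum (Complex \<sigma> (2 * t))) \<ge> 1"
proof -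
  let ?b = "\<lambda>n. mangoldt n / ln (real n)"
  let ?r = "\<lambda>u. Re (log_zeta (Complex \<sigma> u))"
  have s: "(\<lambda>n. ?b n * real n powr (- \<sigma>) * cos (u * ln (real n))) sums ?r u" for u
    using Re_dirichlet_sum_sums[OF coeff_bounds(3), of "Complex \<sigma> u"] assms by simp
  have "(\<lambda>n. 3 * (?b n * real n powr (- \<sigma>) * cos (0 * ln (real n))) +
      4 * (?b n * real n powr (- \<sigma>) * cos (t * ln (real n))) + ?b n * real n powr (- \<sigma>) * cos (2 * t * ln (real n)))
      sums (3 * ?r 0 + 4 * ?r t + ?r (2 * t))" (is "?f sums _")
    by (intro sums_add sums_mult s)
  moreover have "?f n \<ge> 0" for n
  proof -
    have "?f n = ?b n * real n powr (- \<sigma>) * (3 + 4 * cos (t * ln (real n)) + cos (2 * (t * ln (real n))))"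
      by (simp add: algebra_simps)
    also have "3 + 4 * cos (t * ln (real n)) + cos (2 * (t * ln (real n))) = 2 * (1 + cos (t * ln (real n)))\<^sup>2"
      unfolding cos_double_cos by (simp add: power2_eq_square algebra_simps)
    finally show ?thesis using mangoldt_nonneg[of n] ln_of_nat_nonneg[of n] by simp
  qed
  ultimately have "3 * ?r 0 + 4 * ?r t + ?r (2 * t) \<ge> 0" using sums_le[OF _ sums_zero, of ?f] by blast
  then have "1 \<le> exp (3 * ?r 0 + 4 * ?r t + ?r (2 * t))" by simp
  also have "\<dots> = exp (?r 0) ^ 3 * exp (?r t) ^ 4 * exp (?r (2 * t))"
    by (simp add: exp_add exp_of_nat_mult[symmetric])
  also have "\<dots> = norm (zeta_sum (Complex \<sigma> 0)) ^ 3 * norm (zeta_sum (Complex \<sigma> t)) ^ 4 * norm (zeta_sum (Complex \<sigma> (2 * t)))"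
    using assms by (simp add: zeta_sum_eq_exp)
  finally show ?thesis by (simp add: complex_of_real_def)
qed

section \<open>Continuation of (s - 1) zeta(s) to the half-plane Re s > 0\<close>

text \<open>These are the terms of (s - 1) zeta(s) after the telescoping sum of (n + 1)^(1 - s) - n^(1 - s) has been
  added. Each term is an entire function and the remainder of a first-order Taylor expansion of x^(1 - s) at n;
  this gains a factor 1/n, whence convergence for Re s > 0 and no singularity at s = 1.\<close>

definition zeta_term :: "nat \<Rightarrow> complex \<Rightarrow> complex" where
  "zeta_term n s = of_nat (n + 1) powr (1 - s) - of_nat n powr (1 - s) - (1 - s) * of_nat n powr (- s)"

definition zeta_reg :: "complex \<Rightarrow> complex" where
  "zeta_reg s = 1 + (\<Sum>n. zeta_term (Suc n) s)"

text \<open>The Taylor remainder is bounded by the second derivative of x^(1 - s), which is largest at x = n.\<close>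

lemma norm_zeta_term_le:
  assumes n: "n > 0" and s: "Re s > 0"
  shows "norm (zeta_term n s) \<le> norm s * norm (s - 1) * real n powr (- Re s - 1)"
proof -
  define S where "S = closed_segment (of_nat n :: complex) (of_nat (n + 1))"
  define f where "f = (\<lambda>(i::nat) x. if i = 0 then x powr (1 - s) else if i = 1 then (1 - s) * x powr (- s) else (1 - s) * (-s) * x powr (- s - 1))"
  have S: "\<exists>r. x = complex_of_real r \<and> r \<ge> n" if x: "x \<in> S" for x
  proof -
    have "S = closed_segment (complex_of_real (real n)) (complex_of_real (real (n+1)))" by (simp add: S_def)
    also have "\<dots> = complex_of_real ` closed_segment (real n) (real (n+1))" by (rule closed_segment_of_real)
    finally show ?thesis using x by (auto simp: closed_segment_eq_real_ivl)
  qed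
  have "cmod (f 0 (of_nat (n+1)) - (\<Sum>i\<le>(1::nat). f i (of_nat n) * (of_nat (n+1) - of_nat n) ^ i / fact i)) \<le>
      (norm s * norm (s - 1) * real n powr (- Re s - 1)) * cmod (of_nat (n+1) - of_nat n) ^ Suc 1 / fact 1"
  proof (rule complex_Taylor)
    show "convex S" by (simp add: S_def)
    show "of_nat n \<in> S" "of_nat (n + 1) \<in> S" by (auto simp: S_def)
    show "(f i has_field_derivative f (Suc i) x) (at x within S)" if "x \<in> S" "i \<le> 1" for i x
    proof -
      obtain r where r: "x = of_real r" "r \<ge> n" using S[OF \<open>x \<in> S\<close>] by blast
      then have "x \<notin> \<real>\<^sub>\<le>\<^sub>0" using n by (auto simp: nonpos_Reals_of_real_iff)
      note d = has_field_derivative_at_within[OF has_field_derivative_powr[OF this]]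
      consider "i = 0" | "i = 1" using \<open>i \<le> 1\<close> by linarith
      then show ?thesis
      proof cases
        case 1 then show ?thesis using d[of "1 - s"] by (simp add: f_def)
      next
        case 2 then show ?thesis using DERIV_cmult[OF d[of "-s"], of "1 - s"] by (simp add: f_def mult.assoc)
      qed
    qed
    show "cmod (f (Suc 1) x) \<le> norm s * norm (s - 1) * real n powr (- Re s - 1)" if "x \<in> S" for x
    proof -
      obtain r where r: "x = of_real r" "r \<ge> n" using S[OF \<open>x \<in> S\<close>] by blast
      have "cmod (x powr (- s - 1)) = r powr (- Re s - 1)" using r n by (simp add: norm_powr_real_powr)
      also have "\<dots> \<le> real n powr (- Re s - 1)" using r n s by (intro powr_mono2') auto
      finally show ?thesis
        by (simp add: f_def norm_mult mult.assoc norm_minus_commute mult.left_commute mult_left_mono)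
    qed
  qed
  then show ?thesis by (simp add: f_def zeta_term_def algebra_simps)
qed

lemma zeta_reg_holomorphic:
  "zeta_reg holomorphic_on {s. Re s > 0}"
  and zeta_reg_sums: "Re s > 0 \<Longrightarrow> (\<lambda>n. zeta_term (Suc n) s) sums (zeta_reg s - 1)"
proof -
  define S where "S = {s. Re s > 0}"
  have S: "open S" unfolding S_def by (rule open_halfspace_Re_gt)
  have "\<exists>g. \<forall>x \<in> S. ((\<lambda>n. zeta_term (Suc n) x) sums g x) \<and> g field_differentiable (at x)"
  proof (rule series_differentiable_comparison_complex[OF S])
    show "zeta_term (Suc n) field_differentiable (at x)" if "x \<in> S" for n x
    proof -
      have "zeta_term (Suc n) holomorphic_on UNIV" unfolding zeta_term_def by (intro holomorphic_intros)
      then show ?thesis by (auto simp: holomorphic_on_def)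
    qed
    fix x assume x: "x \<in> S"
    define d where "d = Re x / 2"
    have d: "d > 0" using x by (auto simp: d_def S_def)
    define h where "h = (\<lambda>n. complex_of_real ((norm x + d) * (norm x + 1 + d) * real (Suc n) powr (- d - 1)))"
    have "summable (\<lambda>n. real (Suc n) powr (- d - 1))"
      using d by (subst summable_Suc_iff) (simp add: summable_real_powr_iff)
    then have "summable h" unfolding h_def by (intro summable_of_real summable_mult)
    moreover have "range h \<subseteq> \<real>\<^sub>\<ge>\<^sub>0" using d by (auto simp: h_def simp del: of_real_mult of_real_add)
    moreover have "cmod (zeta_term (Suc n) y) \<le> cmod (h n)" if y: "y \<in> ball x d" for n y
    proof -
      have D: "norm (x - y) < d" using y by (simp add: dist_norm)
      have "\<bar>Re (x - y)\<bar> < d" using D abs_Re_le_cmod[of "x - y"] by simp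
      then have Re: "Re y > d" by (auto simp: d_def abs_if field_simps split: if_splits)
      have n1: "norm y \<le> norm x + d" using D norm_triangle_sub[of y x] by (simp add: norm_minus_commute)
      have n2: "norm (y - 1) \<le> norm x + 1 + d" using n1 norm_triangle_ineq4[of y 1] by simp
      have "norm (zeta_term (Suc n) y) \<le> norm y * norm (y - 1) * real (Suc n) powr (- Re y - 1)"
        using Re d by (intro norm_zeta_term_le) auto
      also have "\<dots> \<le> (norm x + d) * (norm x + 1 + d) * real (Suc n) powr (- d - 1)"
        using Re d n1 n2 by (intro mult_mono powr_mono) auto
      also have "\<dots> \<le> cmod (h n)" unfolding h_def norm_of_real by simp
      finally show ?thesis .
    qed
    ultimately show "\<exists>d h. 0 < d \<and> summable h \<and> range h \<subseteq> \<real>\<^sub>\<ge>\<^sub>0 \<and>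
        (\<forall>\<^sub>F n in sequentially. \<forall>y\<in>ball x d \<inter> S. cmod (zeta_term (Suc n) y) \<le> cmod (h n))"
      using d by (intro exI[of _ d] exI[of _ h]) (auto intro!: always_eventually)
  qed blast
  then obtain g where g: "\<And>x. x \<in> S \<Longrightarrow> (\<lambda>n. zeta_term (Suc n) x) sums g x"
    "\<And>x. x \<in> S \<Longrightarrow> g field_differentiable (at x)" by blast
  have eq: "zeta_reg x = 1 + g x" if "x \<in> S" for x
    using g(1)[OF that] by (simp add: zeta_reg_def sums_iff)
  show "(\<lambda>n. zeta_term (Suc n) s) sums (zeta_reg s - 1)" if "Re s > 0"
    using g(1)[of s] eq[of s] that by (simp add: S_def)
  have "g holomorphic_on S" using g(2) by (auto simp: holomorphic_on_def intro: field_differentiable_at_within)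
  then have "(\<lambda>x. 1 + g x) holomorphic_on S" by (intro holomorphic_intros)
  then show "zeta_reg holomorphic_on {s. Re s > 0}"
    using eq unfolding S_def[symmetric] by (subst holomorphic_cong[OF refl eq]) auto
qed

text \<open>The telescoping sum in \<open>zeta_term\<close> converges to -1 when Re s > 1 and cancels the 1 in \<open>zeta_reg\<close>.\<close>

lemma zeta_reg_eq:
  assumes s: "Re s > 1"
  shows "zeta_reg s = (s - 1) * zeta_sum s"
proof -
  have part: "(\<Sum>n<N. zeta_term (Suc n) s) = of_nat (Suc N) powr (1 - s) - 1 + (s - 1) * (\<Sum>n<N. of_nat (Suc n) powr (- s))" for N
    by (induction N) (simp_all add: zeta_term_def algebra_simps)
  have "(\<lambda>n. of_real 1 * of_nat n powr (- s)) sums zeta_sum s"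
    by (rule dirichlet_sum_sums[OF coeff_bounds(1) s])
  then have z: "(\<lambda>n. of_nat (Suc n) powr (- s)) sums zeta_sum s"
    using sums_Suc_iff[of "\<lambda>n. of_nat n powr (- s)"] by (simp add: sums_Suc_iff)
  have "(\<lambda>N. real (Suc N) powr (1 - Re s)) \<longlonglongrightarrow> 0"
    using s by real_asymp
  then have "(\<lambda>N. of_nat (Suc N) powr (1 - s)) \<longlonglongrightarrow> 0"
    by (intro tendsto_norm_zero_cancel[of "\<lambda>N. of_nat (Suc N) powr (1 - s)"]) (simp only: norm_of_nat_powr, simp)
  then have "(\<lambda>N. of_nat (Suc N) powr (1 - s) - 1 + (s - 1) * (\<Sum>n<N. of_nat (Suc n) powr (- s))) \<longlonglongrightarrow> 0 - 1 + (s - 1) * zeta_sum s"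
    using z unfolding sums_def by (intro tendsto_intros)
  moreover have "(\<lambda>N. \<Sum>n<N. zeta_term (Suc n) s) \<longlonglongrightarrow> zeta_reg s - 1"
    using zeta_reg_sums[of s] s unfolding sums_def by simp
  ultimately have "zeta_reg s - 1 = 0 - 1 + (s - 1) * zeta_sum s"
    unfolding part by (rule LIMSEQ_unique[rotated])
  then show ?thesis by (simp add: algebra_simps)
qed

lemma norm_zeta_reg_minus_1_le:
  obtains K where "K \<ge> 1" "\<And>s. Re s \<ge> 1/2 \<Longrightarrow> norm (zeta_reg s - 1) \<le> K * norm s * norm (s - 1)"
proof -
  have sm: "summable (\<lambda>n. real (Suc n) powr (- 3/2))"
    by (subst summable_Suc_iff) (simp add: summable_real_powr_iff)
  define K where "K = (\<Sum>n. real (Suc n) powr (- 3/2))"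
  have "K \<ge> (\<Sum>n<1. real (Suc n) powr (- 3/2))" unfolding K_def by (rule sum_le_suminf[OF sm]) auto
  then have K: "K \<ge> 1" by simp
  moreover have "norm (zeta_reg s - 1) \<le> K * norm s * norm (s - 1)" if s: "Re s \<ge> 1/2" for s
  proof -
    have "norm (\<Sum>n. zeta_term (Suc n) s) \<le> (\<Sum>n. norm s * norm (s - 1) * real (Suc n) powr (- 3/2))"
    proof (rule norm_suminf_le)
      show "summable (\<lambda>n. norm s * norm (s - 1) * real (Suc n) powr (- 3/2))" by (intro summable_mult sm)
      fix n
      have "norm (zeta_term (Suc n) s) \<le> norm s * norm (s - 1) * real (Suc n) powr (- Re s - 1)"
        using s by (intro norm_zeta_term_le) auto
      also have "\<dots> \<le> norm s * norm (s - 1) * real (Suc n) powr (- 3/2)"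
        using s by (intro mult_left_mono powr_mono) auto
      finally show "norm (zeta_term (Suc n) s) \<le> norm s * norm (s - 1) * real (Suc n) powr (- 3/2)" .
    qed
    then show ?thesis unfolding suminf_mult[OF sm] by (simp only: zeta_reg_def K_def mult_ac add_diff_cancel_left')
  qed
  ultimately show thesis by (rule that)
qed

section \<open>Polynomial bounds up to the line Re s = 1\<close>

text \<open>The bound on the function itself comes from \<open>norm_zeta_reg_minus_1_le\<close> on discs of radius 1/2;
  the Cauchy estimates on these discs then bound the derivatives.\<close>

lemma zeta_reg_upper_bounds:
  obtains K where "K \<ge> 1"
    "\<And>s. \<lbrakk>1 \<le> Re s; Re s \<le> 2\<rbrakk> \<Longrightarrow> norm (zeta_reg s) \<le> K * (3 + \<bar>Im s\<bar>) ^ 2"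
    "\<And>s. \<lbrakk>1 \<le> Re s; Re s \<le> 2\<rbrakk> \<Longrightarrow> norm (deriv zeta_reg s) \<le> K * (3 + \<bar>Im s\<bar>) ^ 2"
    "\<And>s. \<lbrakk>1 \<le> Re s; Re s \<le> 2\<rbrakk> \<Longrightarrow> norm (deriv (deriv zeta_reg) s) \<le> K * (3 + \<bar>Im s\<bar>) ^ 2"
proof -
  obtain K where K: "K \<ge> 1" and Kb: "\<And>s. Re s \<ge> 1/2 \<Longrightarrow> norm (zeta_reg s - 1) \<le> K * norm s * norm (s - 1)"
    using norm_zeta_reg_minus_1_le by blast
  have near: "norm (zeta_reg w) < 3 * K * (3 + \<bar>Im s\<bar>) ^ 2"
    if s: "1 \<le> Re s" "Re s \<le> 2" and w: "w \<in> cball s (1/2)" for s w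
  proof -
    have d: "norm (w - s) \<le> 1/2" using w by (simp add: dist_norm norm_minus_commute)
    have "norm s \<le> \<bar>Re s\<bar> + \<bar>Im s\<bar>" by (rule cmod_le)
    then have s1: "norm s \<le> 2 + \<bar>Im s\<bar>" using s by simp
    have "norm (s - 1) \<le> \<bar>Re (s - 1)\<bar> + \<bar>Im (s - 1)\<bar>" by (rule cmod_le)
    then have s2: "norm (s - 1) \<le> 1 + \<bar>Im s\<bar>" using s by simp
    have "norm w \<le> norm s + norm (w - s)" using norm_triangle_ineq[of s "w - s"] by simp
    then have w1: "norm w \<le> 3 + \<bar>Im s\<bar>" using s1 d by simp
    have "norm (w - 1) \<le> norm (s - 1) + norm (w - s)" using norm_triangle_ineq[of "s - 1" "w - s"] by simp
    then have w2: "norm (w - 1) \<le> 3 + \<bar>Im s\<bar>" using s2 d by simp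
    have "\<bar>Re (w - s)\<bar> \<le> 1/2" using abs_Re_le_cmod[of "w - s"] d by linarith
    then have "Re w \<ge> 1/2" using s minus_complex.simps(1)[of w s] by linarith
    from Kb[OF this] have "norm (zeta_reg w - 1) \<le> K * norm w * norm (w - 1)" .
    also have "\<dots> \<le> K * (3 + \<bar>Im s\<bar>) * (3 + \<bar>Im s\<bar>)"
      using K w1 w2 by (intro mult_mono) auto
    finally have "norm (zeta_reg w - 1) \<le> K * (3 + \<bar>Im s\<bar>) ^ 2" by (simp add: power2_eq_square mult.assoc)
    moreover have "norm (zeta_reg w) \<le> 1 + norm (zeta_reg w - 1)"
      using norm_triangle_ineq[of 1 "zeta_reg w - 1"] by simp
    moreover have "1 * 9 \<le> K * (3 + \<bar>Im s\<bar>) ^ 2"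
      using K power_mono[of 3 "3 + \<bar>Im s\<bar>" 2] by (intro mult_mono) auto
    ultimately show ?thesis by linarith
  qed
  have hol: "zeta_reg holomorphic_on cball s (1/2)" if "1 \<le> Re s" for s
  proof (rule holomorphic_on_subset[OF zeta_reg_holomorphic])
    show "cball s (1/2) \<subseteq> {s. Re s > 0}"
    proof
      fix w assume "w \<in> cball s (1/2)"
      then have "norm (s - w) \<le> 1/2" by (simp add: dist_norm)
      then have "\<bar>Re (s - w)\<bar> \<le> 1/2" using abs_Re_le_cmod[of "s - w"] by linarith
      then have "Re w > 0" using that minus_complex.simps(1)[of s w] by linarith
      then show "w \<in> {s. Re s > 0}" by simp
    qed
  qed
  have der: "norm ((deriv ^^ n) zeta_reg s) \<le> fact n * (3 * K * (3 + \<bar>Im s\<bar>) ^ 2) / (1/2) ^ n"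
    if s: "1 \<le> Re s" "Re s \<le> 2" and n: "n > 0" for s n
  proof (rule Cauchy_higher_deriv_bound[where y = 0 and f = zeta_reg])
    show "zeta_reg holomorphic_on ball s (1/2)"
      using hol[OF s(1)] by (rule holomorphic_on_subset) auto
    show "continuous_on (cball s (1/2)) zeta_reg" using hol[OF s(1)] by (rule holomorphic_on_imp_continuous_on)
    show "zeta_reg w \<in> ball 0 (3 * K * (3 + \<bar>Im s\<bar>) ^ 2)" if "w \<in> ball s (1/2)" for w
      using near[OF s, of w] that by simp
  qed (use n in auto)
  have mono: "a * K * (3 + \<bar>Im s\<bar>) ^ 2 \<le> 24 * K * (3 + \<bar>Im s\<bar>) ^ 2" if "a \<le> 24" for s a
    using that K by (intro mult_right_mono) auto
  show thesis
  proof (rule that[of "24 * K"])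
    show "24 * K \<ge> 1" using K by simp
    fix s assume s: "1 \<le> Re s" "Re s \<le> 2"
    show "norm (zeta_reg s) \<le> 24 * K * (3 + \<bar>Im s\<bar>) ^ 2"
      using near[OF s, of s] mono[of 3 s] by simp
    show "norm (deriv zeta_reg s) \<le> 24 * K * (3 + \<bar>Im s\<bar>) ^ 2"
      using der[OF s, of 1] mono[of 6 s] by simp
    show "norm (deriv (deriv zeta_reg) s) \<le> 24 * K * (3 + \<bar>Im s\<bar>) ^ 2"
      using der[OF s, of 2] by (simp add: numeral_2_eq_2)
  qed
qed

text \<open>The 3-4-1 inequality after multiplication by the factors s - 1. A zero at 1 + i t
  with t \<noteq> 0 would make the right-hand side of order (\<sigma> - 1)^4 as \<sigma> tends to 1, while the left-hand side is only of order
  (\<sigma> - 1)^3; \<open>zeta_reg_lower_bound\<close> makes this quantitative.\<close>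

lemma zeta_reg_3_4_1:
  fixes \<sigma> t M1 M2 :: real
  assumes \<sigma>: "\<sigma> > 1"
    and M1: "norm (zeta_reg (of_real \<sigma>)) \<le> M1" and M2: "norm (zeta_reg (Complex \<sigma> (2 * t))) \<le> M2"
  shows "(\<sigma> - 1) ^ 3 * norm (Complex \<sigma> t - 1) ^ 4 * norm (Complex \<sigma> (2 * t) - 1)
           \<le> M1 ^ 3 * norm (zeta_reg (Complex \<sigma> t)) ^ 4 * M2"
proof -
  let ?z0 = "norm (zeta_sum (of_real \<sigma>))" and ?z1 = "norm (zeta_sum (Complex \<sigma> t))" 
    and ?z2 = "norm (zeta_sum (Complex \<sigma> (2 * t)))"
  let ?d0 = "\<sigma> - 1" and ?d1 = "norm (Complex \<sigma> t - 1)" and ?d2 = "norm (Complex \<sigma> (2 * t) - 1)"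
  have r0: "norm (zeta_reg (of_real \<sigma>)) = ?d0 * ?z0"
    using \<sigma> by (simp add: zeta_reg_eq norm_mult) (metis norm_of_real of_real_1 of_real_diff abs_of_pos diff_gt_0_iff_gt)
  have r1: "norm (zeta_reg (Complex \<sigma> t)) = ?d1 * ?z1" 
   and r2: "norm (zeta_reg (Complex \<sigma> (2 * t))) = ?d2 * ?z2"
    using \<sigma> by (simp_all add: zeta_reg_eq norm_mult)
  have "(?d0 ^ 3 * ?d1 ^ 4 * ?d2) * 1 \<le> (?d0 ^ 3 * ?d1 ^ 4 * ?d2) * (?z0 ^ 3 * ?z1 ^ 4 * ?z2)"
    using \<sigma> by (intro mult_left_mono zeta_3_4_1) auto
  also have "\<dots> = (?d0 * ?z0) ^ 3 * (?d1 * ?z1) ^ 4 * (?d2 * ?z2)" by (simp add: power_mult_distrib mult_ac)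
  also have "\<dots> = norm (zeta_reg (of_real \<sigma>)) ^ 3 * norm (zeta_reg (Complex \<sigma> t)) ^ 4 * norm (zeta_reg (Complex \<sigma> (2 * t)))"
    by (simp only: r0 r1 r2)
  also have "\<dots> \<le> M1 ^ 3 * norm (zeta_reg (Complex \<sigma> t)) ^ 4 * M2"
    using M1 M2 order_trans[OF norm_ge_zero M1] by (intro mult_mono power_mono) auto
  finally show ?thesis by simp
qed

text \<open>Away from the real axis the 3-4-1 inequality is effective for Re s \<ge> 1 + \<delta>; the derivative bound
  carries it over to 1 < Re s < 1 + \<delta>, where \<delta> is a small multiple of (3 + |Im s|)^(-10). Near s = 1 the value is
  close to 1, and the remaining region near the real axis stays away from s = 1, so that the 3-4-1 inequality
  yields a positive constant there.\<close>

lemma zeta_reg_lower_bound: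
  obtains c where "c > 0" "\<And>s. \<lbrakk>1 < Re s; Re s \<le> 2\<rbrakk> \<Longrightarrow> norm (zeta_reg s) \<ge> c / (3 + \<bar>Im s\<bar>) ^ 8"
proof -
  obtain K0 where K0: "K0 \<ge> 1" and K0b: "\<And>s. Re s \<ge> 1/2 \<Longrightarrow> norm (zeta_reg s - 1) \<le> K0 * norm s * norm (s - 1)"
    using norm_zeta_reg_minus_1_le by blast
  obtain K where K: "K \<ge> 1"
    and Kb: "\<And>s. \<lbrakk>1 \<le> Re s; Re s \<le> 2\<rbrakk> \<Longrightarrow> norm (zeta_reg s) \<le> K * (3 + \<bar>Im s\<bar>) ^ 2"
    and Kd: "\<And>s. \<lbrakk>1 \<le> Re s; Re s \<le> 2\<rbrakk> \<Longrightarrow> norm (deriv zeta_reg s) \<le> K * (3 + \<bar>Im s\<bar>) ^ 2"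
    using zeta_reg_upper_bounds by metis
  define r where "r = 1 / (8 * K0)"
  have r: "0 < r" "r \<le> 1/8" using K0 by (auto simp: r_def field_simps)
  define t0 where "t0 = r / 2"
  have t0: "0 < t0" "t0 \<le> 1" using r by (auto simp: t0_def)
  define c1 where "c1 = 2 * t0 ^ 5 / ((9 * K) ^ 3 * (4 * K))"
  have c1: "0 < c1" using K t0 by (auto simp: c1_def)
  have c1': "c1 \<le> 1"
  proof -
    have "2 * t0 ^ 5 \<le> 2 * 1" using t0 by (intro mult_left_mono power_le_one) auto
    also have "\<dots> \<le> (9 * 1) ^ 3 * (4 * 1)" by simp
    also have "\<dots> \<le> (9 * K) ^ 3 * (4 * K)" using K by (intro mult_mono power_mono) auto
    finally show ?thesis unfolding c1_def using K by (intro divide_le_eq_1_pos[THEN iffD2]) auto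
  qed
  define c2 where "c2 = c1 / (16 * K ^ 4)"
  have c2: "0 < c2" "c2 \<le> 1"
  proof -
    have "c1 \<le> 16 * K ^ 4" using c1' one_le_power[OF K, of 4] by linarith
    then show "0 < c2" "c2 \<le> 1" using c1 K unfolding c2_def by (auto simp: divide_le_eq)
  qed
  define c where "c = min (1/2) (min (r\<^sup>2 / (100 * K)) (K * c2))"
  have c: "c > 0" "c \<le> 1/2" "c \<le> r\<^sup>2 / (100 * K)" "c \<le> K * c2" using r K c2 by (auto simp: c_def)
  have "norm (zeta_reg s) \<ge> c / (3 + \<bar>Im s\<bar>) ^ 8" if s: "1 < Re s" "Re s \<le> 2" for s
  proof -
    define \<sigma> t where "\<sigma> = Re s" and "t = Im s"
    define \<tau> where "\<tau> = 3 + \<bar>t\<bar>"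
    have s_eq: "s = Complex \<sigma> t" by (simp add: \<sigma>_def t_def)
    have \<sigma>: "1 < \<sigma>" "\<sigma> \<le> 2" using s by (auto simp: \<sigma>_def)
    have \<tau>: "\<tau> \<ge> 3" by (simp add: \<tau>_def)
    have K2: "norm (zeta_reg (Complex x (2 * t))) \<le> 4 * K * \<tau>\<^sup>2" if "1 < x" "x \<le> 2" for x
    proof -
      have "norm (zeta_reg (Complex x (2 * t))) \<le> K * (3 + \<bar>2 * t\<bar>) ^ 2" using Kb[of "Complex x (2 * t)"] that by simp
      also have "\<dots> \<le> K * (2 * \<tau>) ^ 2" using K by (intro mult_left_mono power_mono) (auto simp: \<tau>_def)
      finally show ?thesis by (simp add: power_mult_distrib)
    qed
    have K1: "norm (zeta_reg (complex_of_real x)) \<le> 9 * K" if "1 < x" "x \<le> 2" for x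
      using Kb[of "of_real x"] that by simp
    have le_norm: "\<bar>u\<bar> \<le> norm (Complex x u - 1)" "x - 1 \<le> norm (Complex x u - 1)" for x u
      using abs_Im_le_cmod[of "Complex x u - 1"] abs_Re_le_cmod[of "Complex x u - 1"] by auto
    consider (large) "\<bar>t\<bar> \<ge> t0" | (near) "\<bar>t\<bar> < t0" "norm (s - 1) \<le> r" | (far) "\<bar>t\<bar> < t0" "norm (s - 1) > r"
      by linarith
    then have "norm (zeta_reg s) \<ge> c / \<tau> ^ 8"
    proof cases
      case large
      \<comment> \<open>This choice makes c1 * \<delta>^3 equal to (2 K \<tau>^2 \<delta>)^4 \<tau>^2: the lower bound at 1 + \<delta> is then
        twice the bound K \<tau>^2 \<delta> for the change of the function over a segment of length \<delta>.\<close>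
      define \<delta> where "\<delta> = c2 / \<tau> ^ 10"
      have \<delta>: "0 < \<delta>" using c2 \<tau> by (simp add: \<delta>_def)
      have "\<delta> \<le> c2" unfolding \<delta>_def using c2 \<tau> by (intro divide_le_eq[THEN iffD2]) (auto intro!: mult_le_cancel_left1[THEN iffD2] one_le_power)
      then have \<delta>1: "\<delta> \<le> 1" using c2 by simp
      have main: "norm (zeta_reg (Complex x t)) \<ge> 2 * K * \<tau>\<^sup>2 * \<delta>" if x: "1 + \<delta> \<le> x" "x \<le> 2" for x
      proof -
        have x1: "1 < x" using x \<delta> by simp
        have "\<delta> ^ 3 * t0 ^ 4 * (2 * t0) \<le> (x - 1) ^ 3 * norm (Complex x t - 1) ^ 4 * norm (Complex x (2 * t) - 1)"
          using x \<delta> t0 large le_norm(1)[of t x] le_norm(1)[of "2*t" x] by (intro mult_mono power_mono) auto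
        also have "\<dots> \<le> (9 * K) ^ 3 * norm (zeta_reg (Complex x t)) ^ 4 * (4 * K * \<tau>\<^sup>2)"
          by (rule zeta_reg_3_4_1[OF x1 K1[OF x1 x(2)] K2[OF x1 x(2)]])
        finally have "c1 * \<delta> ^ 3 \<le> norm (zeta_reg (Complex x t)) ^ 4 * \<tau>\<^sup>2"
          using K unfolding c1_def by (simp add: field_simps power_numeral_reduce)
        moreover have "c1 * \<delta> ^ 3 = (2 * K * \<tau>\<^sup>2 * \<delta>) ^ 4 * \<tau>\<^sup>2"
        proof -
          have "c1 = 16 * K ^ 4 * (\<delta> * \<tau> ^ 10)" using K \<tau> by (simp add: \<delta>_def c2_def)
          then have "c1 * \<delta> ^ 3 = 16 * K ^ 4 * \<delta> ^ 4 * \<tau> ^ 10" by (simp add: power_numeral_reduce)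
          also have "\<dots> = (2 * K * \<tau>\<^sup>2 * \<delta>) ^ 4 * \<tau>\<^sup>2" by (simp add: power_numeral_reduce)
          finally show ?thesis .
        qed
        ultimately have "(2 * K * \<tau>\<^sup>2 * \<delta>) ^ 4 \<le> norm (zeta_reg (Complex x t)) ^ 4" using \<tau> by simp
        then show ?thesis by (rule power_le_imp_le_base[where n = 3, unfolded numeral_eq_Suc, simplified]) (auto simp: numeral_eq_Suc)
      qed
      have "norm (zeta_reg s) \<ge> K * \<tau>\<^sup>2 * \<delta>"
      proof (cases "1 + \<delta> \<le> \<sigma>")
        case True
        have "K * \<tau>\<^sup>2 * \<delta> \<le> 2 * K * \<tau>\<^sup>2 * \<delta>" using K \<delta> by simp
        then show ?thesis using main[OF True \<sigma>(2)] unfolding s_eq by linarith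
      next
        case False
        define s1 where "s1 = Complex (1 + \<delta>) t"
        have seg: "1 \<le> Re w \<and> Re w \<le> 2 \<and> Im w = t" if "w \<in> closed_segment s s1" for w
        proof -
          from that obtain u where u: "0 \<le> u" "u \<le> 1" "w = (1 - u) *\<^sub>R s + u *\<^sub>R s1" by (auto simp: in_segment)
          have eq: "Re w = 1 + ((1 - u) * (\<sigma> - 1) + u * \<delta>)" "Im w = t"
          proof -
            have "Re w = (1 - u) * \<sigma> + u * (1 + \<delta>)" "Im w = (1 - u) * t + u * t"
              unfolding u(3) s_eq s1_def by simp_all
            then show "Re w = 1 + ((1 - u) * (\<sigma> - 1) + u * \<delta>)" "Im w = t" by (simp_all add: algebra_simps)
          qed
          have "0 \<le> (1 - u) * (\<sigma> - 1) + u * \<delta>" using u \<sigma> \<delta> by simp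
          moreover have "(1 - u) * (\<sigma> - 1) + u * \<delta> \<le> (1 - u) * 1 + u * 1" using u \<sigma> \<delta>1 by (intro add_mono mult_left_mono) auto
          ultimately show ?thesis using eq by simp
        qed
        have "norm (zeta_reg s - zeta_reg s1) \<le> K * \<tau>\<^sup>2 * norm (s - s1)"
        proof (rule field_differentiable_bound[where S = "closed_segment s s1"])
          fix w assume w: "w \<in> closed_segment s s1"
          have "(zeta_reg has_field_derivative deriv zeta_reg w) (at w)"
            using seg[OF w] by (intro holomorphic_derivI[OF zeta_reg_holomorphic open_halfspace_Re_gt]) auto
          then show "(zeta_reg has_field_derivative deriv zeta_reg w) (at w within closed_segment s s1)"
            by (rule has_field_derivative_at_within)
          show "norm (deriv zeta_reg w) \<le> K * \<tau>\<^sup>2" using Kd[of w] seg[OF w] by (simp add: \<tau>_def)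
        qed auto
        also have "norm (s - s1) = \<bar>\<sigma> - (1 + \<delta>)\<bar>" by (simp add: s_eq s1_def cmod_def)
        also have "\<dots> \<le> \<delta>" using False \<sigma> by simp
        finally have "norm (zeta_reg s - zeta_reg s1) \<le> K * \<tau>\<^sup>2 * \<delta>" using K by (simp add: mult_left_mono)
        moreover have "norm (zeta_reg s1) \<ge> 2 * K * \<tau>\<^sup>2 * \<delta>" unfolding s1_def using \<delta>1 by (intro main) auto
        moreover have "norm (zeta_reg s1) \<le> norm (zeta_reg s) + norm (zeta_reg s - zeta_reg s1)"
          using norm_triangle_ineq4[of "zeta_reg s" "zeta_reg s - zeta_reg s1"] by simp
        ultimately show ?thesis by linarith
      qed
      also have "K * \<tau>\<^sup>2 * \<delta> = K * c2 / \<tau> ^ 8" using \<tau> by (simp add: \<delta>_def field_simps power_numeral_reduce)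
      finally have "K * c2 / \<tau> ^ 8 \<le> norm (zeta_reg s)" .
      moreover have "c / \<tau> ^ 8 \<le> K * c2 / \<tau> ^ 8" using c \<tau> by (intro divide_right_mono) auto
      ultimately show ?thesis by linarith
    next
      case near
      have "norm s \<le> 4" using cmod_le[of s] \<sigma> near t0 by (simp add: \<sigma>_def t_def)
      have "norm (zeta_reg s - 1) \<le> K0 * norm s * norm (s - 1)" using K0b \<sigma> by (simp add: \<sigma>_def)
      also have "\<dots> \<le> K0 * 4 * r" using K0 near \<open>norm s \<le> 4\<close> by (intro mult_mono) auto
      also have "\<dots> = 1/2" using K0 by (simp add: r_def)
      finally have "norm (zeta_reg s) \<ge> 1/2" using norm_triangle_ineq4[of "zeta_reg s" "zeta_reg s - 1"] by simp
      moreover have "c / \<tau> ^ 8 \<le> c" using c \<tau> by (intro divide_le_eq[THEN iffD2]) (auto intro!: mult_le_cancel_left1[THEN iffD2] one_le_power)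
      ultimately show ?thesis using c by linarith
    next
      case far
      have "r < \<bar>\<sigma> - 1\<bar> + \<bar>t\<bar>" using far cmod_le[of "s - 1"] by (simp add: \<sigma>_def t_def)
      then have \<sigma>r: "\<sigma> - 1 \<ge> r / 2" using far \<sigma> by (simp add: t0_def)
      have \<tau>5: "\<tau> ^ 2 \<le> 16" using power_mono[of \<tau> 4 2] far t0 by (simp add: \<tau>_def)
      have e8: "x ^ 8 = x ^ 3 * x ^ 4 * x" and e4: "x ^ 4 = x ^ 3 * x" for x :: real
        by (simp_all add: eval_nat_numeral)
      have "(r / 2) ^ 3 * (r / 2) ^ 4 * (r / 2) \<le> (\<sigma> - 1) ^ 3 * norm (Complex \<sigma> t - 1) ^ 4 * norm (Complex \<sigma> (2 * t) - 1)"
        using \<sigma>r r le_norm(2)[of \<sigma> t] le_norm(2)[of \<sigma> "2*t"] by (intro mult_mono power_mono) auto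
      also have "\<dots> \<le> (9 * K) ^ 3 * norm (zeta_reg (Complex \<sigma> t)) ^ 4 * (4 * K * \<tau>\<^sup>2)"
        by (rule zeta_reg_3_4_1[OF \<sigma>(1) K1[OF \<sigma>] K2[OF \<sigma>]])
      also have "\<dots> \<le> (64 * K) ^ 3 * norm (zeta_reg (Complex \<sigma> t)) ^ 4 * (4 * K * 16)"
        using K \<tau>5 by (intro mult_mono power_mono) auto
      also have "\<dots> = (64 * K) ^ 4 * norm (zeta_reg s) ^ 4"
        unfolding s_eq e4[of "64 * K"] by (simp add: mult_ac)
      finally have "(r / 2) ^ 8 \<le> (64 * K) ^ 4 * norm (zeta_reg s) ^ 4" by (simp only: e8)
      then have "((r / 2) ^ 2) ^ 4 \<le> (64 * K * norm (zeta_reg s)) ^ 4" by (simp add: power_mult_distrib flip: power_mult)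
      then have "(r / 2) ^ 2 \<le> 64 * K * norm (zeta_reg s)"
        by (subst (asm) power_mono_iff) (use K in auto)
      then have "norm (zeta_reg s) \<ge> r\<^sup>2 / (256 * K)" using K by (simp add: field_simps power2_eq_square)
      moreover have "c / \<tau> ^ 8 \<le> c / 3 ^ 8" using c \<tau> by (intro divide_left_mono power_mono) auto
      moreover have "c / 3 ^ 8 \<le> c * (100 / 256)" using c by simp
      moreover have "c * (100 / 256) \<le> r\<^sup>2 / (256 * K)" using c(3) K by (simp add: field_simps)
      ultimately show ?thesis by linarith
    qed
    then show ?thesis by (simp add: \<tau>_def t_def)
  qed
  then show thesis using that[of c] c(1) by blast
qed

text \<open>The difference F(s)/s - 1/(s - 1), where F is the Dirichlet series of the von Mangoldt function, written
  without its removable singularity at s = 1; it is the Laplace transform in \<open>laplace_psi_error\<close>.\<close>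

definition psi_laplace :: "complex \<Rightarrow> complex" where
  "psi_laplace s = (- deriv zeta_reg s / zeta_reg s - 1) / s"

lemma zeta_reg_nonzero: "Re s > 1 \<Longrightarrow> zeta_reg s \<noteq> 0"
  using zeta_sum_eq_exp[of s] by (auto simp: zeta_reg_eq)

text \<open>Logarithmic differentiation of (s - 1) zeta(s).\<close>

lemma psi_laplace_eq:
  assumes s: "Re s > 1"
  shows "mangoldt_series s / s - 1 / (s - 1) = psi_laplace s"
proof -
  have "((\<lambda>s. (s - 1) * zeta_sum s) has_field_derivative (zeta_sum s + (s - 1) * (- (mangoldt_series s * zeta_sum s)))) (at s)"
    by (rule derivative_eq_intros refl zeta_sum_deriv[OF s])+ simp
  then have "(zeta_reg has_field_derivative (zeta_sum s + (s - 1) * (- (mangoldt_series s * zeta_sum s)))) (at s)"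
    by (rule has_field_derivative_transform_within_open[of _ _ _ "{s. Re s > 1}"])
       (use s in \<open>auto simp: zeta_reg_eq open_halfspace_Re_gt\<close>)
  then have d: "deriv zeta_reg s = zeta_sum s + (s - 1) * (- (mangoldt_series s * zeta_sum s))" by (rule DERIV_imp_deriv)
  have "zeta_sum s \<noteq> 0" "s \<noteq> 1" "s \<noteq> 0" using zeta_sum_eq_exp[OF s] s by auto
  then show ?thesis
    by (simp add: psi_laplace_def d zeta_reg_eq[OF s] divide_simps) (simp add: algebra_simps)
qed

lemma psi_laplace_holomorphic: "psi_laplace holomorphic_on {s. Re s > 1}"
proof -
  have h: "zeta_reg holomorphic_on {s. Re s > 1}"
    using zeta_reg_holomorphic by (rule holomorphic_on_subset) auto
  then have "deriv zeta_reg holomorphic_on {s. Re s > 1}"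
    by (intro holomorphic_deriv open_halfspace_Re_gt)
  then show ?thesis unfolding psi_laplace_def
    using h zeta_reg_nonzero by (intro holomorphic_intros open_halfspace_Re_gt) auto
qed

text \<open>The logarithmic derivative of \<open>zeta_reg\<close> is at most of order (3 + |Im s|)^(2 + 8), and its square governs the derivative.\<close>

lemma psi_laplace_bounds:
  obtains C where "C \<ge> 1"
    "\<And>s. \<lbrakk>1 < Re s; Re s \<le> 2\<rbrakk> \<Longrightarrow> norm (psi_laplace s) \<le> C * (3 + \<bar>Im s\<bar>) ^ 20"
    "\<And>s. \<lbrakk>1 < Re s; Re s \<le> 2\<rbrakk> \<Longrightarrow> norm (deriv psi_laplace s) \<le> C * (3 + \<bar>Im s\<bar>) ^ 20"
proof -
  obtain K where K: "K \<ge> 1"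
    and Kd: "\<And>s. \<lbrakk>1 \<le> Re s; Re s \<le> 2\<rbrakk> \<Longrightarrow> norm (deriv zeta_reg s) \<le> K * (3 + \<bar>Im s\<bar>) ^ 2"
    and Kdd: "\<And>s. \<lbrakk>1 \<le> Re s; Re s \<le> 2\<rbrakk> \<Longrightarrow> norm (deriv (deriv zeta_reg) s) \<le> K * (3 + \<bar>Im s\<bar>) ^ 2"
    using zeta_reg_upper_bounds by metis
  obtain c where c: "c > 0" "\<And>s. \<lbrakk>1 < Re s; Re s \<le> 2\<rbrakk> \<Longrightarrow> norm (zeta_reg s) \<ge> c / (3 + \<bar>Im s\<bar>) ^ 8"
    using zeta_reg_lower_bound by metis
  define D where "D = K / c + 1"
  have D: "D \<ge> 1" using K c by (simp add: D_def)
  have quot: "norm (w / zeta_reg s) \<le> D * (3 + \<bar>Im s\<bar>) ^ 10"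
    if s: "1 < Re s" "Re s \<le> 2" and w: "norm w \<le> K * (3 + \<bar>Im s\<bar>) ^ 2" for s w
  proof -
    have "norm (w / zeta_reg s) \<le> (K * (3 + \<bar>Im s\<bar>) ^ 2) / (c / (3 + \<bar>Im s\<bar>) ^ 8)"
      unfolding norm_divide using w c K c(2)[OF s] by (intro frac_le) auto
    also have "\<dots> = (K / c) * (3 + \<bar>Im s\<bar>) ^ 10" by (simp add: field_simps flip: power_add)
    also have "\<dots> \<le> D * (3 + \<bar>Im s\<bar>) ^ 10" unfolding D_def by (intro mult_right_mono) auto
    finally show ?thesis .
  qed
  show thesis
  proof (rule that[of "4 * D\<^sup>2"])
    show "4 * D\<^sup>2 \<ge> 1" using one_le_power[OF D, of 2] by linarith
    fix s assume s: "1 < Re s" "Re s \<le> 2"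
    define \<tau> where "\<tau> = 3 + \<bar>Im s\<bar>"
    have \<tau>: "\<tau> \<ge> 1" by (simp add: \<tau>_def)
    define q1 q2 where "q1 = deriv zeta_reg s / zeta_reg s" and "q2 = deriv (deriv zeta_reg) s / zeta_reg s"
    have q: "norm q1 \<le> D * \<tau> ^ 10" "norm q2 \<le> D * \<tau> ^ 10"
      unfolding q1_def q2_def \<tau>_def using s by (auto intro!: quot Kd Kdd)
    have big: "1 \<le> D * \<tau> ^ 10" using D \<tau> by (intro mult_ge1_I one_le_power)
    have sq: "D * \<tau> ^ 10 \<le> D\<^sup>2 * \<tau> ^ 20"
    proof -
      have "1 * (D * \<tau> ^ 10) \<le> (D * \<tau> ^ 10) * (D * \<tau> ^ 10)" using big by (intro mult_right_mono) auto
      also have "\<dots> = (D * \<tau> ^ 10)\<^sup>2" by (simp only: power2_eq_square)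
      also have "\<dots> = D\<^sup>2 * \<tau> ^ 20" by (simp add: power_mult_distrib flip: power_mult)
      finally show ?thesis by simp
    qed
    have sn: "norm s \<ge> 1" using s complex_Re_le_cmod[of s] by linarith
    have "psi_laplace s = (- q1 - 1) / s" by (simp add: psi_laplace_def q1_def)
    then have "norm (psi_laplace s) = norm (- q1 - 1) / norm s" by (simp only: norm_divide)
    also have "\<dots> \<le> norm (- q1 - 1) / 1" using sn by (intro frac_le) auto
    also have "\<dots> \<le> norm q1 + 1" using norm_triangle_ineq4[of "- q1" 1] by simp
    also have "\<dots> \<le> 4 * (D\<^sup>2 * \<tau> ^ 20)" using q sq big by linarith
    finally show "norm (psi_laplace s) \<le> 4 * D\<^sup>2 * (3 + \<bar>Im s\<bar>) ^ 20" by (simp add: \<tau>_def)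
    have h: "zeta_reg holomorphic_on {s. Re s > 1}"
      using zeta_reg_holomorphic by (rule holomorphic_on_subset) auto
    have d1: "(zeta_reg has_field_derivative deriv zeta_reg s) (at s)"
      using s by (intro holomorphic_derivI[OF h open_halfspace_Re_gt]) auto
    have d2: "(deriv zeta_reg has_field_derivative deriv (deriv zeta_reg) s) (at s)"
      using s by (intro holomorphic_derivI[OF holomorphic_deriv[OF h open_halfspace_Re_gt] open_halfspace_Re_gt]) auto
    have nz: "zeta_reg s \<noteq> 0" "s \<noteq> 0" using zeta_reg_nonzero[of s] s by auto
    have "(psi_laplace has_field_derivative ((- q2 + q1\<^sup>2) / s + (q1 + 1) / s\<^sup>2)) (at s)"
      unfolding psi_laplace_def q1_def q2_def
      by (rule derivative_eq_intros refl d1 d2 nz)+ (use nz in \<open>simp add: divide_simps power2_eq_square, simp add: algebra_simps\<close>)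
    then have "deriv psi_laplace s = (- q2 + q1\<^sup>2) / s + (q1 + 1) / s\<^sup>2" by (rule DERIV_imp_deriv)
    also have "norm \<dots> \<le> norm ((- q2 + q1\<^sup>2) / s) + norm ((q1 + 1) / s\<^sup>2)" by (rule norm_triangle_ineq)
    also have "\<dots> \<le> norm (- q2 + q1\<^sup>2) / 1 + norm (q1 + 1) / 1"
      unfolding norm_divide norm_power using sn by (intro add_mono frac_le) (auto simp: one_le_power)
    also have "\<dots> \<le> norm q2 + (norm q1)\<^sup>2 + (norm q1 + 1)"
      using norm_triangle_ineq[of "-q2" "q1\<^sup>2"] norm_triangle_ineq[of q1 1] by (simp add: norm_power)
    also have "(norm q1)\<^sup>2 \<le> (D * \<tau> ^ 10)\<^sup>2" using q by (intro power_mono) auto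
    also have "(D * \<tau> ^ 10)\<^sup>2 = D\<^sup>2 * \<tau> ^ 20" by (simp add: power_mult_distrib flip: power_mult)
    also have "norm q2 + D\<^sup>2 * \<tau> ^ 20 + (norm q1 + 1) \<le> 4 * (D\<^sup>2 * \<tau> ^ 20)" using q sq big by linarith
    finally show "norm (deriv psi_laplace s) \<le> 4 * D\<^sup>2 * (3 + \<bar>Im s\<bar>) ^ 20" by (simp add: \<tau>_def)
  qed
qed

section \<open>The Laplace transform of the Chebyshev function\<close>

definition psi :: "real \<Rightarrow> real" where
  "psi x = (\<Sum>n | n > 0 \<and> real n \<le> x. mangoldt n)"

lemma finite_nat_le: "finite {n::nat. n > 0 \<and> real n \<le> x}"
  by (rule finite_subset[of _ "{..nat \<lfloor>x\<rfloor>}"]) (auto simp: le_nat_floor)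

lemma psi_mono: "x \<le> y \<Longrightarrow> psi x \<le> psi y"
  unfolding psi_def by (intro sum_mono2 finite_nat_le) (auto simp: mangoldt_nonneg)

lemma psi_nonneg: "psi x \<ge> 0"
  unfolding psi_def by (intro sum_nonneg) (auto simp: mangoldt_nonneg)

text \<open>The fundamental theorem of calculus on a half-line.\<close>

lemma has_bochner_integral_exp_tail:
  fixes s :: complex
  assumes s: "Re s > 0"
  shows "has_bochner_integral lborel (\<lambda>u. indicator {a..} u *\<^sub>R exp (- s * of_real u)) (exp (- s * of_real a) / s)"
proof -
  have nrm: "norm (exp (- s * of_real u)) = exp (- Re s * u)" for u by simp
  have "(\<lambda>x. exp (- Re s * x)) integrable_on {a..}" by (rule integrable_on_exp_minus_to_infinity[OF s])
  then have "(\<lambda>x. exp (- Re s * x)) absolutely_integrable_on {a..}"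
    by (intro nonnegative_absolutely_integrable_1) auto
  then have "set_integrable lborel {a..} (\<lambda>x. exp (- Re s * x))"
    by (simp add: set_integrable_def integrable_completion)
  then have i1: "set_integrable lborel {a..} (\<lambda>u. exp (- s * of_real u))"
    by (rule set_integrable_bound) (auto simp: set_borel_measurable_def)
  then have i2: "set_integrable lborel {a<..} (\<lambda>u. exp (- s * of_real u))"
    by (rule set_integrable_subset) auto
  have "((\<lambda>u. exp (- Re s * u) / norm s) \<longlongrightarrow> 0) at_top" 
  proof -
    have "((\<lambda>u. exp (- a * u) / b) \<longlongrightarrow> 0) at_top" if "a > 0" "b > 0" for a b :: real using that by real_asymp
    moreover have "norm s > 0" using s by auto
    ultimately show ?thesis using s by blast
  qed
  then have "((\<lambda>u. norm (- exp (- s * of_real u) / s)) \<longlongrightarrow> 0) at_top"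
    by (simp only: norm_divide norm_minus_cancel nrm)
  then have B: "((\<lambda>u::real. - exp (- s * of_real u) / s) \<longlongrightarrow> 0) at_top" by (rule tendsto_norm_zero_cancel)
  have "(LBINT x=ereal a..\<infinity>. exp (- s * of_real x)) = 0 - (- exp (- s * of_real a) / s)"
  proof (rule interval_integral_FTC_integrable[where F = "\<lambda>u. - exp (- s * of_real u) / s"])
    show "((\<lambda>u. - exp (- s * of_real u) / s) has_vector_derivative exp (- s * of_real x)) (at x)" for x :: real
    proof -
      have "((\<lambda>z. - exp (- s * z) / s) has_field_derivative exp (- s * of_real x)) (at (of_real x))"
        using s by (auto intro!: derivative_eq_intros)
      then show ?thesis by (rule has_vector_derivative_real_field)
    qed
    have "isCont (\<lambda>u::real. - exp (- s * of_real u) / s) a" using s by (intro continuous_intros) auto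
    then have "((\<lambda>u::real. - exp (- s * of_real u) / s) \<longlongrightarrow> (- exp (- s * of_real a) / s)) (at_right a)"
      unfolding isCont_def filterlim_at_split by blast
    then show "(((\<lambda>u. - exp (- s * of_real u) / s) \<circ> real_of_ereal) \<longlongrightarrow> - exp (- s * of_real a) / s) (at_right (ereal a))"
      by (rule ereal_tendsto_simps1(2)[THEN iffD2])
    show "(((\<lambda>u. - exp (- s * of_real u) / s) \<circ> real_of_ereal) \<longlongrightarrow> 0) (at_left \<infinity>)"
      using B by (rule ereal_tendsto_simps1(3)[THEN iffD2])
  qed (use i2 in \<open>auto\<close>)
  then have v: "(LINT u|lborel. indicator {a<..} u *\<^sub>R exp (- s * of_real u)) = exp (- s * of_real a) / s"
    by (simp add: interval_integral_to_infinity_eq set_lebesgue_integral_def)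
  have "(LINT u|lborel. indicator {a..} u *\<^sub>R exp (- s * of_real u)) = (LINT u|lborel. indicator {a<..} u *\<^sub>R exp (- s * of_real u))"
    using AE_lborel_singleton[of a] by (intro integral_cong_AE) (auto simp: indicator_def elim!: eventually_mono)
  then show ?thesis using i1 v by (simp add: has_bochner_integral_iff set_integrable_def)
qed

lemma psi_exp_eq_suminf:
  "of_real (psi (exp u)) * exp (- s * of_real u) =
     (\<Sum>n. of_real (mangoldt n) * (indicator {ln (real n)..} u *\<^sub>R exp (- s * of_real u :: complex)))"
proof -
  have "(\<Sum>n. of_real (mangoldt n) * (indicator {ln (real n)..} u *\<^sub>R exp (- s * of_real u :: complex))) =
     (\<Sum>n | n > 0 \<and> real n \<le> exp u. of_real (mangoldt n) * (indicator {ln (real n)..} u *\<^sub>R exp (- s * of_real u)))"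
  proof (rule suminf_finite[OF finite_nat_le])
    fix n assume "n \<notin> {n. 0 < n \<and> real n \<le> exp u}"
    then have "n = 0 \<or> exp u < real n" by auto
    then have "n = 0 \<or> u < ln (real n)" by (metis exp_gt_zero exp_less_cancel_iff exp_ln less_trans)
    then show "of_real (mangoldt n) * (indicator {ln (real n)..} u *\<^sub>R exp (- s * of_real u :: complex)) = 0" by auto
  qed
  also have "\<dots> = (\<Sum>n | n > 0 \<and> real n \<le> exp u. of_real (mangoldt n) * exp (- s * of_real u))"
    by (intro sum.cong) (auto simp: ln_le_cancel_iff[symmetric] indicator_def simp del: ln_le_cancel_iff)
  finally show ?thesis by (simp add: psi_def sum_distrib_right)
qed

text \<open>Term by term: psi (exp u) is the sum of the von Mangoldt function over all n with ln n \<le> u, and the integral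
  of exp (- s u) from ln n to infinity is n powr (- s) / s.\<close>

lemma laplace_psi:
  fixes s :: complex
  assumes s: "Re s > 1"
  shows "has_bochner_integral lborel (\<lambda>u. of_real (psi (exp u)) * exp (- s * of_real u)) (mangoldt_series s / s)"
proof -
  define f where "f = (\<lambda>n u. of_real (mangoldt n) * (indicator {ln (real n)..} u *\<^sub>R exp (- s * of_real u :: complex)))"
  have s0: "Re s > 0" using s by simp
  have pw: "exp (- s * of_real (ln (real n))) = of_nat n powr (- s)" if "n > 0" for n
    using that by (simp add: powr_def Ln_of_nat)
  have hb: "has_bochner_integral lborel (f n) (of_real (mangoldt n) * of_nat n powr (- s) / s)" for n
  proof (cases "n > 0")
    case True
    from has_bochner_integral_mult_right[OF has_bochner_integral_exp_tail[OF s0, of "ln (real n)"], of "of_real (mangoldt n)"]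
    show ?thesis unfolding f_def pw[OF True] by simp
  qed (auto simp: f_def)
  have nf: "norm (f n u) = Re (of_real (mangoldt n) * (indicator {ln (real n)..} u *\<^sub>R exp (- complex_of_real (Re s) * of_real u)))" for n u
    by (auto simp: f_def norm_mult indicator_def mangoldt_nonneg Re_exp)
  have hbn: "has_bochner_integral lborel (\<lambda>u. norm (f n u)) (mangoldt n * real n powr (- Re s) / Re s)" for n
  proof (cases "n > 0")
    case True
    have "Re (complex_of_real (Re s)) > 0" using s0 by simp
    from has_bochner_integral_mult_right[OF has_bochner_integral_exp_tail[OF this, of "ln (real n)"], of "of_real (mangoldt n)"]
    have "has_bochner_integral lborel (\<lambda>u. of_real (mangoldt n) * (indicator {ln (real n)..} u *\<^sub>R exp (- complex_of_real (Re s) * of_real u)))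
        (of_real (mangoldt n) * (exp (- complex_of_real (Re s) * of_real (ln (real n))) / complex_of_real (Re s)))" by simp
    from has_bochner_integral_Re[OF this]
    have "has_bochner_integral lborel (\<lambda>u. norm (f n u)) (Re (of_real (mangoldt n) * (exp (- complex_of_real (Re s) * of_real (ln (real n))) / complex_of_real (Re s))))"
      unfolding nf .
    also have "exp (- complex_of_real (Re s) * of_real (ln (real n))) = of_real (real n powr (- Re s))"
      using True by (simp add: powr_def exp_of_real[symmetric])
    also have "Re (of_real (mangoldt n) * (of_real (real n powr (- Re s)) / complex_of_real (Re s))) = mangoldt n * real n powr (- Re s) / Re s"
      by (simp flip: of_real_divide of_real_mult)
    finally show ?thesis .
  qed (auto simp: f_def)
  have int: "integrable lborel (f n)" for n using hb[of n] by (rule integrable.intros)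
  have ae: "AE u in lborel. summable (\<lambda>n. norm (f n u))"
  proof (rule AE_I2)
    fix u
    show "summable (\<lambda>n. norm (f n u))"
    proof (rule summable_finite[OF finite_nat_le[of "exp u"]])
      fix n assume "n \<notin> {n. 0 < n \<and> real n \<le> exp u}"
      then have "n = 0 \<or> exp u < real n" by auto
      then have "n = 0 \<or> u < ln (real n)" by (metis exp_gt_zero exp_less_cancel_iff exp_ln less_trans)
      then show "norm (f n u) = 0" by (auto simp: f_def)
    qed
  qed
  have sm: "summable (\<lambda>n. LINT u|lborel. norm (f n u))"
  proof -
    have "summable (\<lambda>n. norm (of_real (mangoldt n) * of_nat n powr (- s) :: complex) / Re s)"
      by (intro summable_divide summable_norm_dirichlet coeff_bounds s)
    also have "(\<lambda>n. norm (of_real (mangoldt n) * of_nat n powr (- s) :: complex) / Re s) = (\<lambda>n. LINT u|lborel. norm (f n u))"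
      by (intro ext) (simp add: has_bochner_integral_integral_eq[OF hbn] norm_mult norm_of_nat_powr)
    finally show ?thesis .
  qed
  have "integrable lborel (\<lambda>u. \<Sum>n. f n u)" by (rule integrable_suminf[OF int ae sm])
  moreover have "(LINT u|lborel. (\<Sum>n. f n u)) = (\<Sum>n. LINT u|lborel. f n u)" by (rule integral_suminf[OF int ae sm])
  moreover have "(\<Sum>n. LINT u|lborel. f n u) = mangoldt_series s / s"
    unfolding has_bochner_integral_integral_eq[OF hb] using sums_divide[OF dirichlet_sum_sums[OF coeff_bounds(2) s]]
    by (simp add: sums_iff)
  ultimately show ?thesis
    unfolding f_def psi_exp_eq_suminf[symmetric] by (simp add: has_bochner_integral_iff)
qed

definition psi_error :: "real \<Rightarrow> real" where
  "psi_error u = indicator {0..} u * (psi (exp u) * exp (- u) - 1)"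

lemma laplace_psi_error:
  fixes s :: complex
  assumes s: "Re s > 1"
  shows "has_bochner_integral lborel (\<lambda>u. of_real (psi_error u) * exp (- (s - 1) * of_real u)) (psi_laplace s)"
proof -
  have "Re (s - 1) > 0" using s by simp
  from has_bochner_integral_diff[OF laplace_psi[OF s] has_bochner_integral_exp_tail[OF this, of 0]]
  have "has_bochner_integral lborel (\<lambda>u. of_real (psi (exp u)) * exp (- s * of_real u) - indicator {0..} u *\<^sub>R exp (- (s - 1) * of_real u))
      (mangoldt_series s / s - 1 / (s - 1))" by simp
  also have "(\<lambda>u. of_real (psi (exp u)) * exp (- s * of_real u) - indicator {0..} u *\<^sub>R exp (- (s - 1) * of_real u)) =
     (\<lambda>u. of_real (psi_error u) * exp (- (s - 1) * of_real u))"
  proof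
    fix u :: real
    have "psi (exp u) = 0" if "u < 0"
    proof -
      have "exp u < 1" using that by simp
      then have "real n > exp u" if "n > 0" for n using that by linarith
      then have "\<not> (n > 0 \<and> real n \<le> exp u)" for n using not_le by blast
      then have "{n. n > 0 \<and> real n \<le> exp u} = {}" by blast
      then show ?thesis by (simp only: psi_def sum.empty)
    qed
    moreover have "exp (- s * of_real u) = of_real (exp (- u)) * exp (- (s - 1) * of_real u)"
      by (simp add: exp_of_real[symmetric] algebra_simps flip: exp_add)
    ultimately show "of_real (psi (exp u)) * exp (- s * of_real u) - indicator {0..} u *\<^sub>R exp (- (s - 1) * of_real u) =
      of_real (psi_error u) * exp (- (s - 1) * of_real u)"
      by (cases "u \<ge> 0") (auto simp: psi_error_def algebra_simps)
  qed
  finally show ?thesis by (simp only: psi_laplace_eq[OF s])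
qed

lemma psi_error_measurable [measurable]: "psi_error \<in> borel_measurable borel"
proof -
  have "(\<lambda>u. psi (exp u)) \<in> borel_measurable borel" by (intro borel_measurable_mono monoI psi_mono) simp
  then show ?thesis unfolding psi_error_def by measurable
qed

text \<open>The Gaussian weight at y - u is the characteristic function of the standard normal distribution at
  l (y - u). Exchanging the two integrals leaves the Laplace transform on the line Re s = 1 + \<epsilon>.\<close>

lemma gaussian_smoothing_identity:
  fixes \<epsilon> l y :: real
  assumes \<epsilon>: "\<epsilon> > 0"
  shows "integrable lborel (\<lambda>u. psi_error u * exp (- \<epsilon> * u))" (is ?I)
    and "of_real (LINT u|lborel. psi_error u * exp (- \<epsilon> * u) * exp (- (l * (y - u))\<^sup>2 / 2)) =
       (CLINT z|std_normal_distribution. iexp (l * y * z) * psi_laplace (Complex (1 + \<epsilon>) (l * z)))" (is ?E)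
proof -
  define g where "g = (\<lambda>u. psi_error u * exp (- \<epsilon> * u))"
  have gm [measurable]: "g \<in> borel_measurable borel" unfolding g_def by measurable
  have lap: "has_bochner_integral lborel (\<lambda>u. of_real (g u) * iexp (- t * u)) (psi_laplace (Complex (1 + \<epsilon>) t))" for t
  proof -
    have "Re (Complex (1 + \<epsilon>) t) > 1" using \<epsilon> by simp
    from laplace_psi_error[OF this] 
    have "has_bochner_integral lborel (\<lambda>u. of_real (psi_error u) * exp (- (Complex (1 + \<epsilon>) t - 1) * of_real u)) (psi_laplace (Complex (1 + \<epsilon>) t))" .
    also have "(\<lambda>u. of_real (psi_error u) * exp (- (Complex (1 + \<epsilon>) t - 1) * of_real u)) = (\<lambda>u. of_real (g u) * iexp (- t * u))"
    proof
      fix u :: real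
      have "- (Complex (1 + \<epsilon>) t - 1) * of_real u = of_real (- \<epsilon> * u) + \<i> * of_real (- t * u)" by (simp add: complex_eq_iff)
      then have "exp (- (Complex (1 + \<epsilon>) t - 1) * of_real u) = of_real (exp (- \<epsilon> * u)) * iexp (- t * u)"
        by (simp only: exp_add exp_of_real)
      then show "of_real (psi_error u) * exp (- (Complex (1 + \<epsilon>) t - 1) * of_real u) = of_real (g u) * iexp (- t * u)"
        unfolding g_def by simp
    qed
    finally show ?thesis .
  qed
  have "has_bochner_integral lborel (\<lambda>u. complex_of_real (g u)) (psi_laplace (Complex (1 + \<epsilon>) 0))" using lap[of 0] by simp
  then have "integrable lborel (\<lambda>u. Re (complex_of_real (g u)))" by (intro integrable_Re) (rule integrable.intros)
  then have gi: "integrable lborel g" by simp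
  then show ?I by (simp add: g_def)
  interpret N: prob_space std_normal_distribution by (rule prob_space_normal_density) simp
  interpret P: pair_sigma_finite std_normal_distribution lborel ..
  have [measurable_cong]: "sets std_normal_distribution = sets borel" by simp
  have nrm: "norm (of_real (g u) * iexp x) = \<bar>g u\<bar>" for u x by (simp add: norm_mult)
  have I2: "integrable (std_normal_distribution \<Otimes>\<^sub>M lborel) (\<lambda>(z, u). of_real (g u) * iexp (l * (y - u) * z))"
  proof (rule P.Fubini_integrable)
    show "(\<lambda>(z, u). of_real (g u) * iexp (l * (y - u) * z)) \<in> borel_measurable (std_normal_distribution \<Otimes>\<^sub>M lborel)"
      by measurable
    show "integrable std_normal_distribution (\<lambda>z. LINT u|lborel. norm (case (z, u) of (z, u) \<Rightarrow> of_real (g u) * iexp (l * (y - u) * z)))"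
      unfolding prod.case nrm by simp
    have "integrable lborel (\<lambda>u. complex_of_real (g u) * iexp (l * (y - u) * z))" for z
      by (rule Bochner_Integration.integrable_bound[OF gi]) (auto simp: norm_mult)
    then show "AE z in std_normal_distribution. integrable lborel (\<lambda>u. case (z, u) of (z, u) \<Rightarrow> of_real (g u) * iexp (l * (y - u) * z))"
      by simp
  qed
  have "of_real (LINT u|lborel. g u * exp (- (l * (y - u))\<^sup>2 / 2)) = (CLINT u|lborel. of_real (g u * exp (- (l * (y - u))\<^sup>2 / 2)))"
    by (rule integral_complex_of_real[symmetric])
  also have "\<dots> = (CLINT u|lborel. of_real (g u) * (CLINT z|std_normal_distribution. iexp (l * (y - u) * z)))"
  proof (rule Bochner_Integration.integral_cong[OF refl])
    fix u
    have "char std_normal_distribution (l * (y - u)) = of_real (exp (- (l * (y - u))\<^sup>2 / 2))"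
      by (simp add: char_std_normal_distribution)
    then show "of_real (g u * exp (- (l * (y - u))\<^sup>2 / 2)) = of_real (g u) * (CLINT z|std_normal_distribution. iexp (l * (y - u) * z))"
      unfolding char_def by simp
  qed
  also have "\<dots> = (CLINT u|lborel. (CLINT z|std_normal_distribution. of_real (g u) * iexp (l * (y - u) * z)))"
    by (simp only: integral_mult_right_zero)
  also have "\<dots> = (CLINT z|std_normal_distribution. (CLINT u|lborel. of_real (g u) * iexp (l * (y - u) * z)))"
    by (rule P.Fubini_integral[OF I2])
  also have "\<dots> = (CLINT z|std_normal_distribution. iexp (l * y * z) * psi_laplace (Complex (1 + \<epsilon>) (l * z)))"
  proof (rule Bochner_Integration.integral_cong[OF refl])
    fix z
    have "of_real (g u) * iexp (l * (y - u) * z) = iexp (l * y * z) * (of_real (g u) * iexp (- (l * z) * u))" for u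
    proof -
      have "iexp (l * (y - u) * z) = iexp (l * y * z) * iexp (- (l * z) * u)"
        by (simp add: algebra_simps flip: exp_add)
      then show ?thesis by (simp add: mult_ac)
    qed
    then show "(CLINT u|lborel. of_real (g u) * iexp (l * (y - u) * z)) = iexp (l * y * z) * psi_laplace (Complex (1 + \<epsilon>) (l * z))"
      using has_bochner_integral_integral_eq[OF lap[of "l * z"]] by (simp only: integral_mult_right_zero)
  qed
  finally show ?E by (simp only: g_def)
qed

section \<open>Gaussian smoothing\<close>

text \<open>In \<open>gaussian_smoothing_identity\<close> the oscillating factor is iexp (l y z). One
  integration by parts against it gains 1/(l y), and the derivative of the remaining factor is at most
  l^21 times a polynomial in |z| times the normal density. The bound is uniform in \<epsilon> because the bounds of \<open>psi_laplace_bounds\<close> hold up to the line Re s = 1.\<close>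

lemma gaussian_smoothing_bound:
  obtains C where "C \<ge> 0"
    "\<And>\<epsilon> l y. \<lbrakk>0 < \<epsilon>; \<epsilon> \<le> 1; l \<ge> 1; y > 0\<rbrakk> \<Longrightarrow>
       \<bar>LINT u|lborel. psi_error u * exp (- \<epsilon> * u) * normal_density y (1 / l) u\<bar> \<le> C * l ^ 21 / y"
proof -
  obtain C where C: "C \<ge> 1"
    and Cb: "\<And>s. \<lbrakk>1 < Re s; Re s \<le> 2\<rbrakk> \<Longrightarrow> norm (psi_laplace s) \<le> C * (3 + \<bar>Im s\<bar>) ^ 20"
    and Cd: "\<And>s. \<lbrakk>1 < Re s; Re s \<le> 2\<rbrakk> \<Longrightarrow> norm (deriv psi_laplace s) \<le> C * (3 + \<bar>Im s\<bar>) ^ 20"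
    using psi_laplace_bounds by metis
  let ?d = std_normal_density
  have poly_int: "integrable lborel (\<lambda>z. (3 + \<bar>z\<bar>) ^ n * ?d z)" for n
  proof (rule Bochner_Integration.integrable_bound)
    show "integrable lborel (\<lambda>z. 2 ^ n * (3 ^ n * ?d z + ?d z * \<bar>z\<bar> ^ n))"
      by (intro integrable_mult_right Bochner_Integration.integrable_add integrable_std_normal_moment_abs integrable_normal_density) auto
    have "(3 + \<bar>z\<bar>) ^ n \<le> 2 ^ n * (3 ^ n + \<bar>z\<bar> ^ n)" for z :: real
    proof -
      have "(3 + \<bar>z\<bar>) ^ n \<le> (2 * max 3 \<bar>z\<bar>) ^ n" by (intro power_mono) auto
      also have "\<dots> = 2 ^ n * max (3 ^ n) (\<bar>z\<bar> ^ n)" by (auto simp: power_mult_distrib max_def intro!: antisym power_mono)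
      also have "\<dots> \<le> 2 ^ n * (3 ^ n + \<bar>z\<bar> ^ n)" by (intro mult_left_mono) auto
      finally show ?thesis .
    qed
    then have "(3 + \<bar>z\<bar>) ^ n * ?d z \<le> 2 ^ n * (3 ^ n + \<bar>z\<bar> ^ n) * ?d z" for z
      by (intro mult_right_mono) auto
    then show "AE z in lborel. norm ((3 + \<bar>z\<bar>) ^ n * ?d z) \<le> norm (2 ^ n * (3 ^ n * ?d z + ?d z * \<bar>z\<bar> ^ n))"
      by (intro AE_I2) (simp add: algebra_simps abs_mult)
  qed simp
  define M where "M = (LINT z|lborel. (3 + \<bar>z\<bar>) ^ 21 * ?d z)"
  have M0: "M \<ge> 0" unfolding M_def by (intro Bochner_Integration.integral_nonneg) auto
  show thesis
  proof (rule that[of "C * M"])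
    show "C * M \<ge> 0" using C M0 by simp
    fix \<epsilon> l y :: real
    assume \<epsilon>: "0 < \<epsilon>" "\<epsilon> \<le> 1" and l: "l \<ge> 1" and y: "y > 0"
    define a where "a = l * y"
    have a: "a > 0" using l y by (simp add: a_def)
    define w where "w = (\<lambda>z. Complex (1 + \<epsilon>) (l * z))"
    define E where "E = (\<lambda>z. iexp (a * z))"
    define S where "S = (\<lambda>z. complex_of_real (?d z))"
    define S' where "S' = (\<lambda>z. complex_of_real (- z * ?d z))"
    define R where "R = (\<lambda>z. psi_laplace (w z))"
    define R' where "R' = (\<lambda>z. \<i> * of_real l * deriv psi_laplace (w z))"
    have w12: "1 < Re (w z)" "Re (w z) \<le> 2" for z using \<epsilon> by (auto simp: w_def)
    have cont_w: "isCont w z" for z unfolding w_def Complex_eq by (intro continuous_intros)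
    have E': "(E has_vector_derivative (\<i> * of_real a * E z)) (at z)" for z
    proof -
      have "((\<lambda>x. exp (\<i> * (of_real a * x))) has_field_derivative (\<i> * of_real a * exp (\<i> * (of_real a * of_real z)))) (at (of_real z))"
        by (auto intro!: derivative_eq_intros)
      from has_vector_derivative_real_field[OF this] show ?thesis by (simp add: E_def)
    qed
    have S'd: "(S has_vector_derivative S' z) (at z)" for z
    proof -
      have "(?d has_real_derivative (- z * ?d z)) (at z)"
        unfolding std_normal_density_def by (auto intro!: derivative_eq_intros simp: field_simps)
      then show ?thesis unfolding S_def S'_def
        by (simp only: has_vector_derivative_of_real has_real_derivative_iff_has_vector_derivative)
    qed
    have R'd: "(R has_vector_derivative R' z) (at z)" for z
    proof -
      have "(w has_vector_derivative (\<i> * of_real l)) (at z)"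
      proof -
        have "((\<lambda>x. 1 + of_real \<epsilon> + \<i> * (of_real l * x)) has_field_derivative (\<i> * of_real l)) (at (of_real z))"
          by (auto intro!: derivative_eq_intros)
        from has_vector_derivative_real_field[OF this] show ?thesis by (simp add: w_def Complex_eq)
      qed
      moreover have "(psi_laplace has_field_derivative deriv psi_laplace (w z)) (at (w z))"
        using w12 by (intro holomorphic_derivI[OF psi_laplace_holomorphic open_halfspace_Re_gt]) auto
      ultimately have "((psi_laplace \<circ> w) has_vector_derivative (\<i> * of_real l * deriv psi_laplace (w z))) (at z)"
        by (rule field_vector_diff_chain_at)
      then show ?thesis by (simp add: R_def R'_def o_def)
    qed
    have contE: "isCont E z" and contS: "isCont S z" and contR: "isCont R z" for z
      using E' S'd R'd by (auto intro: has_vector_derivative_continuous)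
    have contS': "isCont S' z" for z
      unfolding S'_def using contS[of z] by (simp add: S_def)
    have contR': "isCont R' z" for z
    proof -
      have "continuous_on {s. Re s > 1} (deriv psi_laplace)"
        by (intro holomorphic_on_imp_continuous_on holomorphic_deriv psi_laplace_holomorphic open_halfspace_Re_gt)
      then have "isCont (deriv psi_laplace) (w z)"
        using w12 by (subst (asm) continuous_on_eq_continuous_at[OF open_halfspace_Re_gt]) auto
      then have "isCont (\<lambda>z. deriv psi_laplace (w z)) z" by (rule isCont_o2[OF cont_w])
      then show ?thesis unfolding R'_def by (intro continuous_intros)
    qed
    have pol: "(3 + \<bar>l * z\<bar>) ^ 20 \<le> l ^ 20 * (3 + \<bar>z\<bar>) ^ 20" for z
    proof -
      have "3 + \<bar>l * z\<bar> \<le> l * (3 + \<bar>z\<bar>)" using l by (simp add: abs_mult algebra_simps)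
      then have "(3 + \<bar>l * z\<bar>) ^ 20 \<le> (l * (3 + \<bar>z\<bar>)) ^ 20" by (intro power_mono) auto
      then show ?thesis by (simp add: power_mult_distrib)
    qed
    have polC: "C * (3 + \<bar>l * z\<bar>) ^ 20 \<le> C * (l ^ 20 * (3 + \<bar>z\<bar>) ^ 20)" for z
      using C pol by (intro mult_left_mono) auto
    have Rb: "norm (R z) \<le> C * (l ^ 20 * (3 + \<bar>z\<bar>) ^ 20)" for z
      using Cb[OF w12[of z]] polC[of z] by (simp add: R_def w_def)
    have R'b: "norm (R' z) \<le> l * (C * (l ^ 20 * (3 + \<bar>z\<bar>) ^ 20))" for z
    proof -
      have "norm (deriv psi_laplace (w z)) \<le> C * (l ^ 20 * (3 + \<bar>z\<bar>) ^ 20)"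
        using Cd[OF w12[of z]] polC[of z] by (simp add: w_def)
      then show ?thesis using l by (simp add: R'_def norm_mult mult_left_mono)
    qed
    \<comment> \<open>\<open>f0\<close> is the integrand, and its derivative is \<open>f1\<close> plus i a times \<open>f0\<close>, where \<open>f1\<close> has no factor a.\<close>
    define f1 where "f1 = (\<lambda>z. E z * (S z * R' z + S' z * R z))"
    define f0 where "f0 = (\<lambda>z. E z * (S z * R z))"
    have f0b: "norm (f0 z) \<le> C * l ^ 20 * ((3 + \<bar>z\<bar>) ^ 20 * ?d z)" for z
    proof -
      have "norm (f0 z) = ?d z * norm (R z)" by (simp add: f0_def E_def S_def norm_mult)
      also have "\<dots> \<le> ?d z * (C * (l ^ 20 * (3 + \<bar>z\<bar>) ^ 20))" by (intro mult_left_mono Rb) auto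
      finally show ?thesis by (simp add: mult_ac)
    qed
    have f1b: "norm (f1 z) \<le> C * l ^ 21 * ((3 + \<bar>z\<bar>) ^ 21 * ?d z)" for z
    proof -
      have "norm (f1 z) = norm (S z * R' z + S' z * R z)" by (simp add: f1_def E_def norm_mult)
      also have "\<dots> \<le> norm (S z * R' z) + norm (S' z * R z)" by (rule norm_triangle_ineq)
      also have "\<dots> = ?d z * norm (R' z) + \<bar>z\<bar> * ?d z * norm (R z)" by (simp add: S_def S'_def norm_mult abs_mult)
      also have "\<dots> \<le> ?d z * (l * (C * (l ^ 20 * (3 + \<bar>z\<bar>) ^ 20))) + \<bar>z\<bar> * ?d z * (C * (l ^ 20 * (3 + \<bar>z\<bar>) ^ 20))"
        by (intro add_mono mult_left_mono Rb R'b) auto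
      also have "\<dots> = C * l ^ 20 * (3 + \<bar>z\<bar>) ^ 20 * ?d z * (l + \<bar>z\<bar>)" by (simp add: algebra_simps)
      also have "\<dots> \<le> C * l ^ 20 * (3 + \<bar>z\<bar>) ^ 20 * ?d z * (l * (3 + \<bar>z\<bar>))"
      proof (rule mult_left_mono)
        have "1 * \<bar>z\<bar> \<le> l * \<bar>z\<bar>" using l by (intro mult_right_mono) auto
        then show "l + \<bar>z\<bar> \<le> l * (3 + \<bar>z\<bar>)" using l by (simp add: algebra_simps)
      qed (use C l in auto)
      also have "\<dots> = C * (l ^ 20 * l) * (((3 + \<bar>z\<bar>) ^ 20 * (3 + \<bar>z\<bar>)) * ?d z)" by (simp only: mult_ac)
      also have "\<dots> = C * l ^ 21 * ((3 + \<bar>z\<bar>) ^ 21 * ?d z)" by (simp only: power_Suc2[symmetric]) simp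
      finally show ?thesis .
    qed
    have contf0: "isCont f0 z" and contf1: "isCont f1 z" for z
      unfolding f0_def f1_def using contE contS contR contS' contR' by (auto intro!: continuous_intros)
    have m0 [measurable]: "f0 \<in> borel_measurable borel" and m1 [measurable]: "f1 \<in> borel_measurable borel"
      using contf0 contf1 by (auto intro!: borel_measurable_continuous_onI continuous_at_imp_continuous_on)
    have i0: "integrable lborel f0"
      by (rule Bochner_Integration.integrable_bound[OF integrable_mult_right[OF poly_int[of 20], of "C * l ^ 20"]])
         (use f0b C l in \<open>auto intro!: AE_I2 simp: abs_mult\<close>)
    have i1: "integrable lborel f1"
      by (rule Bochner_Integration.integrable_bound[OF integrable_mult_right[OF poly_int[of 21], of "C * l ^ 21"]])
         (use f1b C l in \<open>auto intro!: AE_I2 simp: abs_mult\<close>)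
    have "((\<lambda>z. (3 + z) ^ 20 * ((1 / sqrt (2 * pi)) * exp (- z\<^sup>2 / 2))) \<longlongrightarrow> 0) at_top" by real_asymp
    then have "((\<lambda>z. (3 + \<bar>z\<bar>) ^ 20 * ((1 / sqrt (2 * pi)) * exp (- z\<^sup>2 / 2))) \<longlongrightarrow> 0) at_top"
      by (rule Lim_transform_eventually) (auto intro: eventually_mono[OF eventually_ge_at_top[of 0]])
    then have lim_top: "((\<lambda>z. (3 + \<bar>z\<bar>) ^ 20 * ?d z) \<longlongrightarrow> 0) at_top" by (simp only: std_normal_density_def)
    then have lim_bot: "((\<lambda>z. (3 + \<bar>z\<bar>) ^ 20 * ?d z) \<longlongrightarrow> 0) at_bot"
      by (subst filterlim_at_bot_mirror) (simp add: std_normal_density_def)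
    have lim0: "(f0 \<longlongrightarrow> 0) F" if "((\<lambda>z. (3 + \<bar>z\<bar>) ^ 20 * ?d z) \<longlongrightarrow> 0) F" for F
    proof (rule Lim_null_comparison)
      show "\<forall>\<^sub>F z in F. norm (f0 z) \<le> C * l ^ 20 * ((3 + \<bar>z\<bar>) ^ 20 * ?d z)" using f0b by simp
      show "((\<lambda>z. C * l ^ 20 * ((3 + \<bar>z\<bar>) ^ 20 * ?d z)) \<longlongrightarrow> 0) F" using tendsto_mult_left[OF that, of "C * l ^ 20"] by simp
    qed
    have "(LBINT x=-\<infinity>..\<infinity>. f1 x + \<i> * of_real a * f0 x) = 0 - 0"
    proof (rule interval_integral_FTC_integrable)
      show "(f0 has_vector_derivative f1 x + \<i> * of_real a * f0 x) (at x)" for x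
        using has_vector_derivative_mult[OF E' has_vector_derivative_mult[OF S'd R'd]]
        unfolding f0_def f1_def by (simp add: algebra_simps)
      show "isCont (\<lambda>x. f1 x + \<i> * of_real a * f0 x) x" for x
        using contf0 contf1 by (intro continuous_intros) auto
      show "set_integrable lborel (einterval (- \<infinity>) \<infinity>) (\<lambda>x. f1 x + \<i> * of_real a * f0 x)"
        using i0 i1 by (auto simp: set_integrable_def)
      show "((f0 \<circ> real_of_ereal) \<longlongrightarrow> 0) (at_right (-\<infinity>))" using lim0[OF lim_bot] by (simp add: ereal_tendsto_simps1)
      show "((f0 \<circ> real_of_ereal) \<longlongrightarrow> 0) (at_left \<infinity>)" using lim0[OF lim_top] by (simp add: ereal_tendsto_simps1)
    qed auto
    then have "(CLINT x|lborel. f1 x + \<i> * of_real a * f0 x) = 0"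
      by (simp add: interval_lebesgue_integral_def set_lebesgue_integral_def)
    then have "(CLINT x|lborel. f1 x) + \<i> * of_real a * (CLINT x|lborel. f0 x) = 0"
      using i0 i1 by simp
    then have "\<i> * of_real a * (CLINT x|lborel. f0 x) = - (CLINT x|lborel. f1 x)" by (simp add: eq_neg_iff_add_eq_0 add.commute)
    then have "norm (\<i> * of_real a * (CLINT x|lborel. f0 x)) = norm (CLINT x|lborel. f1 x)" by (simp only: norm_minus_cancel)
    then have "a * norm (CLINT x|lborel. f0 x) = norm (CLINT x|lborel. f1 x)" using a by (simp add: norm_mult)
    also have "\<dots> \<le> (LINT x|lborel. C * l ^ 21 * ((3 + \<bar>x\<bar>) ^ 21 * ?d x))"
      by (rule Bochner_Integration.integral_norm_bound_integral[OF i1 integrable_mult_right[OF poly_int]]) (rule f1b)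
    also have "\<dots> = C * l ^ 21 * M" by (simp add: M_def)
    finally have f0i: "norm (CLINT x|lborel. f0 x) \<le> C * l ^ 21 * M / a" using a by (simp add: field_simps)
    have "(CLINT z|std_normal_distribution. iexp (l * y * z) * psi_laplace (Complex (1 + \<epsilon>) (l * z))) = (CLINT z|std_normal_distribution. E z * R z)"
      by (simp add: E_def R_def w_def a_def)
    also have "\<dots> = (CLINT z|lborel. ?d z *\<^sub>R (E z * R z))"
      using contE contR
      by (intro integral_density) (auto intro!: borel_measurable_continuous_onI continuous_at_imp_continuous_on borel_measurable_times)
    also have "\<dots> = (CLINT z|lborel. f0 z)" by (simp add: f0_def S_def scaleR_conv_of_real mult_ac)
    finally have eq: "of_real (LINT u|lborel. psi_error u * exp (- \<epsilon> * u) * exp (- (l * (y - u))\<^sup>2 / 2)) = (CLINT z|lborel. f0 z)"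
      using gaussian_smoothing_identity(2)[OF \<epsilon>(1), of l y] by (rule trans[rotated])
    have "norm (complex_of_real (LINT u|lborel. psi_error u * exp (- \<epsilon> * u) * exp (- (l * (y - u))\<^sup>2 / 2))) \<le> C * l ^ 21 * M / a"
      unfolding eq by (rule f0i)
    then have Xb: "\<bar>LINT u|lborel. psi_error u * exp (- \<epsilon> * u) * exp (- (l * (y - u))\<^sup>2 / 2)\<bar> \<le> C * l ^ 21 * M / a"
      by (simp only: norm_of_real)
    have "normal_density y (1 / l) u = l / sqrt (2 * pi) * exp (- (l * (y - u))\<^sup>2 / 2)" for u
    proof -
      have "- (u - y)\<^sup>2 / (2 * (1 / l)\<^sup>2) = - (l * (y - u))\<^sup>2 / 2"
        using l by (simp add: power_mult_distrib power_divide power2_commute[of u y])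
      moreover have "sqrt (2 * pi * (1 / l)\<^sup>2) = sqrt (2 * pi) / l"
        using l by (simp add: real_sqrt_mult real_sqrt_divide)
      ultimately show ?thesis by (simp add: normal_density_def)
    qed
    then have Xe: "(LINT u|lborel. psi_error u * exp (- \<epsilon> * u) * normal_density y (1 / l) u) =
       l / sqrt (2 * pi) * (LINT u|lborel. psi_error u * exp (- \<epsilon> * u) * exp (- (l * (y - u))\<^sup>2 / 2))"
      by (simp only: mult.left_commute[of _ "l / sqrt (2 * pi)"] integral_mult_right_zero)
    have "\<bar>LINT u|lborel. psi_error u * exp (- \<epsilon> * u) * normal_density y (1 / l) u\<bar> =
        l / sqrt (2 * pi) * \<bar>LINT u|lborel. psi_error u * exp (- \<epsilon> * u) * exp (- (l * (y - u))\<^sup>2 / 2)\<bar>"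
      unfolding Xe abs_mult using l by simp
    also have "\<dots> \<le> l / sqrt (2 * pi) * (C * l ^ 21 * M / a)"
      using l by (intro mult_left_mono Xb) auto
    also have "\<dots> = (C * M * l ^ 21 / y) * (1 / sqrt (2 * pi))" using l y by (simp add: a_def field_simps)
    also have "\<dots> \<le> (C * M * l ^ 21 / y) * 1"
    proof (rule mult_left_mono)
      have "1 \<le> 2 * pi" using pi_gt3 by linarith
      then show "1 / sqrt (2 * pi) \<le> 1" by simp
    qed (use C M0 l y in auto)
    finally show "\<bar>LINT u|lborel. psi_error u * exp (- \<epsilon> * u) * normal_density y (1 / l) u\<bar> \<le> C * M * l ^ 21 / y" by simp
  qed
qed

section \<open>The prime number theorem with an error term\<close>

text \<open>The inequality of Chebyshev for the normal distribution.\<close>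

lemma normal_density_concentration:
  assumes "\<sigma> > 0" "\<eta> > 0"
  shows "(LINT u|lborel. indicator (- {y-\<eta>..y+\<eta>}) u * normal_density y \<sigma> u) \<le> (\<sigma> / \<eta>)\<^sup>2" (is ?A)
    and "(LINT u|lborel. indicator {y-\<eta>..y+\<eta>} u * normal_density y \<sigma> u) \<ge> 1 - (\<sigma> / \<eta>)\<^sup>2" (is ?B)
proof -
  note [simp] = integrable_normal_density[OF assms(1)]
  have i: "integrable lborel (\<lambda>u. indicator S u * normal_density y \<sigma> u)" if "S \<in> sets borel" for S
    using integrable_mult_indicator[of S lborel "normal_density y \<sigma>"] that by simp
  have "(LINT u|lborel. indicator (- {y-\<eta>..y+\<eta>}) u * normal_density y \<sigma> u) \<le>
      (LINT u|lborel. (1 / \<eta>\<^sup>2) * (normal_density y \<sigma> u * (u - y) ^ 2))"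
  proof (rule integral_mono)
    show "integrable lborel (\<lambda>u. (1 / \<eta>\<^sup>2) * (normal_density y \<sigma> u * (u - y) ^ 2))"
      by (intro integrable_mult_right integrable_normal_moment assms)
    fix u
    have "\<eta>\<^sup>2 \<le> (u - y)\<^sup>2" if "u \<notin> {y-\<eta>..y+\<eta>}"
      using that assms by (subst abs_le_square_iff[symmetric]) auto
    then have "indicator (- {y-\<eta>..y+\<eta>}) u \<le> (1 / \<eta>\<^sup>2) * (u - y)\<^sup>2"
      using assms by (auto simp: indicator_def divide_simps)
    then have "indicator (- {y-\<eta>..y+\<eta>}) u * normal_density y \<sigma> u \<le> (1 / \<eta>\<^sup>2) * (u - y)\<^sup>2 * normal_density y \<sigma> u"
      by (rule mult_right_mono) simp
    then show "indicator (- {y-\<eta>..y+\<eta>}) u * normal_density y \<sigma> u \<le> (1 / \<eta>\<^sup>2) * (normal_density y \<sigma> u * (u - y) ^ 2)"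
      by (simp add: mult_ac)
  qed (simp add: i)
  also have "\<dots> = (\<sigma> / \<eta>)\<^sup>2"
    using integral_normal_moment_even[OF assms(1), of y 1] by (simp add: power_divide)
  finally show A: ?A .
  have "1 = (LINT u|lborel. indicator (- {y-\<eta>..y+\<eta>}) u * normal_density y \<sigma> u + indicator {y-\<eta>..y+\<eta>} u * normal_density y \<sigma> u)"
    unfolding integral_normal_density[OF assms(1), of y, symmetric]
    by (intro Bochner_Integration.integral_cong) (auto simp: indicator_def)
  also have "\<dots> = (LINT u|lborel. indicator (- {y-\<eta>..y+\<eta>}) u * normal_density y \<sigma> u) + (LINT u|lborel. indicator {y-\<eta>..y+\<eta>} u * normal_density y \<sigma> u)"
    by (intro Bochner_Integration.integral_add i) auto
  finally show ?B using A by linarith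
qed

definition psi_ratio :: "real \<Rightarrow> real" where
  "psi_ratio u = psi (exp u) * exp (- u)"

lemma psi_ratio_nonneg: "psi_ratio u \<ge> 0"
  by (simp add: psi_ratio_def psi_nonneg)

text \<open>The monotonicity of psi in the form in which it undoes the smoothing.\<close>

lemma psi_ratio_le: "u \<le> v \<Longrightarrow> psi_ratio u \<le> psi_ratio v * exp (v - u)"
  using mult_right_mono[OF psi_mono[of "exp u" "exp v"], of "exp (- u)"]
  by (simp add: psi_ratio_def exp_diff exp_minus field_simps)

text \<open>The damped Gaussian mean of \<open>psi_ratio\<close> is close to the same mean of the constant 1, because
  \<open>psi_ratio\<close> and 1 differ by \<open>psi_error\<close> on the half-line.\<close>

lemma psi_ratio_smoothed:
  fixes \<epsilon> l y :: real
  assumes C: "\<And>\<epsilon> l y. \<lbrakk>0 < \<epsilon>; \<epsilon> \<le> 1; l \<ge> 1; y > 0\<rbrakk> \<Longrightarrow>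
       \<bar>LINT u|lborel. psi_error u * exp (- \<epsilon> * u) * normal_density y (1 / l) u\<bar> \<le> C * l ^ 21 / y"
    and \<epsilon>: "0 < \<epsilon>" "\<epsilon> \<le> 1" and l: "l \<ge> 1" and y: "y > 0"
  defines "w \<equiv> (\<lambda>u. indicator {0..} u * exp (- \<epsilon> * u) * normal_density y (1 / l) u)"
  shows "integrable lborel w" "integrable lborel (\<lambda>u. psi_ratio u * w u)"
    "\<bar>(LINT u|lborel. psi_ratio u * w u) - (LINT u|lborel. w u)\<bar> \<le> C * l ^ 21 / y"
    "(LINT u|lborel. w u) \<le> 1"
proof -
  have N: "integrable lborel (normal_density y (1 / l))" using l by (intro integrable_normal_density) simp
  have wb: "0 \<le> w u" "w u \<le> normal_density y (1 / l) u" for u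
  proof -
    show "0 \<le> w u" by (simp add: w_def)
    have "indicator {0..} u * exp (- \<epsilon> * u) \<le> 1" using \<epsilon> by (auto simp: indicator_def)
    from mult_right_mono[OF this, of "normal_density y (1 / l) u"] show "w u \<le> normal_density y (1 / l) u" by (simp add: w_def)
  qed
  have [measurable]: "w \<in> borel_measurable borel" unfolding w_def by measurable
  show iw: "integrable lborel w"
    by (rule Bochner_Integration.integrable_bound[OF N]) (use wb in \<open>auto intro!: AE_I2\<close>)
  have "(LINT u|lborel. w u) \<le> (LINT u|lborel. normal_density y (1 / l) u)"
    by (rule integral_mono[OF iw N]) (rule wb)
  then show "(LINT u|lborel. w u) \<le> 1" using l by simp
  have bound: "normal_density y (1 / l) u \<le> 1 / sqrt (2 * pi * (1 / l)\<^sup>2)" for u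
    unfolding normal_density_def by (intro mult_left_le) auto
  have ie: "integrable lborel (\<lambda>u. psi_error u * exp (- \<epsilon> * u) * normal_density y (1 / l) u)"
  proof (rule Bochner_Integration.integrable_bound[OF integrable_mult_right[OF gaussian_smoothing_identity(1)[OF \<epsilon>(1)], of "1 / sqrt (2 * pi * (1 / l)\<^sup>2)"]])
    show "AE u in lborel. norm (psi_error u * exp (- \<epsilon> * u) * normal_density y (1 / l) u)
        \<le> norm (1 / sqrt (2 * pi * (1 / l)\<^sup>2) * (psi_error u * exp (- \<epsilon> * u)))"
    proof (rule AE_I2)
      fix u
      have "\<bar>psi_error u * exp (- \<epsilon> * u)\<bar> * normal_density y (1 / l) u \<le> \<bar>psi_error u * exp (- \<epsilon> * u)\<bar> * (1 / sqrt (2 * pi * (1 / l)\<^sup>2))"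
        by (intro mult_left_mono bound) auto
      moreover have "\<bar>1 / sqrt (2 * pi * (1 / l)\<^sup>2)\<bar> = 1 / sqrt (2 * pi * (1 / l)\<^sup>2)" by (rule abs_of_nonneg) simp
      ultimately show "norm (psi_error u * exp (- \<epsilon> * u) * normal_density y (1 / l) u)
        \<le> norm (1 / sqrt (2 * pi * (1 / l)\<^sup>2) * (psi_error u * exp (- \<epsilon> * u)))"
        by (simp add: abs_mult mult_ac)
    qed
  qed measurable
  have eq: "psi_ratio u * w u = psi_error u * exp (- \<epsilon> * u) * normal_density y (1 / l) u + w u" for u
    by (auto simp: psi_ratio_def psi_error_def w_def indicator_def algebra_simps)
  show i2: "integrable lborel (\<lambda>u. psi_ratio u * w u)"
    unfolding eq by (intro Bochner_Integration.integrable_add ie iw)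
  have "(LINT u|lborel. psi_ratio u * w u) = (LINT u|lborel. psi_error u * exp (- \<epsilon> * u) * normal_density y (1 / l) u) + (LINT u|lborel. w u)"
    unfolding eq by (intro Bochner_Integration.integral_add ie iw)
  then show "\<bar>(LINT u|lborel. psi_ratio u * w u) - (LINT u|lborel. w u)\<bar> \<le> C * l ^ 21 / y"
    using C[OF \<epsilon> l y] by simp
qed

text \<open>If \<open>psi_ratio\<close> is large at y, then by monotonicity of psi it is large on an interval to the right of y, and a
  Gaussian mean centred in that interval shows this; the lower bound works on an interval to the left of y,
  where the upper bound already found controls the tails. All parameters are powers of \<eta> = y powr (-1/84): the intervals have
  half-length \<eta>, the Gaussian has standard deviation \<eta>^2, and the smoothing
  error is of order l^21 / y = \<eta>^(-42) \<eta>^84, hence O(\<eta>). The damping \<epsilon> = 1/y^2 changes the values near y by a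
  factor 1 + O(1/y).\<close>

lemma psi_ratio_asymptotic:
  obtains D y0 where "y0 \<ge> 1" "D \<ge> 0" "\<And>y. y \<ge> y0 \<Longrightarrow> \<bar>psi_ratio y - 1\<bar> \<le> D * y powr (- 1 / 84)"
proof -
  obtain C where C0: "C \<ge> 0" and C: "\<And>\<epsilon> l y. \<lbrakk>0 < \<epsilon>; \<epsilon> \<le> 1; l \<ge> 1; y > 0\<rbrakk> \<Longrightarrow>
       \<bar>LINT u|lborel. psi_error u * exp (- \<epsilon> * u) * normal_density y (1 / l) u\<bar> \<le> C * l ^ 21 / y"
    by (rule gaussian_smoothing_bound, rule that; blast)
  define y0 :: real where "y0 = 10 ^ 84"
  have y0_ge: "y0 \<ge> 1" unfolding y0_def by (rule one_le_power) simp
  define \<eta> where "\<eta> = (\<lambda>y::real. y powr (- 1 / 84))"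
  have params: "0 < \<eta> y \<and> \<eta> y \<le> 1/10 \<and> C * (1 / (\<eta> y)\<^sup>2) ^ 21 / v \<le> 2 * C * \<eta> y \<and> 1 / y \<le> \<eta> y"
    if y: "y \<ge> y0" and v: "v \<ge> y / 2" for y v
  proof -
    have y1: "y \<ge> 1" using y y0_ge by simp
    have e0: "0 < \<eta> y" using y1 by (simp add: \<eta>_def)
    have "\<eta> y \<le> y0 powr (- 1 / 84)" unfolding \<eta>_def using y by (intro powr_mono2') (use y0_ge in auto)
    also have "y0 powr (- 1 / 84) = 1 / 10"
    proof -
      have "y0 = 10 powr 84" unfolding y0_def by (rule powr_numeral[symmetric]) simp
      then have "y0 powr (- 1 / 84) = 10 powr (84 * (- 1 / 84))" by (simp only: powr_powr)
      also have "84 * (- 1 / 84) = (- 1 :: real)" by simp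
      finally show ?thesis by (simp add: powr_minus_divide)
    qed
    finally have e1: "\<eta> y \<le> 1/10" .
    have pw: "\<eta> y ^ n = y powr (- real n / 84)" for n
    proof -
      have "\<eta> y ^ n = (y powr (- 1 / 84)) powr real n" using y1 by (simp add: \<eta>_def powr_realpow)
      also have "\<dots> = y powr ((- 1 / 84) * real n)" by (rule powr_powr)
      also have "(- 1 / 84) * real n = - real n / 84" by simp
      finally show ?thesis .
    qed
    have e84: "1 / y = \<eta> y ^ 84" using y1 by (simp add: pw powr_minus_divide)
    have "C * (1 / (\<eta> y)\<^sup>2) ^ 21 / v \<le> C * (1 / (\<eta> y)\<^sup>2) ^ 21 / (y / 2)"
      using v y1 C0 e0 by (intro divide_left_mono) auto
    also have "\<dots> = 2 * C * ((1 / (\<eta> y) ^ 42) * (1 / y))" by (simp add: power_divide flip: power_mult)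
    also have "\<dots> = 2 * C * \<eta> y ^ 42" unfolding e84 using e0 by (simp add: field_simps flip: power_add)
    also have "\<dots> \<le> 2 * C * \<eta> y ^ 1" using e0 e1 C0 by (intro mult_left_mono power_decreasing) auto
    finally have A: "C * (1 / (\<eta> y)\<^sup>2) ^ 21 / v \<le> 2 * C * \<eta> y" by simp
    have "1 / y \<le> \<eta> y ^ 1" unfolding e84 using e0 e1 by (intro power_decreasing) auto
    with A e0 e1 show ?thesis by simp
  qed
  note y01 = y0_ge
  have upper: "psi_ratio y - 1 \<le> (4 * C + 10) * \<eta> y" if y: "y \<ge> y0" for y
  proof -
    define e l \<epsilon> v where "e = \<eta> y" and "l = 1 / e\<^sup>2" and "\<epsilon> = 1 / y\<^sup>2" and "v = y + e"
    have y1: "y \<ge> 1" using y y01 by simp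
    have e: "0 < e" "e \<le> 1/10" "1 / y \<le> e" using params[OF y, of y] y1 by (auto simp: e_def)
    have v: "v \<ge> y / 2" "v > 0" using e y1 by (auto simp: v_def)
    have err: "C * l ^ 21 / v \<le> 2 * C * e" using params[OF y v(1)] by (simp add: e_def l_def)
    have l: "l \<ge> 1" using e by (simp add: l_def power_le_one)
    have \<epsilon>: "0 < \<epsilon>" "\<epsilon> \<le> 1" using y1 by (auto simp: \<epsilon>_def one_le_power)
    define w where "w = (\<lambda>u. indicator {0..} u * exp (- \<epsilon> * u) * normal_density v (1 / l) u)"
    have S: "integrable lborel w" "integrable lborel (\<lambda>u. psi_ratio u * w u)"
      "\<bar>(LINT u|lborel. psi_ratio u * w u) - (LINT u|lborel. w u)\<bar> \<le> C * l ^ 21 / v"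
      "(LINT u|lborel. w u) \<le> 1"
      unfolding w_def by (rule psi_ratio_smoothed[OF C \<epsilon> l v(2)]; assumption)+
    let ?N = "\<lambda>u. indicator {v-e..v+e} u * normal_density v (1 / l) u"
    have "psi_ratio y * exp (- 4 * e) * (LINT u|lborel. ?N u) = (LINT u|lborel. psi_ratio y * exp (- 4 * e) * ?N u)" by simp
    also have "\<dots> \<le> (LINT u|lborel. psi_ratio u * w u)"
    proof (rule integral_mono)
      show "integrable lborel (\<lambda>u. psi_ratio y * exp (- 4 * e) * ?N u)"
        using l integrable_mult_indicator[of "{v-e..v+e}" lborel "normal_density v (1 / l)"] by simp
      show "integrable lborel (\<lambda>u. psi_ratio u * w u)" by (rule S(2))
      fix u
      show "psi_ratio y * exp (- 4 * e) * ?N u \<le> psi_ratio u * w u"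
      proof (cases "u \<in> {v-e..v+e}")
        case True
        then have u: "y \<le> u" "u \<le> y + 2 * e" by (auto simp: v_def)
        have "psi_ratio y \<le> psi_ratio u * exp (u - y)" using u by (intro psi_ratio_le)
        also have "\<dots> \<le> psi_ratio u * exp (2 * e)" using u by (intro mult_left_mono psi_ratio_nonneg) auto
        finally have 1: "psi_ratio y * exp (- 2 * e) \<le> psi_ratio u" by (simp add: exp_minus field_simps)
        have "\<epsilon> * u \<le> 1 / y\<^sup>2 * (2 * y)" unfolding \<epsilon>_def using u e y1 by (intro mult_left_mono) auto
        also have "\<dots> \<le> 2 * e" using e y1 by (simp add: power2_eq_square)
        finally have 2: "exp (- 2 * e) \<le> exp (- \<epsilon> * u)" by simp
        have "psi_ratio y * exp (- 4 * e) = psi_ratio y * exp (- 2 * e) * exp (- 2 * e)" by (simp flip: exp_add)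
        also have "\<dots> \<le> psi_ratio u * exp (- \<epsilon> * u)" by (intro mult_mono 1 2 psi_ratio_nonneg) auto
        finally have "psi_ratio y * exp (- 4 * e) * normal_density v (1 / l) u \<le> psi_ratio u * exp (- \<epsilon> * u) * normal_density v (1 / l) u"
          by (rule mult_right_mono) auto
        then show ?thesis using True u y1 by (simp add: w_def)
      qed (auto simp: psi_ratio_nonneg w_def)
    qed
    also have "\<dots> \<le> 1 + 2 * C * e" using S(3,4) err by linarith
    finally have A: "psi_ratio y * exp (- 4 * e) * (LINT u|lborel. ?N u) \<le> 1 + 2 * C * e" .
    have "1 - e\<^sup>2 \<le> (LINT u|lborel. ?N u)"
      using normal_density_concentration(2)[of "1 / l" e v] e by (simp add: l_def power2_eq_square)
    moreover have "1 - 4 * e \<le> exp (- 4 * e)" using exp_ge_add_one_self[of "- 4 * e"] by simp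
    ultimately have "(1 - 4 * e) * (1 - e\<^sup>2) \<le> exp (- 4 * e) * (LINT u|lborel. ?N u)"
      using e by (intro mult_mono) (auto simp: power_le_one)
    moreover have "1 - 5 * e \<le> (1 - 4 * e) * (1 - e\<^sup>2)"
    proof -
      have "e\<^sup>2 \<le> e * 1" using e unfolding power2_eq_square by (intro mult_left_mono) auto
      moreover have "0 \<le> e * e\<^sup>2" using e by simp
      ultimately show ?thesis by (simp add: algebra_simps)
    qed
    ultimately have "psi_ratio y * (1 - 5 * e) \<le> psi_ratio y * (exp (- 4 * e) * (LINT u|lborel. ?N u))"
      by (intro mult_left_mono psi_ratio_nonneg) auto
    with A have B: "psi_ratio y * (1 - 5 * e) \<le> 1 + 2 * C * e" by (simp add: mult.assoc)
    have "psi_ratio y = psi_ratio y * ((1 - 5 * e) * (1 / (1 - 5 * e)))" using e by simp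
    also have "1 / (1 - 5 * e) \<le> 1 + 10 * e"
    proof -
      have "e * e \<le> e * (1/10)" using e by (intro mult_left_mono) auto
      then show ?thesis using e by (simp add: divide_le_eq algebra_simps)
    qed
    then have "psi_ratio y * ((1 - 5 * e) * (1 / (1 - 5 * e))) \<le> psi_ratio y * ((1 - 5 * e) * (1 + 10 * e))"
      using e by (intro mult_left_mono psi_ratio_nonneg) auto
    also have "\<dots> = psi_ratio y * (1 - 5 * e) * (1 + 10 * e)" by simp
    also have "\<dots> \<le> (1 + 2 * C * e) * (1 + 10 * e)" using B e by (intro mult_right_mono) auto
    also have "\<dots> \<le> 1 + (4 * C + 10) * e"
    proof -
      have "C * e * e \<le> C * e * (1/10)" using e C0 by (intro mult_left_mono) auto
      then show ?thesis by (simp add: algebra_simps)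
    qed
    finally show ?thesis by (simp add: e_def)
  qed
  define H where "H = max (psi (exp y0)) (2 + 4 * C + 10)"
  have H: "psi_ratio u \<le> H" if "u \<ge> 0" for u
  proof (cases "u \<ge> y0")
    case True
    have "(4 * C + 10) * \<eta> u \<le> (4 * C + 10) * 1" using params[OF True, of u] C0 True y01 by (intro mult_left_mono) auto
    then show ?thesis using upper[OF True] by (simp add: H_def)
  next
    case False
    have "psi_ratio u \<le> psi (exp u) * 1" unfolding psi_ratio_def using that by (intro mult_left_mono psi_nonneg) auto
    also have "\<dots> \<le> psi (exp y0)" using False by (simp add: psi_mono)
    finally show ?thesis by (simp add: H_def)
  qed
  have H0: "H \<ge> 0" using C0 by (simp add: H_def)
  have lower: "1 - psi_ratio y \<le> (3 + 2 * C + 5 * H) * \<eta> y" if y: "y \<ge> y0" for y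
  proof -
    define e l \<epsilon> v where "e = \<eta> y" and "l = 1 / e\<^sup>2" and "\<epsilon> = 1 / y\<^sup>2" and "v = y - e"
    have y1: "y \<ge> 1" using y y01 by simp
    have e: "0 < e" "e \<le> 1/10" "1 / y \<le> e" using params[OF y, of y] y1 by (auto simp: e_def)
    have v: "v \<ge> y / 2" "v > 0" using e y1 by (auto simp: v_def)
    have err: "C * l ^ 21 / v \<le> 2 * C * e" using params[OF y v(1)] by (simp add: e_def l_def)
    have l: "l \<ge> 1" using e by (simp add: l_def power_le_one)
    have \<epsilon>: "0 < \<epsilon>" "\<epsilon> \<le> 1" using y1 by (auto simp: \<epsilon>_def one_le_power)
    define w where "w = (\<lambda>u. indicator {0..} u * exp (- \<epsilon> * u) * normal_density v (1 / l) u)"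
    have S: "integrable lborel w" "integrable lborel (\<lambda>u. psi_ratio u * w u)"
      "\<bar>(LINT u|lborel. psi_ratio u * w u) - (LINT u|lborel. w u)\<bar> \<le> C * l ^ 21 / v"
      "(LINT u|lborel. w u) \<le> 1"
      unfolding w_def by (rule psi_ratio_smoothed[OF C \<epsilon> l v(2)]; assumption)+
    let ?N = "\<lambda>u. indicator {v-e..v+e} u * normal_density v (1 / l) u"
    let ?N' = "\<lambda>u. indicator (- {v-e..v+e}) u * normal_density v (1 / l) u"
    have iN: "integrable lborel ?N" "integrable lborel ?N'" "integrable lborel (normal_density v (1 / l))"
      using l integrable_mult_indicator[of "{v-e..v+e}" lborel "normal_density v (1 / l)"]
         integrable_mult_indicator[of "- {v-e..v+e}" lborel "normal_density v (1 / l)"] by simp_all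
    have conc: "1 - e\<^sup>2 \<le> (LINT u|lborel. ?N u)" "(LINT u|lborel. ?N' u) \<le> e\<^sup>2"
      using normal_density_concentration[of "1 / l" e v] e by (simp_all add: l_def power2_eq_square)
    have ee: "e\<^sup>2 \<le> e * 1" using e unfolding power2_eq_square by (intro mult_left_mono) auto
    have "(1 - 2 * e) * (1 - e\<^sup>2) \<le> exp (- 2 * e) * (LINT u|lborel. ?N u)"
      using e conc exp_ge_add_one_self[of "- 2 * e"] by (intro mult_mono) (auto simp: power_le_one)
    also have "\<dots> = (LINT u|lborel. exp (- 2 * e) * ?N u)" by simp
    also have "\<dots> \<le> (LINT u|lborel. w u)"
    proof (rule integral_mono)
      show "integrable lborel (\<lambda>u. exp (- 2 * e) * ?N u)" using iN by simp
      show "integrable lborel w" by (rule S(1))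
      fix u
      show "exp (- 2 * e) * ?N u \<le> w u"
      proof (cases "u \<in> {v-e..v+e}")
        case True
        then have u: "0 \<le> u" "u \<le> y" using y1 e by (auto simp: v_def)
        have "\<epsilon> * u \<le> 1 / y\<^sup>2 * (2 * y)" unfolding \<epsilon>_def using u e y1 by (intro mult_left_mono) auto
        also have "\<dots> \<le> 2 * e" using e y1 by (simp add: power2_eq_square)
        finally have "exp (- 2 * e) \<le> exp (- \<epsilon> * u)" by simp
        then have "exp (- 2 * e) * normal_density v (1 / l) u \<le> exp (- \<epsilon> * u) * normal_density v (1 / l) u"
          by (rule mult_right_mono) auto
        then show ?thesis using True u by (simp add: w_def)
      qed (auto simp: w_def)
    qed
    also have "\<dots> \<le> (LINT u|lborel. psi_ratio u * w u) + 2 * C * e" using S(3) err by linarith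
    also have "(LINT u|lborel. psi_ratio u * w u) \<le> (LINT u|lborel. psi_ratio y * exp (2 * e) * normal_density v (1 / l) u + H * ?N' u)"
    proof (rule integral_mono)
      show "integrable lborel (\<lambda>u. psi_ratio u * w u)" by (rule S(2))
      show "integrable lborel (\<lambda>u. psi_ratio y * exp (2 * e) * normal_density v (1 / l) u + H * ?N' u)"
        using iN by (intro Bochner_Integration.integrable_add integrable_mult_right)
      fix u
      have wN: "w u \<le> normal_density v (1 / l) u" "0 \<le> w u"
      proof -
        have "indicator {0..} u * exp (- \<epsilon> * u) \<le> 1" using \<epsilon> by (auto simp: indicator_def)
        from mult_right_mono[OF this, of "normal_density v (1 / l) u"] show "w u \<le> normal_density v (1 / l) u" by (simp add: w_def)
        show "0 \<le> w u" by (simp add: w_def)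
      qed
      show "psi_ratio u * w u \<le> psi_ratio y * exp (2 * e) * normal_density v (1 / l) u + H * ?N' u"
      proof (cases "u \<in> {v-e..v+e}")
        case True
        then have u: "y - 2 * e \<le> u" "u \<le> y" by (auto simp: v_def)
        have "psi_ratio u \<le> psi_ratio y * exp (y - u)" using u by (intro psi_ratio_le)
        also have "\<dots> \<le> psi_ratio y * exp (2 * e)" using u by (intro mult_left_mono psi_ratio_nonneg) auto
        finally have "psi_ratio u * w u \<le> psi_ratio y * exp (2 * e) * normal_density v (1 / l) u"
          using wN by (intro mult_mono) (auto simp: psi_ratio_nonneg)
        then show ?thesis using True by simp
      next
        case False
        have "psi_ratio u * w u \<le> H * normal_density v (1 / l) u"
        proof (cases "u \<ge> 0")
          case True
          then show ?thesis using H[OF True] wN H0 by (intro mult_mono) auto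
        qed (use H0 in \<open>auto simp: w_def\<close>)
        moreover have "0 \<le> psi_ratio y * exp (2 * e) * normal_density v (1 / l) u" by (simp add: psi_ratio_nonneg)
        ultimately show ?thesis using False by simp
      qed
    qed
    also have "(LINT u|lborel. psi_ratio y * exp (2 * e) * normal_density v (1 / l) u + H * ?N' u) = psi_ratio y * exp (2 * e) + H * (LINT u|lborel. ?N' u)"
      using iN l by simp
    also have "H * (LINT u|lborel. ?N' u) \<le> H * e" using conc(2) ee H0 by (intro mult_left_mono) auto
    also have "psi_ratio y * exp (2 * e) \<le> psi_ratio y + H * (4 * e)"
    proof -
      have "exp (2 * e) \<le> 1 + 4 * e" using exp_bound_lemma[of "2 * e"] e by simp
      then have "psi_ratio y * exp (2 * e) \<le> psi_ratio y * (1 + 4 * e)" by (intro mult_left_mono psi_ratio_nonneg)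
      moreover have "psi_ratio y * (4 * e) \<le> H * (4 * e)" using H[of y] y1 e by (intro mult_right_mono) auto
      ultimately show ?thesis by (simp add: algebra_simps)
    qed
    finally have "(1 - 2 * e) * (1 - e\<^sup>2) \<le> psi_ratio y + H * (4 * e) + H * e + 2 * C * e" by simp
    moreover have "1 - 3 * e \<le> (1 - 2 * e) * (1 - e\<^sup>2)"
    proof -
      have "0 \<le> e * e\<^sup>2" using e by simp
      with ee show ?thesis by (simp add: algebra_simps)
    qed
    ultimately show ?thesis by (simp add: e_def[symmetric] algebra_simps)
  qed
  show thesis
  proof (rule that[of y0 "13 + 4 * C + 5 * H"])
    fix y assume y: "y \<ge> y0"
    have "0 < \<eta> y" using params[OF y, of y] y y01 by simp
    then have "(4 * C + 10) * \<eta> y \<le> (13 + 4 * C + 5 * H) * \<eta> y" "(3 + 2 * C + 5 * H) * \<eta> y \<le> (13 + 4 * C + 5 * H) * \<eta> y"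
      using C0 H0 by (auto intro!: mult_right_mono)
    with upper[OF y] lower[OF y] show "\<bar>psi_ratio y - 1\<bar> \<le> (13 + 4 * C + 5 * H) * y powr (- 1 / 84)"
      by (simp add: \<eta>_def abs_le_iff)
  qed (use y01 C0 H0 in auto)
qed

text \<open>The values of x for which ln x is below the threshold of \<open>psi_ratio_asymptotic\<close> are absorbed into the constant.\<close>

theorem prime_number_theorem_psi:
  obtains C where "C \<ge> 0" "\<And>x. x \<ge> 2 \<Longrightarrow> \<bar>psi x - x\<bar> \<le> C * x * ln x powr (- 1 / 84)"
proof -
  obtain D y0 where D: "y0 \<ge> 1" "D \<ge> 0" "\<And>y. y \<ge> y0 \<Longrightarrow> \<bar>psi_ratio y - 1\<bar> \<le> D * y powr (- 1 / 84)"
    by (rule psi_ratio_asymptotic, rule that; blast)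
  define C where "C = max D ((psi (exp y0) + 1) * y0 powr (1 / 84))"
  have C0: "C \<ge> 0" using D by (simp add: C_def)
  have "\<bar>psi_ratio y - 1\<bar> \<le> C * y powr (- 1 / 84)" if y: "y > 0" for y
  proof (cases "y \<ge> y0")
    case True
    have "D * y powr (- 1 / 84) \<le> C * y powr (- 1 / 84)" by (intro mult_right_mono) (auto simp: C_def)
    with D(3)[OF True] show ?thesis by linarith
  next
    case False
    have "psi_ratio y \<le> psi (exp y) * 1" unfolding psi_ratio_def using y by (intro mult_left_mono psi_nonneg) auto
    also have "\<dots> \<le> psi (exp y0)" using False by (simp add: psi_mono)
    finally have "\<bar>psi_ratio y - 1\<bar> \<le> (psi (exp y0) + 1) * 1"
      using psi_ratio_nonneg[of y] psi_nonneg[of "exp y0"] by simp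
    also have "\<dots> \<le> (psi (exp y0) + 1) * (y0 powr (1 / 84) * y powr (- 1 / 84))"
    proof (rule mult_left_mono)
      have "y powr (1 / 84) \<le> y0 powr (1 / 84)" using y False by (intro powr_mono2) auto
      then show "1 \<le> y0 powr (1 / 84) * y powr (- 1 / 84)" using y by (simp add: powr_minus_divide field_simps)
    qed (use psi_nonneg[of "exp y0"] in auto)
    also have "\<dots> \<le> C * y powr (- 1 / 84)" unfolding mult.assoc[symmetric] by (intro mult_right_mono) (auto simp: C_def)
    finally show ?thesis .
  qed
  note * = this
  show thesis
  proof (rule that[OF C0])
    fix x :: real assume x: "x \<ge> 2"
    have "psi x - x = x * (psi_ratio (ln x) - 1)" using x by (simp add: psi_ratio_def exp_minus field_simps)
    then have "\<bar>psi x - x\<bar> = x * \<bar>psi_ratio (ln x) - 1\<bar>" using x by (simp add: abs_mult)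
    also have "\<dots> \<le> x * (C * ln x powr (- 1 / 84))" using x by (intro mult_left_mono *) auto
    finally show "\<bar>psi x - x\<bar> \<le> C * x * ln x powr (- 1 / 84)" by (simp add: mult_ac)
  qed
qed

section \<open>Powerful numbers\<close>

text \<open>An even exponent v is 2 (v/2), and an odd exponent v, being at least 3, is 2 ((v - 3)/2) + 3.\<close>

lemma powerful_eq_square_times_cube:
  assumes "powerful n"
  obtains a b :: nat where "n = a\<^sup>2 * b ^ 3"
proof -
  have n: "n > 0" using assms by (simp add: powerful_def)
  let ?v = "\<lambda>p. multiplicity p n"
  define a where "a = (\<Prod>p\<in>prime_factors n. p ^ ((?v p - 3 * (?v p mod 2)) div 2))"
  define b where "b = (\<Prod>p\<in>prime_factors n. p ^ (?v p mod 2))"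
  have "a\<^sup>2 * b ^ 3 = (\<Prod>p\<in>prime_factors n. p ^ (2 * ((?v p - 3 * (?v p mod 2)) div 2) + 3 * (?v p mod 2)))"
    unfolding a_def b_def prod_power_distrib prod.distrib[symmetric]
    by (intro prod.cong) (simp_all add: power_add power_mult[symmetric] mult.commute)
  also have "\<dots> = (\<Prod>p\<in>prime_factors n. p ^ ?v p)"
  proof (rule prod.cong[OF refl])
    fix p assume p: "p \<in> prime_factors n"
    then have "prime p" "p dvd n" by auto
    with assms have "p\<^sup>2 dvd n" by (simp add: powerful_def)
    then have "2 \<le> ?v p" using \<open>prime p\<close> n by (intro multiplicity_geI) (auto simp: prime_nat_iff)
    then have "2 * ((?v p - 3 * (?v p mod 2)) div 2) + 3 * (?v p mod 2) = ?v p"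
    proof (cases "even (?v p)")
      case False
      then obtain k where k: "?v p = 2 * k + 1" by (elim oddE)
      with \<open>2 \<le> ?v p\<close> obtain j where "k = Suc j" by (cases k) auto
      then have "?v p = 2 * j + 3" using k by simp
      then show ?thesis by simp
    qed auto
    then show "p ^ (2 * ((?v p - 3 * (?v p mod 2)) div 2) + 3 * (?v p mod 2)) = p ^ ?v p" by simp
  qed
  also have "\<dots> = n" using n by (simp add: prod_prime_factors)
  finally show thesis using that by metis
qed

text \<open>The exponent 3/4 leaves room on both sides: it exceeds 1/2, the abscissa of convergence, and the
  remaining 1/4 supplies the decay of the tail in \<open>powerful_inverse_tail\<close> and absorbs the number of prime factors.\<close>

lemma powerful_powr_summable: "(\<lambda>l. real l powr (- 3 / 4)) summable_on {l. powerful l}"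
proof -
  have "\<exists>a b. n = a\<^sup>2 * b ^ 3" if "powerful n" for n using that powerful_eq_square_times_cube by metis
  then obtain a b :: "nat \<Rightarrow> nat" where ab: "\<And>n. powerful n \<Longrightarrow> n = (a n)\<^sup>2 * (b n) ^ 3" by metis
  define f where "f = (\<lambda>(i::nat, j::nat). real i powr (- 3 / 2) * real j powr (- 9 / 4))"
  have s: "(\<lambda>n. real n powr c) summable_on UNIV" if "c < -1" for c
    using that by (subst summable_on_UNIV_nonneg_real_iff) (auto simp: summable_real_powr_iff)
  have "(\<lambda>x. norm (f x)) summable_on UNIV \<times> UNIV"
    unfolding Infinite_Sum.abs_summable_on_Sigma_iff f_def
    using s[of "-3/2"] s[of "-9/4"]
    by (auto simp: norm_mult infsum_cmult_right' abs_mult intro!: summable_on_cmult_right summable_on_cmult_left)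
  then have "f summable_on UNIV \<times> UNIV" by (rule abs_summable_summable)
  then have "f summable_on (\<lambda>n. (a n, b n)) ` {l. powerful l}" by (rule summable_on_subset_banach) auto
  moreover have inj: "inj_on (\<lambda>n. (a n, b n)) {l. powerful l}"
    by (rule inj_onI) (metis ab mem_Collect_eq prod.inject)
  ultimately have "(f \<circ> (\<lambda>n. (a n, b n))) summable_on {l. powerful l}" by (simp add: summable_on_reindex)
  also have "?this \<longleftrightarrow> ?thesis"
  proof (rule summable_on_cong)
    fix n assume "n \<in> {l. powerful l}"
    then have n: "powerful n" by simp
    then have pos: "a n > 0" "b n > 0" using ab[OF n] by (auto simp: powerful_def intro!: gr0I)
    have "real n = real (a n) powr 2 * real (b n) powr 3" using pos by (subst ab[OF n]) (simp add: powr_numeral)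
    then have "real n powr (- 3 / 4) = (real (a n) powr 2) powr (- 3 / 4) * (real (b n) powr 3) powr (- 3 / 4)"
      using pos by (simp only: powr_mult powr_ge_zero)
    also have "\<dots> = real (a n) powr (2 * (- 3 / 4)) * real (b n) powr (3 * (- 3 / 4))" by (simp only: powr_powr)
    finally show "(f \<circ> (\<lambda>n. (a n, b n))) n = real n powr (- 3 / 4)" by (simp add: f_def)
  qed
  finally show ?thesis .
qed

definition powerful_sum :: real where
  "powerful_sum = (\<Sum>\<^sub>\<infinity>l | powerful l. real l powr (- 3 / 4))"

lemma powerful_sum_nonneg: "powerful_sum \<ge> 0"
  unfolding powerful_sum_def by (intro infsum_nonneg) auto

lemma powerful_finite_sum_le:
  assumes "finite A" "\<And>l. l \<in> A \<Longrightarrow> powerful l" "\<And>l. l \<in> A \<Longrightarrow> f l \<le> K * real l powr (- 3 / 4)" "K \<ge> 0"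
  shows "sum f A \<le> K * powerful_sum"
proof -
  have "sum f A \<le> K * (\<Sum>l\<in>A. real l powr (- 3 / 4))"
    unfolding sum_distrib_left by (intro sum_mono assms)
  also have "(\<Sum>l\<in>A. real l powr (- 3 / 4)) \<le> powerful_sum" unfolding powerful_sum_def
    using assms by (intro finite_sum_le_infsum powerful_powr_summable) auto
  finally show ?thesis using assms(4) by (simp add: mult_left_mono)
qed

lemma powerful_summable_comparison:
  assumes "\<And>l. powerful l \<Longrightarrow> \<bar>f l\<bar> \<le> K * real l powr (- 3 / 4)" "A \<subseteq> {l. powerful l}"
  shows "f summable_on A"
proof -
  have "(\<lambda>l. K * real l powr (- 3 / 4)) summable_on A"
    using assms(2) by (intro summable_on_cmult_right summable_on_subset_banach[OF powerful_powr_summable])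
  then have "(\<lambda>l. norm (f l)) summable_on A"
    by (rule summable_on_comparison_test) (use assms in auto)
  then show ?thesis by (rule abs_summable_summable)
qed

lemma inverse_le_powr_three_quarters: "n > 0 \<Longrightarrow> 1 / real n \<le> real n powr - (3 / 4)"
  using powr_mono[of "-1" "- (3/4)" "real n"] by (simp add: powr_minus_divide)

text \<open>Rankin's trick: the factor (l/Y)^(1/4) is at least 1 on A and leaves the exponent 3/4.\<close>

lemma powerful_inverse_tail:
  assumes "finite A" "\<And>l. l \<in> A \<Longrightarrow> powerful l" "\<And>l. l \<in> A \<Longrightarrow> real l \<ge> Y" "Y > 0"
  shows "(\<Sum>l\<in>A. 1 / real l) \<le> Y powr (- 1 / 4) * powerful_sum"
proof (rule powerful_finite_sum_le[OF assms(1,2)])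
  fix l assume l: "l \<in> A"
  then have "real l > 0" using assms by force
  have "1 / real l = real l powr (- 1 / 4) * real l powr (- 3 / 4)"
    using \<open>real l > 0\<close> by (simp add: powr_minus_divide flip: powr_add)
  also have "\<dots> \<le> Y powr (- 1 / 4) * real l powr (- 3 / 4)"
    using assms l by (intro mult_right_mono powr_mono2') auto
  finally show "1 / real l \<le> Y powr (- 1 / 4) * real l powr (- 3 / 4)" .
qed auto

lemma mangoldt_nonprime_powerful:
  assumes "(mangoldt n :: real) \<noteq> 0" "\<not> prime n"
  shows "powerful n"
proof -
  have "primepow n" using assms(1) by (auto simp: mangoldt_def split: if_splits)
  then obtain p k where pk: "prime p" "k > 0" "n = p ^ k" by (auto simp: primepow_def)
  with assms(2) have k: "k \<ge> 2" by (cases "k = 1") auto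
  have "q\<^sup>2 dvd n" if "prime q" "q dvd n" for q
  proof -
    have "q = p" using that pk by (metis prime_dvd_power primes_dvd_imp_eq)
    then show ?thesis using k pk by (simp add: le_imp_power_dvd)
  qed
  then show ?thesis using pk by (auto simp: powerful_def prime_gt_0_nat)
qed

section \<open>The prime number theorem for theta\<close>

definition primes_le :: "real \<Rightarrow> nat set" where
  "primes_le x = {p. prime p \<and> real p \<le> x}"

lemma finite_primes_le [simp]: "finite (primes_le x)"
  by (rule finite_subset[OF _ finite_nat_le[of x]]) (auto simp: primes_le_def prime_gt_0_nat)

definition theta :: "real \<Rightarrow> real" where
  "theta x = (\<Sum>p\<in>primes_le x. ln (real p))"

text \<open>The difference runs over the proper prime powers, which are powerful and hence sparse.\<close>

lemma psi_minus_theta: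
  assumes "x \<ge> 1"
  shows "theta x \<le> psi x" "psi x \<le> theta x + powerful_sum * ln x * x powr (3 / 4)"
proof -
  let ?A = "{n. n > 0 \<and> real n \<le> x}"
  have sub: "primes_le x \<subseteq> ?A" by (auto simp: primes_le_def prime_gt_0_nat)
  have "psi x = (\<Sum>n\<in>primes_le x. mangoldt n) + (\<Sum>n\<in>?A - primes_le x. mangoldt n)"
    unfolding psi_def using sub by (subst sum.subset_diff[OF sub finite_nat_le]) simp
  also have "(\<Sum>n\<in>primes_le x. mangoldt n) = theta x"
    unfolding theta_def by (intro sum.cong) (auto simp: primes_le_def)
  finally have eq: "psi x = theta x + (\<Sum>n\<in>?A - primes_le x. mangoldt n)" .
  then show "theta x \<le> psi x" by (simp add: sum_nonneg mangoldt_nonneg)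
  have "(\<Sum>n\<in>?A - primes_le x. mangoldt n) = (\<Sum>n\<in>{n\<in>?A - primes_le x. mangoldt n \<noteq> (0::real)}. mangoldt n :: real)"
    by (intro sum.mono_neutral_right) (auto intro: finite_nat_le)
  also have "\<dots> \<le> (ln x * x powr (3 / 4)) * powerful_sum"
  proof (rule powerful_finite_sum_le)
    show "finite {n\<in>?A - primes_le x. mangoldt n \<noteq> (0::real)}" by (auto intro: finite_subset[OF _ finite_nat_le[of x]])
    show "powerful n" if "n \<in> {n\<in>?A - primes_le x. mangoldt n \<noteq> (0::real)}" for n
      using that mangoldt_nonprime_powerful by (auto simp: primes_le_def)
    show "mangoldt n \<le> ln x * x powr (3 / 4) * real n powr (- 3 / 4)" if "n \<in> {n\<in>?A - primes_le x. mangoldt n \<noteq> (0::real)}" for n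
    proof -
      have n: "n > 0" "real n \<le> x" using that by auto
      have "mangoldt n \<le> ln (real n)" by (rule mangoldt_le_ln)
      also have "\<dots> \<le> ln x * 1" using n assms by simp
      also have "\<dots> \<le> ln x * (x powr (3 / 4) * real n powr (- 3 / 4))"
      proof (rule mult_left_mono)
        have "real n powr (3 / 4) \<le> x powr (3 / 4)" using n by (intro powr_mono2) auto
        then show "1 \<le> x powr (3 / 4) * real n powr (- 3 / 4)" using n by (simp add: powr_minus_divide)
      qed (use assms in auto)
      finally show ?thesis by simp
    qed
  qed (use assms in auto)
  finally show "psi x \<le> theta x + powerful_sum * ln x * x powr (3 / 4)" using eq by (simp add: mult_ac)
qed

lemma ln_ln_pos: "x \<ge> 3 \<Longrightarrow> ln (ln x) > 0" "x \<ge> 3 \<Longrightarrow> ln x > (1::real)"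
proof -
  have "exp 1 < (3::real)"
    using exp_le e_less_272 by linarith
  then have "ln (exp 1) < ln (3::real)" by (subst ln_less_cancel_iff) auto
  then have "1 < ln (3::real)" by simp
  moreover assume "x \<ge> 3"
  moreover have "ln 3 \<le> ln x" using \<open>x \<ge> 3\<close> by simp
  ultimately show "ln x > 1" by linarith
  then show "ln (ln x) > 0" by simp
qed

text \<open>A power of log x is saved by the prime number theorem for psi, and more by \<open>psi_minus_theta\<close>; both savings
  are weakened to log log x, which is the precision of the final result.\<close>

lemma theta_asymptotic:
  obtains C where "C \<ge> 0" "\<And>x. x \<ge> 3 \<Longrightarrow> \<bar>theta x - x\<bar> \<le> C * x / ln (ln x)"
     "\<And>x. x \<ge> 0 \<Longrightarrow> theta x \<le> C * x"
proof -
  obtain C where C: "C \<ge> 0" "\<And>x. x \<ge> 2 \<Longrightarrow> \<bar>psi x - x\<bar> \<le> C * x * ln x powr (- 1 / 84)"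
    by (rule prime_number_theorem_psi, rule that; blast)
  have loglog: "ln (ln x) \<le> 84 * ln x powr (1 / 84)" if "x \<ge> 3" for x :: real
    using ln_powr_bound[of "ln x" "1/84"] ln_ln_pos(2)[OF that] by simp
  have logpow: "ln x * x powr (3 / 4) * ln (ln x) \<le> 64 * x" if "x \<ge> 3" for x :: real
  proof -
    have l: "ln x \<le> x powr (1 / 8) / (1 / 8)" using that by (intro ln_powr_bound) auto
    have "ln (ln x) \<le> ln x" using ln_ln_pos(2)[OF that] ln_le_minus_one[of "ln x"] by linarith
    then have "ln (ln x) \<le> 8 * x powr (1 / 8)" using l by simp
    then have "ln x * x powr (3 / 4) * ln (ln x) \<le> (8 * x powr (1 / 8)) * x powr (3 / 4) * (8 * x powr (1 / 8))"
      using l ln_ln_pos[OF that] by (intro mult_mono) auto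
    also have "\<dots> = 64 * x" using that by (simp add: mult_ac flip: powr_add)
    finally show ?thesis .
  qed
  define D where "D = C * 84 + powerful_sum * 64"
  have D0: "D \<ge> 0" using C powerful_sum_nonneg by (simp add: D_def)
  have main: "\<bar>theta x - x\<bar> \<le> D * x / ln (ln x)" if x: "x \<ge> 3" for x
  proof -
    note lp = ln_ln_pos[OF x]
    have "\<bar>theta x - x\<bar> \<le> \<bar>psi x - x\<bar> + powerful_sum * (ln x * x powr (3 / 4))"
      using psi_minus_theta[of x] x by (simp add: mult.assoc abs_le_iff) linarith
    also have "\<dots> \<le> C * x * ln x powr (- 1 / 84) + powerful_sum * (64 * x / ln (ln x))"
      using C(2)[of x] x logpow[OF x] lp powerful_sum_nonneg
      by (intro add_mono mult_left_mono) (auto simp: pos_le_divide_eq)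
    also have "C * x * ln x powr (- 1 / 84) \<le> C * x * (84 / ln (ln x))"
    proof (rule mult_left_mono)
      show "ln x powr (- 1 / 84) \<le> 84 / ln (ln x)"
        using loglog[OF x] lp by (simp add: powr_minus_divide field_simps)
    qed (use C x in auto)
    finally show ?thesis using lp by (simp add: D_def field_simps)
  qed
  define E where "E = D + 1 + D / ln (ln 3) + ln 3"
  have lp3: "ln (ln 3) > (0::real)" "ln 3 > (1::real)" using ln_ln_pos[of 3] by auto
  have E: "theta x \<le> E * x" if x: "x \<ge> 0" for x
  proof -
    consider "x < 2" | "2 \<le> x" "x < 3" | "x \<ge> 3" by linarith
    then show ?thesis
    proof cases
      case 1
      then have "primes_le x = {}" by (auto simp: primes_le_def dest: prime_ge_2_nat)
      then have "theta x = 0" by (simp add: theta_def)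
      then show ?thesis using D0 lp3 x by (simp add: E_def)
    next
      case 2
      have "primes_le x \<subseteq> {2}" using 2 by (auto simp: primes_le_def dest!: prime_ge_2_nat)
      then have "theta x \<le> ln 2" unfolding theta_def
        using sum_mono2[of "{2::nat}" "primes_le x" "\<lambda>p. ln (real p)"] by simp
      also have "\<dots> \<le> ln 3" by simp
      also have "\<dots> \<le> E * 1" using D0 lp3 by (simp add: E_def)
      also have "\<dots> \<le> E * x" using 2 D0 lp3 by (intro mult_left_mono) (auto simp: E_def)
      finally show ?thesis .
    next
      case 3
      have "theta x \<le> x + D * x / ln (ln x)" using main[OF 3] by linarith
      also have "D * x / ln (ln x) \<le> D * x / ln (ln 3)"
        using 3 D0 lp3 ln_ln_pos[OF 3] by (intro divide_left_mono mult_pos_pos) auto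
      also have "x + D * x / ln (ln 3) = (1 + D / ln (ln 3)) * x" by (simp add: field_simps)
      also have "\<dots> \<le> E * x" using 3 D0 lp3 by (intro mult_right_mono) (auto simp: E_def)
      finally show ?thesis by simp
    qed
  qed
  show thesis
  proof (rule that[of E])
    show "E \<ge> 0" using D0 lp3 by (simp add: E_def)
    show "\<bar>theta x - x\<bar> \<le> E * x / ln (ln x)" if "x \<ge> 3" for x
    proof -
      have "D * x / ln (ln x) \<le> E * x / ln (ln x)"
        using that ln_ln_pos[OF that] D0 lp3 by (intro divide_right_mono mult_right_mono) (auto simp: E_def)
      then show ?thesis using main[OF that] by linarith
    qed
  qed (use E in auto)
qed

section \<open>The second theorem of Mertens\<close>

definition prime_recip_sum :: "real \<Rightarrow> real" where
  "prime_recip_sum x = (\<Sum>p\<in>primes_le x. 1 / real p)"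

lemma prime_recip_sum_nonneg: "prime_recip_sum x \<ge> 0"
  unfolding prime_recip_sum_def by (intro sum_nonneg) auto

text \<open>Let s = 1 + 1/ln x. Then log zeta(s) = log log x + O(1), because (s - 1) zeta(s) is bounded above and below,
  and F(s) = O(log x) for the series F of the von Mangoldt function. Replacing p^(-s) by 1/p for p \<le> x, and dropping
  the primes p > x, changes the sum by O(F(s) / log x) = O(1); the proper prime powers contribute O(1).\<close>

theorem mertens_second:
  obtains M where "M \<ge> 0" "\<And>x. x \<ge> 3 \<Longrightarrow> \<bar>prime_recip_sum x - ln (ln x)\<bar> \<le> M"
proof -
  obtain K where K: "K \<ge> 1" "\<And>s. \<lbrakk>1 \<le> Re s; Re s \<le> 2\<rbrakk> \<Longrightarrow> norm (zeta_reg s) \<le> K * (3 + \<bar>Im s\<bar>) ^ 2"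
    by (rule zeta_reg_upper_bounds, rule that; blast)
  obtain c where c: "c > 0" "\<And>s. \<lbrakk>1 < Re s; Re s \<le> 2\<rbrakk> \<Longrightarrow> norm (zeta_reg s) \<ge> c / (3 + \<bar>Im s\<bar>) ^ 8"
    by (rule zeta_reg_lower_bound, rule that; blast)
  obtain C where C: "C \<ge> 1" "\<And>s. \<lbrakk>1 < Re s; Re s \<le> 2\<rbrakk> \<Longrightarrow> norm (psi_laplace s) \<le> C * (3 + \<bar>Im s\<bar>) ^ 20"
    by (rule psi_laplace_bounds, rule that; blast)
  define M1 where "M1 = \<bar>ln (K * 9)\<bar> + \<bar>ln (c / 3 ^ 8)\<bar>"
  define M2 where "M2 = 2 * (1 + C * 3 ^ 20)"
  have M20: "M2 \<ge> 0" using C by (simp add: M2_def)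
  define M where "M = M1 + exp 1 * M2 + powerful_sum"
  have ps: "powerful_sum \<ge> 0" by (rule powerful_sum_nonneg)
  show thesis
  proof (rule that[of M])
    have "exp 1 * M2 \<ge> 0" using M20 by simp
    then show "M \<ge> 0" using ps by (simp add: M_def M1_def)
    fix x :: real assume x: "x \<ge> 3"
    note lx = ln_ln_pos[OF x]
    define \<sigma> where "\<sigma> = 1 + 1 / ln x"
    define s where "s = complex_of_real \<sigma>"
    have \<sigma>: "1 < \<sigma>" "\<sigma> \<le> 2" using lx by (auto simp: \<sigma>_def)
    then have s1: "Re s > 1" by (simp add: s_def)
    have "\<sigma> - 1 = 1 / ln x" by (simp add: \<sigma>_def)
    then have sm1: "s - 1 = of_real (1 / ln x)" unfolding s_def by (metis of_real_1 of_real_diff)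
    define Z F where "Z = Re (log_zeta s)" and "F = Re (mangoldt_series s)"
    have Zs: "(\<lambda>n. mangoldt n / ln (real n) * real n powr (- \<sigma>)) sums Z"
      using Re_dirichlet_sum_sums[OF coeff_bounds(3) s1] by (simp add: s_def Z_def)
    have Fs: "(\<lambda>n. mangoldt n * real n powr (- \<sigma>)) sums F"
      using Re_dirichlet_sum_sums[OF coeff_bounds(2) s1] by (simp add: s_def F_def)
    have F_le: "F \<le> M2 * ln x"
    proof -
      have "mangoldt_series s / s = psi_laplace s + of_real (ln x)"
        using psi_laplace_eq[OF s1] by (simp add: sm1 algebra_simps)
      then have "mangoldt_series s = s * (psi_laplace s + of_real (ln x))" using \<sigma> by (simp add: s_def field_simps)
      then have "norm (mangoldt_series s) = \<sigma> * norm (psi_laplace s + of_real (ln x))" using \<sigma> by (simp add: norm_mult s_def)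
      also have "\<dots> \<le> 2 * (norm (psi_laplace s) + ln x)"
        using \<sigma> lx norm_triangle_ineq[of "psi_laplace s" "of_real (ln x)"] by (intro mult_mono) auto
      also have "norm (psi_laplace s) \<le> C * 3 ^ 20" using C(2)[of s] \<sigma> by (simp add: s_def)
      also have "C * 3 ^ 20 \<le> C * 3 ^ 20 * ln x" using C lx by (intro mult_le_cancel_left1[THEN iffD2]) auto
      also have "2 * (C * 3 ^ 20 * ln x + ln x) = M2 * ln x" by (simp add: M2_def algebra_simps)
      finally have "norm (mangoldt_series s) \<le> M2 * ln x" by simp
      then show ?thesis unfolding F_def using complex_Re_le_cmod[of "mangoldt_series s"] by linarith
    qed
    have F0: "F \<ge> 0" using sums_le[OF _ sums_zero Fs] by (simp add: mangoldt_nonneg)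
    have Z_eq: "\<bar>Z - ln (ln x)\<bar> \<le> M1"
    proof -
      define q where "q = norm (zeta_reg s)"
      have "zeta_reg s = of_real (1 / ln x) * exp (log_zeta s)"
        using zeta_reg_eq[OF s1] zeta_sum_eq_exp[OF s1] sm1 by simp
      then have q: "q = exp Z / ln x" using lx by (simp add: q_def norm_mult norm_divide Z_def)
      then have "ln q = Z - ln (ln x)" using lx by (simp add: ln_div)
      moreover have q0: "q > 0" using q lx by simp
      moreover have "q \<le> K * 9" "c / 3 ^ 8 \<le> q" using K(2)[of s] c(2)[of s] \<sigma> by (simp_all add: q_def s_def)
      then have "ln q \<le> ln (K * 9)" "ln (c / 3 ^ 8) \<le> ln q"
        using K(1) c(1) q0 by (subst ln_le_cancel_iff; simp)+
      ultimately show ?thesis unfolding M1_def by linarith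
    qed
    have fin: "(\<lambda>n. if n \<in> primes_le x then 1 / real n else 0) sums prime_recip_sum x"
      unfolding prime_recip_sum_def by (rule sums_If_finite_set) simp
    \<comment> \<open>With t = ln p / ln x, at most 1 for p \<le> x, one has 1/p = p^(-\<sigma>) exp t and exp t \<le> 1 + exp 1 * t.\<close>
    have A: "prime_recip_sum x \<le> Z + exp 1 / ln x * F"
    proof (rule sums_le[OF _ fin sums_add[OF Zs sums_mult[OF Fs, of "exp 1 / ln x"]]])
      fix n
      show "(if n \<in> primes_le x then 1 / real n else 0) \<le> mangoldt n / ln (real n) * real n powr (- \<sigma>) + exp 1 / ln x * (mangoldt n * real n powr (- \<sigma>))"
      proof (cases "n \<in> primes_le x")
        case True
        then have n: "prime n" "real n \<le> x" by (auto simp: primes_le_def)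
        have n1: "real n > 1" using prime_gt_1_nat[OF n(1)] by simp
        define t where "t = ln (real n) / ln x"
        have t: "0 \<le> t" "t \<le> 1" using n n1 lx by (auto simp: t_def divide_le_eq)
        have pw: "real n powr (- \<sigma>) = 1 / real n * exp (- t)"
          using n1 by (simp add: \<sigma>_def powr_def t_def algebra_simps exp_diff exp_minus field_simps flip: exp_add)
        have "1 \<le> exp (- t) * (1 + exp 1 * t)"
        proof -
          have "exp t \<le> 1 + exp 1 * t"
          proof -
            have "1 - t \<le> exp (- t)" using exp_ge_add_one_self[of "- t"] by simp
            then have "(1 - t) * exp t \<le> exp (- t) * exp t" by (intro mult_right_mono) auto
            then have "exp t \<le> 1 + t * exp t" by (simp add: algebra_simps flip: exp_add)
            also have "t * exp t \<le> t * exp 1" using t by (intro mult_left_mono) auto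
            finally show ?thesis by (simp add: mult.commute)
          qed
          then show ?thesis by (simp add: exp_minus field_simps)
        qed
        then have "1 / real n * 1 \<le> 1 / real n * (exp (- t) * (1 + exp 1 * t))" by (intro mult_left_mono) auto
        also have "\<dots> = mangoldt n / ln (real n) * real n powr (- \<sigma>) + exp 1 / ln x * (mangoldt n * real n powr (- \<sigma>))"
          using n n1 unfolding pw by (simp add: t_def algebra_simps add_divide_distrib)
        finally show ?thesis using True by simp
      next
        case False
        then show ?thesis using mangoldt_nonneg[of n] ln_of_nat_nonneg[of n] lx by simp
      qed
    qed
    have pws: "(\<lambda>n. 1 / real n) summable_on {n. powerful n}"
      by (rule powerful_summable_comparison[where K = 1]) (auto simp: powerful_def inverse_le_powr_three_quarters)
    have pw_le: "(\<Sum>\<^sub>\<infinity>n | powerful n. 1 / real n) \<le> powerful_sum"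
      unfolding powerful_sum_def by (intro infsum_mono pws powerful_powr_summable) (auto simp: powerful_def inverse_le_powr_three_quarters)
    have "((\<lambda>n. 1 / real n) has_sum (\<Sum>\<^sub>\<infinity>n | powerful n. 1 / real n)) {n. powerful n}" using pws by (rule has_sum_infsum)
    then have "((\<lambda>n. if powerful n then 1 / real n else 0) has_sum (\<Sum>\<^sub>\<infinity>n | powerful n. 1 / real n)) UNIV"
      by (rule has_sum_cong_neutral[THEN iffD1, rotated 3]) auto
    then have pwsums: "(\<lambda>n. if powerful n then 1 / real n else 0) sums (\<Sum>\<^sub>\<infinity>n | powerful n. 1 / real n)" by (rule has_sum_imp_sums)
    \<comment> \<open>For primes p > x the coefficient 1 is at most ln p / ln x.\<close>
    have B: "Z \<le> prime_recip_sum x + 1 / ln x * F + (\<Sum>\<^sub>\<infinity>n | powerful n. 1 / real n)"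
    proof (rule sums_le[OF _ Zs sums_add[OF sums_add[OF fin sums_mult[OF Fs, of "1 / ln x"]] pwsums]])
      fix n
      have nn: "0 \<le> 1 / ln x * (mangoldt n * real n powr (- \<sigma>))" using lx mangoldt_nonneg[of n] by simp
      have "mangoldt n / ln (real n) \<le> 1"
        using mangoldt_le_ln[of n] ln_of_nat_nonneg[of n] by (cases "ln (real n) = 0") (auto simp: divide_le_eq_1)
      then have le1: "mangoldt n / ln (real n) * real n powr (- \<sigma>) \<le> 1 * real n powr (- \<sigma>)" by (intro mult_right_mono) auto
      moreover have "real n powr (- \<sigma>) \<le> 1 / real n"
        using powr_mono[of "-\<sigma>" "-1" "real n"] \<sigma> by (cases "n = 0") (auto simp: powr_minus_divide)
      ultimately have le2: "mangoldt n / ln (real n) * real n powr (- \<sigma>) \<le> 1 / real n" by linarith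
      consider "n \<in> primes_le x" | "prime n" "real n > x" | "powerful n" | "mangoldt n = (0::real)"
        using mangoldt_nonprime_powerful[of n] by (force simp: primes_le_def)
      then show "mangoldt n / ln (real n) * real n powr (- \<sigma>) \<le> (if n \<in> primes_le x then 1 / real n else 0) +
          1 / ln x * (mangoldt n * real n powr (- \<sigma>)) + (if powerful n then 1 / real n else 0)"
      proof cases
        case 1
        have "0 \<le> (if powerful n then 1 / real n else 0)" by simp
        then show ?thesis using le2 nn unfolding if_P[OF 1] by linarith
      next
        case 2
        have "1 / ln (real n) \<le> 1 / ln x" using 2 lx x by (intro divide_left_mono) auto
        then have "1 / ln (real n) * (mangoldt n * real n powr (- \<sigma>)) \<le> 1 / ln x * (mangoldt n * real n powr (- \<sigma>))"
          by (intro mult_right_mono) (auto simp: mangoldt_nonneg)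
        moreover have "0 \<le> (if n \<in> primes_le x then 1 / real n else 0)" "0 \<le> (if powerful n then 1 / real n else 0)" by simp_all
        moreover have "mangoldt n / ln (real n) * real n powr (- \<sigma>) = 1 / ln (real n) * (mangoldt n * real n powr (- \<sigma>))" by simp
        ultimately show ?thesis by linarith
      next
        case 3
        have "0 \<le> (if n \<in> primes_le x then 1 / real n else 0)" by simp
        then show ?thesis using le2 nn unfolding if_P[OF 3] by linarith
      next
        case 4
        then show ?thesis by simp
      qed
    qed
    have "1 / ln x * F \<le> M2" using F_le lx by (simp add: field_simps)
    moreover have "exp 1 / ln x * F \<le> exp 1 * M2" using F_le lx by (simp add: field_simps)
    moreover have "1 * M2 \<le> exp 1 * M2" using M20 by (intro mult_right_mono) auto
    ultimately show "\<bar>prime_recip_sum x - ln (ln x)\<bar> \<le> M"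
      using A B Z_eq pw_le ps unfolding M_def by linarith
  qed
qed

section \<open>Prime factors of exponent one and the powerful part\<close>

definition simple_primes :: "nat \<Rightarrow> nat set" where
  "simple_primes n = {p \<in> prime_factors n. multiplicity p n = 1}"

definition powerful_part :: "nat \<Rightarrow> nat" where
  "powerful_part n = (\<Prod>p\<in>prime_factors n - simple_primes n. p ^ multiplicity p n)"

text \<open>The defect that n acquires when it is multiplied by a prime not dividing it, see \<open>exp_defect_prime_mult\<close>.\<close>

definition next_defect :: "nat \<Rightarrow> nat" where
  "next_defect n = prime_omega n + 1 - card (insert 1 ((\<lambda>p. multiplicity p n) ` prime_factors n))"

lemma finite_simple_primes [simp]: "finite (simple_primes n)"
  by (auto simp: simple_primes_def)

lemma simple_primesD: "p \<in> simple_primes n \<Longrightarrow> prime p" "p \<in> simple_primes n \<Longrightarrow> p dvd n"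
  by (auto simp: simple_primes_def)

lemma prod_simple_primes_mult_powerful_part:
  assumes "n > 0"
  shows "\<Prod>(simple_primes n) * powerful_part n = n"
proof -
  have "\<Prod>(simple_primes n) = (\<Prod>p\<in>simple_primes n. p ^ multiplicity p n)"
    by (intro prod.cong) (auto simp: simple_primes_def)
  then have "\<Prod>(simple_primes n) * powerful_part n = (\<Prod>p\<in>prime_factors n. p ^ multiplicity p n)"
    unfolding powerful_part_def
    by (subst prod.subset_diff[of "simple_primes n" "prime_factors n"]) (auto simp: simple_primes_def mult.commute)
  then show ?thesis using assms by (simp add: prod_prime_factors)
qed

lemma multiplicity_powerful_part:
  assumes "prime p"
  shows "multiplicity p (powerful_part n) = (if p \<in> prime_factors n - simple_primes n then multiplicity p n else 0)"
  unfolding powerful_part_def using assms by (intro multiplicity_prod_prime_powers) auto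

lemma powerful_part_pos: "powerful_part n > 0"
  unfolding powerful_part_def by (intro prod_pos) (auto simp: prime_gt_0_nat prime_factors_gt_0_nat)

lemma powerful_powerful_part: "powerful (powerful_part n)"
  unfolding powerful_def
proof (intro conjI allI impI powerful_part_pos)
  fix p assume p: "prime p" "p dvd powerful_part n"
  then have "multiplicity p (powerful_part n) > 0" using powerful_part_pos[of n] by (simp add: prime_multiplicity_gt_zero_iff)
  then have "p \<in> prime_factors n" "multiplicity p n \<noteq> 1" "multiplicity p (powerful_part n) = multiplicity p n"
    using multiplicity_powerful_part[OF p(1), of n] by (auto simp: simple_primes_def split: if_splits)
  then have "multiplicity p (powerful_part n) \<ge> 2" using \<open>multiplicity p (powerful_part n) > 0\<close> by linarith
  then show "p\<^sup>2 dvd powerful_part n" by (rule multiplicity_dvd')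
qed

lemma simple_primes_not_dvd_powerful_part:
  assumes "p \<in> simple_primes n"
  shows "\<not> p dvd powerful_part n"
proof -
  have "prime p" using assms by (rule simple_primesD)
  then have "multiplicity p (powerful_part n) = 0" using multiplicity_powerful_part[of p n] assms by simp
  then show ?thesis using \<open>prime p\<close> powerful_part_pos[of n] by (simp add: multiplicity_eq_zero_iff prime_nat_iff)
qed

lemma powerful_multiplicity_ge_2:
  assumes "powerful l" "p \<in> prime_factors l"
  shows "multiplicity p l \<ge> 2"
proof -
  have "prime p" "p dvd l" "l > 0" using assms by (auto simp: powerful_def)
  then have "p\<^sup>2 dvd l" using assms by (auto simp: powerful_def)
  then show ?thesis using \<open>prime p\<close> \<open>l > 0\<close> by (intro multiplicity_geI) (auto simp: prime_nat_iff)
qed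

text \<open>Every positive integer is uniquely the product of a finite set S of primes and a powerful number l divisible by none
  of them: S and l are recovered as the simple primes and the powerful part. The exponent 1 does not occur in l, so the exponents
  of the product together with 1 are one more in number than those of l.\<close>

lemma compose_simple_primes:
  assumes S: "finite S" "\<And>p. p \<in> S \<Longrightarrow> prime p" "\<And>p. p \<in> S \<Longrightarrow> \<not> p dvd l" and l: "powerful l"
  shows simple_primes_compose: "simple_primes (\<Prod>S * l) = S"
    and powerful_part_compose: "powerful_part (\<Prod>S * l) = l"
    and next_defect_compose: "next_defect (\<Prod>S * l) = card S + exp_defect l"
    and compose_pos: "\<Prod>S * l > 0"
proof -
  let ?n = "\<Prod>S * l"
  have l0: "l > 0" using l by (simp add: powerful_def)
  have P0: "\<Prod>S > 0" using S by (intro prod_pos) (auto simp: prime_gt_0_nat)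
  show n0: "?n > 0" using l0 P0 by simp
  have mS: "multiplicity p (\<Prod>S) = (if p \<in> S then 1 else 0)" if "prime p" for p
    using multiplicity_prod_prime_powers[OF S(1) S(2) that, of "\<lambda>_. 1"] by simp
  have m: "multiplicity p ?n = (if p \<in> S then 1 else 0) + multiplicity p l" if "prime p" for p
    using mS[OF that] l0 P0 that by (subst prime_elem_multiplicity_mult_distrib) auto
  have m0: "multiplicity p l = 0" if "p \<in> S" for p using S(3)[OF that] by (simp add: not_dvd_imp_multiplicity_0)
  have "prime_factors (\<Prod>S) = S"
  proof -
    have "prime_factors (\<Prod>S) = {p. prime p \<and> p \<in> S}"
      unfolding prime_factors_multiplicity using mS by (auto split: if_splits)
    then show ?thesis using S by auto
  qed
  then have pf: "prime_factors ?n = S \<union> prime_factors l"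
    using l0 P0 by (subst prime_factors_product) auto
  have disj: "S \<inter> prime_factors l = {}" using S(3) by auto
  have ge2: "multiplicity p l \<ge> 2" if "p \<in> prime_factors l" for p using powerful_multiplicity_ge_2[OF l that] .
  have multl: "multiplicity p ?n = multiplicity p l" if "p \<in> prime_factors l" for p
  proof -
    have "prime p" "p \<notin> S" using that disj by auto
    then show ?thesis using m[of p] by simp
  qed
  have multS: "multiplicity p ?n = 1" if "p \<in> S" for p using m[of p] m0[OF that] S(2)[OF that] that by simp
  show sp: "simple_primes ?n = S"
  proof
    show "simple_primes ?n \<subseteq> S"
    proof
      fix p assume p: "p \<in> simple_primes ?n"
      then have "p \<in> S \<union> prime_factors l" "multiplicity p ?n = 1" using pf by (auto simp: simple_primes_def)
      then show "p \<in> S" using multl[of p] ge2[of p] by fastforce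
    qed
    show "S \<subseteq> simple_primes ?n" using multS pf unfolding simple_primes_def by blast
  qed
  have "\<Prod>S * powerful_part ?n = \<Prod>S * l"
    using prod_simple_primes_mult_powerful_part[OF n0] sp by simp
  then show "powerful_part ?n = l" using P0 by simp
  let ?E = "(\<lambda>p. multiplicity p l) ` prime_factors l"
  have "insert 1 ((\<lambda>p. multiplicity p ?n) ` prime_factors ?n) = insert 1 ?E"
  proof -
    have "(\<lambda>p. multiplicity p ?n) ` prime_factors ?n = (\<lambda>p. multiplicity p ?n) ` S \<union> (\<lambda>p. multiplicity p ?n) ` prime_factors l"
      unfolding pf by (rule image_Un)
    also have "(\<lambda>p. multiplicity p ?n) ` prime_factors l = ?E" using multl by (intro image_cong) auto
    also have "insert 1 ((\<lambda>p. multiplicity p ?n) ` S \<union> ?E) = insert 1 ?E" using multS by auto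
    finally show ?thesis by simp
  qed
  moreover have "1 \<notin> ?E" using ge2 by fastforce
  ultimately have "card (insert 1 ((\<lambda>p. multiplicity p ?n) ` prime_factors ?n)) = Suc (num_exps l)"
    by (simp add: num_exps_def)
  moreover have "prime_omega ?n = card S + prime_omega l"
    unfolding prime_omega_def pf using S(1) disj by (intro card_Un_disjoint) auto
  ultimately show "next_defect ?n = card S + exp_defect l"
    using num_exps_le_prime_omega[of l] by (simp add: next_defect_def exp_defect_def)
qed

lemma next_defect_eq:
  assumes "n > 0"
  shows "next_defect n = card (simple_primes n) + exp_defect (powerful_part n)"
  using next_defect_compose[of "simple_primes n" "powerful_part n"]
    prod_simple_primes_mult_powerful_part[OF assms] powerful_powerful_part simple_primes_not_dvd_powerful_part simple_primesD
  by simp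

lemma exp_defect_prime_mult:
  assumes n: "n > 0" and p: "prime p" "\<not> p dvd n"
  shows "exp_defect (p * n) = next_defect n" "p \<in> simple_primes (p * n)"
proof -
  have p0: "p > 0" using p by (simp add: prime_gt_0_nat)
  have pf: "prime_factors (p * n) = insert p (prime_factors n)"
    using n p p0 by (subst prime_factors_product) (auto simp: prime_prime_factors)
  have mp: "multiplicity p (p * n) = 1"
    using n p p0 by (subst prime_elem_multiplicity_mult_distrib) (auto simp: not_dvd_imp_multiplicity_0)
  have mq: "multiplicity q (p * n) = multiplicity q n" if "q \<in> prime_factors n" for q
  proof -
    have "prime q" "q \<noteq> p" using that p by auto
    then have "\<not> q dvd p" using p primes_dvd_imp_eq by blast
    then show ?thesis using \<open>prime q\<close> by (intro multiplicity_prime_elem_times_other) auto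
  qed
  show "p \<in> simple_primes (p * n)" using pf mp by (simp add: simple_primes_def)
  have "(\<lambda>q. multiplicity q (p * n)) ` prime_factors (p * n) = insert 1 ((\<lambda>q. multiplicity q n) ` prime_factors n)"
    unfolding pf using mp mq by (auto simp: image_iff)
  moreover have "card (prime_factors (p * n)) = card (prime_factors n) + 1"
    unfolding pf using p by (subst card_insert_disjoint) auto
  ultimately show "exp_defect (p * n) = next_defect n"
    by (simp add: exp_defect_def next_defect_def num_exps_def prime_omega_def)
qed

lemma simple_primes_cofactor:
  assumes "p \<in> simple_primes n"
  obtains m where "n = p * m" "\<not> p dvd m" "m > 0"
proof -
  have p: "prime p" "p dvd n" "multiplicity p n = 1" "n > 0" using assms by (auto simp: simple_primes_def intro: gr0I)
  then obtain m where m: "n = p * m" by auto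
  then have m0: "m > 0" using p by (auto intro: gr0I)
  have "\<not> p dvd m"
  proof
    assume "p dvd m"
    then have "p\<^sup>2 dvd n" using m by (simp add: power2_eq_square)
    then have "2 \<le> multiplicity p n" using p by (intro multiplicity_geI) (auto simp: prime_nat_iff)
    then show False using p by simp
  qed
  then show thesis using that m m0 by blast
qed

text \<open>From 2^\<omega>(n) \<le> n.\<close>

lemma prime_omega_le_powr:
  assumes "n > 0"
  shows "real (prime_omega n) \<le> 8 * real n powr (1 / 4)"
proof -
  have "2 ^ prime_omega n = (\<Prod>p\<in>prime_factors n. 2::nat)" by (simp add: prime_omega_def)
  also have "\<dots> \<le> (\<Prod>p\<in>prime_factors n. p ^ multiplicity p n)"
  proof (rule prod_mono)
    fix p assume p: "p \<in> prime_factors n"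
    then have "2 \<le> p" using in_prime_factors_imp_prime prime_ge_2_nat by blast
    moreover have "p ^ 1 \<le> p ^ multiplicity p n" using p by (intro power_increasing) (auto simp: prime_factors_multiplicity dest: prime_gt_0_nat)
    ultimately show "0 \<le> (2::nat) \<and> 2 \<le> p ^ multiplicity p n" by simp
  qed
  also have "\<dots> = n" using assms by (simp add: prod_prime_factors)
  finally have "2 ^ prime_omega n \<le> n" .
  then have "real (2 ^ prime_omega n) \<le> real n" by (rule of_nat_mono)
  then have "ln (2 ^ prime_omega n) \<le> ln (real n)" using assms by (subst ln_le_cancel_iff) auto
  then have "real (prime_omega n) * ln 2 \<le> ln (real n)" by (simp add: ln_realpow)
  moreover have "ln 2 \<ge> (1/2::real)" using ln_add_one_self_le_self2 ln2_ge_two_thirds by linarith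
  then have "real (prime_omega n) * (1/2) \<le> real (prime_omega n) * ln 2" by (intro mult_left_mono) auto
  ultimately have "real (prime_omega n) * (1/2) \<le> ln (real n)" by (rule order_trans[rotated])
  moreover have "ln (real n) \<le> 4 * real n powr (1 / 4)" using ln_powr_bound[of "real n" "1/4"] assms by simp
  ultimately show ?thesis by linarith
qed

lemma special_iff_exp_defect: "n > 0 \<Longrightarrow> special n \<longleftrightarrow> exp_defect n = 0"
  using num_exps_le_prime_omega[of n] by (auto simp: special_def exp_defect_def)

section \<open>Elementary symmetric sums\<close>

text \<open>The elementary symmetric function of degree k in the numbers a p for p in A.\<close>

definition esym :: "('a \<Rightarrow> real) \<Rightarrow> nat \<Rightarrow> 'a set \<Rightarrow> real" where
  "esym a k A = (\<Sum>S | S \<subseteq> A \<and> card S = k. \<Prod>p\<in>S. a p)"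

lemma esym_0: "finite A \<Longrightarrow> esym a 0 A = 1"
proof -
  assume "finite A"
  then have "{S. S \<subseteq> A \<and> card S = 0} = {{}}" by (auto dest: finite_subset)
  then show ?thesis by (simp add: esym_def)
qed

text \<open>Double counting of the pairs of a set of size k + 1 and one of its elements.\<close>

lemma esym_Suc:
  assumes A: "finite A"
  shows "real (Suc k) * esym a (Suc k) A = (\<Sum>p\<in>A. a p * esym a k (A - {p}))"
proof -
  have fin: "finite {S. S \<subseteq> B \<and> card S = j}" if "finite B" for B :: "'a set" and j
    using that by simp
  have "real (Suc k) * esym a (Suc k) A = (\<Sum>S | S \<subseteq> A \<and> card S = Suc k. \<Sum>p\<in>S. \<Prod>q\<in>S. a q)"
    unfolding esym_def sum_distrib_left by (intro sum.cong) auto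
  also have "\<dots> = (\<Sum>(S, p)\<in>(SIGMA S:{S. S \<subseteq> A \<and> card S = Suc k}. S). \<Prod>q\<in>S. a q)"
    by (rule sum.Sigma) (use A fin in \<open>auto dest: finite_subset\<close>)
  also have "\<dots> = (\<Sum>(p, T)\<in>(SIGMA p:A. {T. T \<subseteq> A - {p} \<and> card T = k}). a p * (\<Prod>q\<in>T. a q))"
  proof (rule sum.reindex_bij_witness[where i = "\<lambda>(p, T). (insert p T, p)" and j = "\<lambda>(S, p). (p, S - {p})"])
    fix x assume "x \<in> (SIGMA S:{S. S \<subseteq> A \<and> card S = Suc k}. S)"
    then obtain S p where x: "x = (S, p)" "S \<subseteq> A" "card S = Suc k" "p \<in> S" by auto
    have fS: "finite S" using x(2) A by (rule finite_subset)
    show "(case case x of (S, p) \<Rightarrow> (p, S - {p}) of (p, T) \<Rightarrow> (insert p T, p)) = x" using x by auto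
    show "(case x of (S, p) \<Rightarrow> (p, S - {p})) \<in> (SIGMA p:A. {T. T \<subseteq> A - {p} \<and> card T = k})" using x fS by auto
    show "(case case x of (S, p) \<Rightarrow> (p, S - {p}) of (p, T) \<Rightarrow> a p * (\<Prod>q\<in>T. a q)) = (case x of (S, p) \<Rightarrow> \<Prod>q\<in>S. a q)"
      using x fS prod.remove[OF fS x(4), of a] by simp
  next
    fix y assume "y \<in> (SIGMA p:A. {T. T \<subseteq> A - {p} \<and> card T = k})"
    then obtain p T where y: "y = (p, T)" "p \<in> A" "T \<subseteq> A - {p}" "card T = k" by auto
    have fT: "finite T" using y(3) A by (auto dest: finite_subset)
    show "(case case y of (p, T) \<Rightarrow> (insert p T, p) of (S, p) \<Rightarrow> (p, S - {p})) = y" using y by auto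
    show "(case y of (p, T) \<Rightarrow> (insert p T, p)) \<in> (SIGMA S:{S. S \<subseteq> A \<and> card S = Suc k}. S)"
      using y fT by (auto simp: card_insert_if)
  qed
  also have "\<dots> = (\<Sum>p\<in>A. \<Sum>T | T \<subseteq> A - {p} \<and> card T = k. a p * (\<Prod>q\<in>T. a q))"
    by (rule sum.Sigma[symmetric]) (use A fin in auto)
  also have "\<dots> = (\<Sum>p\<in>A. a p * esym a k (A - {p}))" by (simp add: esym_def sum_distrib_left)
  finally show ?thesis .
qed

lemma esym_upper:
  assumes "finite A" "\<And>p. p \<in> A \<Longrightarrow> 0 \<le> a p"
  shows "fact k * esym a k A \<le> (\<Sum>p\<in>A. a p) ^ k"
  using assms
proof (induction k arbitrary: A)
  case 0
  then show ?case by (simp add: esym_0)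
next
  case (Suc k)
  have "fact (Suc k) * esym a (Suc k) A = fact k * (real (Suc k) * esym a (Suc k) A)" by (simp add: mult_ac)
  also have "\<dots> = (\<Sum>p\<in>A. a p * (fact k * esym a k (A - {p})))"
    unfolding esym_Suc[OF Suc.prems(1)] by (simp add: sum_distrib_left mult_ac)
  also have "\<dots> \<le> (\<Sum>p\<in>A. a p * (\<Sum>p\<in>A. a p) ^ k)"
  proof (intro sum_mono mult_left_mono)
    fix p assume p: "p \<in> A"
    have "fact k * esym a k (A - {p}) \<le> (\<Sum>q\<in>A - {p}. a q) ^ k" using Suc.prems by (intro Suc.IH) auto
    also have "\<dots> \<le> (\<Sum>q\<in>A. a q) ^ k"
      using Suc.prems by (intro power_mono sum_mono2 sum_nonneg) auto
    finally show "fact k * esym a k (A - {p}) \<le> (\<Sum>q\<in>A. a q) ^ k" .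
  qed (use Suc.prems in auto)
  finally show ?case by (simp add: sum_distrib_right)
qed

text \<open>The recursion \<open>esym_Suc\<close> removes one element per step, and each removal lowers the sum by at most 1.\<close>

lemma esym_lower:
  assumes "finite A" "\<And>p. p \<in> A \<Longrightarrow> 0 \<le> a p" "\<And>p. p \<in> A \<Longrightarrow> a p \<le> 1"
  shows "(max 0 ((\<Sum>p\<in>A. a p) - real k)) ^ k \<le> fact k * esym a k A"
  using assms
proof (induction k arbitrary: A)
  case 0
  then show ?case by (simp add: esym_0)
next
  case (Suc k)
  let ?m = "max 0 ((\<Sum>p\<in>A. a p) - real (Suc k))"
  have "?m ^ Suc k \<le> (\<Sum>p\<in>A. a p) * ?m ^ k"
    using Suc.prems sum_nonneg[of A a] by (auto intro!: mult_right_mono)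
  also have "\<dots> = (\<Sum>p\<in>A. a p * ?m ^ k)" by (rule sum_distrib_right)
  also have "\<dots> \<le> (\<Sum>p\<in>A. a p * (fact k * esym a k (A - {p})))"
  proof (intro sum_mono mult_left_mono)
    fix p assume p: "p \<in> A"
    have "(\<Sum>q\<in>A. a q) = a p + (\<Sum>q\<in>A - {p}. a q)" using Suc.prems p by (intro sum.remove) auto
    then have "?m \<le> max 0 ((\<Sum>q\<in>A - {p}. a q) - real k)" using Suc.prems(3)[OF p] by auto
    then have "?m ^ k \<le> (max 0 ((\<Sum>q\<in>A - {p}. a q) - real k)) ^ k" by (intro power_mono) auto
    also have "\<dots> \<le> fact k * esym a k (A - {p})" using Suc.prems by (intro Suc.IH) auto
    finally show "?m ^ k \<le> fact k * esym a k (A - {p})" .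
  qed (use Suc.prems in auto)
  also have "\<dots> = fact k * (real (Suc k) * esym a (Suc k) A)"
    unfolding esym_Suc[OF Suc.prems(1)] by (simp add: sum_distrib_left mult_ac)
  also have "\<dots> = fact (Suc k) * esym a (Suc k) A" by (simp add: mult_ac)
  finally show ?case .
qed

lemma power_diff_le:
  fixes x y :: real
  assumes "0 \<le> y" "y \<le> x"
  shows "x ^ k - y ^ k \<le> real k * (x - y) * x ^ (k - 1)"
proof (induction k)
  case (Suc k)
  have "x ^ Suc k - y ^ Suc k = x * (x ^ k - y ^ k) + (x - y) * y ^ k" by (simp add: algebra_simps)
  also have "\<dots> \<le> x * (real k * (x - y) * x ^ (k - 1)) + (x - y) * x ^ k"
    using assms Suc by (intro add_mono mult_left_mono power_mono) auto
  also have "x * (real k * (x - y) * x ^ (k - 1)) = real k * (x - y) * x ^ k"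
    by (cases k) (auto simp: mult_ac)
  finally show ?case by (simp add: algebra_simps)
qed simp

text \<open>Bernoulli's inequality for t^k, in a form that is also valid when b exceeds t.\<close>

lemma power_max_minus_ge:
  fixes t b :: real
  assumes "0 \<le> t" "0 \<le> b"
  shows "t ^ k - real k * b * t ^ (k - 1) \<le> (max 0 (t - b)) ^ k"
proof (cases "t \<le> b")
  case True
  show ?thesis
  proof (cases k)
    case (Suc j)
    have "t * t ^ j \<le> real k * b * t ^ j"
    proof (rule mult_right_mono)
      have "t \<le> 1 * b" using True by simp
      also have "\<dots> \<le> real k * b" using Suc assms by (intro mult_right_mono) auto
      finally show "t \<le> real k * b" .
    qed (use assms in auto)
    then show ?thesis using Suc True by simp
  qed simp
next
  case False
  then show ?thesis using power_diff_le[of "t - b" t k] assms by simp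
qed

text \<open>An additive error M in the base b costs a factor 1 + O(1/b) in the k-th power. The bounds are written with b^k / b
  instead of b^(k - 1) so that they cover k = 0.\<close>

lemma power_close:
  fixes a b M :: real
  assumes "0 \<le> a" "1 \<le> b" "\<bar>a - b\<bar> \<le> M"
  shows "\<bar>a ^ k - b ^ k\<bar> \<le> real k * M * (1 + M) ^ k * (b ^ k / b)"
    and "a ^ k \<le> (1 + M) ^ k * b ^ k"
    and "real k * a ^ (k - 1) \<le> real k * (1 + M) ^ k * (b ^ k / b)"
proof -
  have M: "M \<ge> 0" using assms by linarith
  have "1 * M \<le> b * M" using assms M by (intro mult_right_mono) auto
  then have mx: "a \<le> (1 + M) * b" "b \<le> (1 + M) * b" using assms M by (auto simp: algebra_simps abs_le_iff)
  from mx(1) show "a ^ k \<le> (1 + M) ^ k * b ^ k" using assms by (simp add: power_mult_distrib[symmetric] power_mono)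
  have pw: "real k * ((1 + M) * b) ^ (k - 1) \<le> real k * ((1 + M) ^ k * (b ^ k / b))"
  proof (cases k)
    case (Suc j)
    have "(1 + M) ^ j * b ^ j \<le> (1 + M) ^ k * b ^ j" using assms M Suc by (intro mult_right_mono power_increasing) auto
    then show ?thesis using Suc assms by (simp add: power_mult_distrib)
  qed simp
  have x: "u ^ k - v ^ k \<le> real k * M * (1 + M) ^ k * (b ^ k / b)"
    if "0 \<le> v" "v \<le> u" "u - v \<le> M" "u \<le> (1 + M) * b" for u v
  proof -
    have "u ^ k - v ^ k \<le> real k * (u - v) * u ^ (k - 1)" using that by (intro power_diff_le)
    also have "\<dots> \<le> real k * M * ((1 + M) * b) ^ (k - 1)" using that M by (intro mult_mono power_mono) auto
    also have "\<dots> = M * (real k * ((1 + M) * b) ^ (k - 1))" by simp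
    also have "\<dots> \<le> M * (real k * ((1 + M) ^ k * (b ^ k / b)))" using pw M by (rule mult_left_mono)
    finally show ?thesis by (simp add: mult_ac)
  qed
  show "\<bar>a ^ k - b ^ k\<bar> \<le> real k * M * (1 + M) ^ k * (b ^ k / b)"
  proof (cases "a \<le> b")
    case True
    then have "a ^ k \<le> b ^ k" using assms by (intro power_mono) auto
    then show ?thesis using x[of a b] True assms mx by (auto simp: abs_le_iff)
  next
    case False
    then have "b ^ k \<le> a ^ k" using assms by (intro power_mono) auto
    then show ?thesis using x[of b a] False assms mx by (auto simp: abs_le_iff)
  qed
  have "real k * a ^ (k - 1) \<le> real k * ((1 + M) * b) ^ (k - 1)"
    using mx assms by (intro mult_left_mono power_mono) auto
  with pw show "real k * a ^ (k - 1) \<le> real k * (1 + M) ^ k * (b ^ k / b)" by (simp add: mult_ac)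
qed

section \<open>The logarithmic sum\<close>

definition log_density :: "nat \<Rightarrow> real \<Rightarrow> real" where
  "log_density k x = (\<Sum>m | m > 0 \<and> real m \<le> x \<and> next_defect m = k. 1 / real m)"

lemma summable_B_const: "(\<lambda>l. 1 / real l) summable_on {l. powerful l \<and> special l}"
proof (rule powerful_summable_comparison[where K = 1])
  show "\<bar>1 / real l\<bar> \<le> 1 * real l powr (- 3 / 4)" if "powerful l" for l
    using inverse_le_powr_three_quarters[of l] that by (simp add: powerful_def)
qed auto

lemma B_const_finite_sum_le:
  assumes "finite D" "D \<subseteq> {l. powerful l \<and> special l}"
  shows "(\<Sum>l\<in>D. 1 / real l) \<le> B_const"
  unfolding B_const_def using assms by (intro finite_sum_le_infsum summable_B_const) auto

lemma B_const_pos: "B_const > 0"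
  using B_const_finite_sum_le[of "{1}"] special_1 powerful_1 by simp

text \<open>Each finite partial sum of B splits at Y, and \<open>powerful_inverse_tail\<close> controls the part beyond Y.\<close>

lemma B_const_tail:
  assumes Y: "Y > 0"
  shows "B_const \<le> (\<Sum>l | powerful l \<and> special l \<and> real l \<le> Y. 1 / real l) + Y powr (- 1 / 4) * powerful_sum"
  unfolding B_const_def
proof (rule infsum_le_finite_sums[OF summable_B_const])
  fix F assume F: "finite F" "F \<subseteq> {l. powerful l \<and> special l}"
  let ?D = "{l. powerful l \<and> special l \<and> real l \<le> Y}"
  have fD: "finite ?D" by (rule finite_subset[OF _ finite_nat_le[of Y]]) (auto simp: powerful_def)
  have "(\<Sum>l\<in>F. 1 / real l) = (\<Sum>l\<in>F \<inter> ?D. 1 / real l) + (\<Sum>l\<in>F - ?D. 1 / real l)"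
    using F by (subst sum.union_disjoint[symmetric]) (auto intro!: sum.cong)
  also have "(\<Sum>l\<in>F \<inter> ?D. 1 / real l) \<le> (\<Sum>l\<in>?D. 1 / real l)" using fD by (intro sum_mono2) auto
  also have "(\<Sum>l\<in>F - ?D. 1 / real l) \<le> Y powr (- 1 / 4) * powerful_sum"
    using F Y by (intro powerful_inverse_tail) auto
  finally show "(\<Sum>l\<in>F. 1 / real l) \<le> (\<Sum>l\<in>?D. 1 / real l) + Y powr (- 1 / 4) * powerful_sum" by simp
qed

text \<open>Send m to its powerful part and its set of simple primes and drop the condition that their product be at most x.
  A special powerful part l leaves all k primes to be chosen, any other l leaves at most k - 1.\<close>

lemma log_density_upper:
  fixes x :: real and k :: nat
  defines "P \<equiv> prime_recip_sum x"
  shows "log_density k x \<le> B_const * P ^ k / fact k + powerful_sum * (if k = 0 then 0 else (1 + P) ^ (k - 1))"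
proof -
  have P0: "P \<ge> 0" unfolding P_def by (rule prime_recip_sum_nonneg)
  let ?e = "esym (\<lambda>p. 1 / real p)"
  let ?M = "{m. m > 0 \<and> real m \<le> x \<and> next_defect m = k}"
  let ?L = "{l. powerful l \<and> real l \<le> x \<and> exp_defect l \<le> k}"
  let ?T = "SIGMA l:?L. {S. S \<subseteq> primes_le x \<and> card S = k - exp_defect l}"
  let ?g = "\<lambda>(l::nat, S::nat set). 1 / real l * (\<Prod>p\<in>S. 1 / real p)"
  let ?f = "\<lambda>m. (powerful_part m, simple_primes m)"
  have fL: "finite ?L" by (rule finite_subset[OF _ finite_nat_le[of x]]) (auto simp: powerful_def)
  have fT: "finite ?T" using fL by (intro finite_SigmaI) auto
  have inj: "inj_on ?f ?M"
    by (rule inj_onI) (metis (mono_tags, lifting) mem_Collect_eq prod.inject prod_simple_primes_mult_powerful_part)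
  have g: "?g (?f m) = 1 / real m" if "m \<in> ?M" for m
  proof -
    have "real m = real (\<Prod>(simple_primes m)) * real (powerful_part m)"
      using prod_simple_primes_mult_powerful_part[of m] that by (metis (mono_tags, lifting) mem_Collect_eq of_nat_mult)
    then show ?thesis by (simp add: prod_dividef)
  qed
  have sub: "?f ` ?M \<subseteq> ?T"
  proof
    fix y assume "y \<in> ?f ` ?M"
    then obtain m where m: "m > 0" "real m \<le> x" "next_defect m = k" "y = ?f m" by auto
    have le: "d \<le> m" if "d dvd m" for d using that m by (intro dvd_imp_le)
    have "powerful_part m dvd m" using prod_simple_primes_mult_powerful_part[OF m(1)] by (metis dvd_triv_right)
    then have "real (powerful_part m) \<le> x" using le[of "powerful_part m"] m by linarith
    moreover have "simple_primes m \<subseteq> primes_le x"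
    proof
      fix p assume "p \<in> simple_primes m"
      then have "prime p" "p \<le> m" using simple_primesD le by auto
      then show "p \<in> primes_le x" using m by (simp add: primes_le_def)
    qed
    ultimately show "y \<in> ?T" using m next_defect_eq[OF m(1)] by (auto simp: powerful_powerful_part)
  qed
  have "log_density k x = (\<Sum>m\<in>?M. ?g (?f m))" unfolding log_density_def by (intro sum.cong refl g[symmetric])
  also have "\<dots> = sum ?g (?f ` ?M)" by (simp only: sum.reindex[OF inj] o_def)
  also have "\<dots> \<le> sum ?g ?T" using fT sub by (intro sum_mono2) (auto intro!: prod_nonneg divide_nonneg_nonneg)
  also have "\<dots> = (\<Sum>l\<in>?L. \<Sum>S | S \<subseteq> primes_le x \<and> card S = k - exp_defect l. 1 / real l * (\<Prod>p\<in>S. 1 / real p))"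
    by (rule sum.Sigma[symmetric]) (use fL in auto)
  also have "\<dots> = (\<Sum>l\<in>?L. 1 / real l * ?e (k - exp_defect l) (primes_le x))"
    by (simp only: esym_def sum_distrib_left)
  also have "\<dots> \<le> (\<Sum>l\<in>?L. (if special l then 1 / real l else 0) * (P ^ k / fact k) + 1 / real l * (if k = 0 then 0 else (1 + P) ^ (k - 1)))"
  proof (rule sum_mono)
    fix l assume l: "l \<in> ?L"
    then have l0: "l > 0" by (auto simp: powerful_def)
    define j where "j = k - exp_defect l"
    have "fact j * ?e j (primes_le x) \<le> P ^ j"
      unfolding P_def prime_recip_sum_def by (intro esym_upper) auto
    then have ej: "?e j (primes_le x) \<le> P ^ j / fact j" by (simp add: pos_le_divide_eq mult.commute)
    show "1 / real l * ?e (k - exp_defect l) (primes_le x) \<le>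
      (if special l then 1 / real l else 0) * (P ^ k / fact k) + 1 / real l * (if k = 0 then 0 else (1 + P) ^ (k - 1))"
    proof (cases "special l")
      case True
      then have "j = k" using special_iff_exp_defect[OF l0] by (simp add: j_def)
      then have "1 / real l * ?e (k - exp_defect l) (primes_le x) \<le> 1 / real l * (P ^ k / fact k)"
        using ej by (intro mult_left_mono) (auto simp: j_def)
      moreover have "0 \<le> 1 / real l * (if k = 0 then 0 else (1 + P) ^ (k - 1))" using P0 by simp
      ultimately show ?thesis using True by simp
    next
      case False
      then have "exp_defect l > 0" using special_iff_exp_defect[OF l0] by simp
      then have k: "j \<le> k - 1" "k > 0" using l by (auto simp: j_def)
      have "P ^ j / fact j \<le> P ^ j / 1" using P0 by (intro divide_left_mono) (auto simp: fact_ge_1)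
      also have "\<dots> \<le> (1 + P) ^ j" using P0 by (simp add: power_mono)
      also have "\<dots> \<le> (1 + P) ^ (k - 1)" using P0 k by (intro power_increasing) auto
      finally have "1 / real l * ?e (k - exp_defect l) (primes_le x) \<le> 1 / real l * (1 + P) ^ (k - 1)"
        using ej by (intro mult_left_mono) (auto simp: j_def)
      then show ?thesis using False k by simp
    qed
  qed
  also have "\<dots> = (\<Sum>l\<in>?L. if special l then 1 / real l else 0) * (P ^ k / fact k) + (\<Sum>l\<in>?L. 1 / real l) * (if k = 0 then 0 else (1 + P) ^ (k - 1))"
    by (simp only: sum.distrib sum_distrib_right)
  also have "\<dots> \<le> B_const * (P ^ k / fact k) + powerful_sum * (if k = 0 then 0 else (1 + P) ^ (k - 1))"
  proof (intro add_mono mult_right_mono)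
    have "(\<Sum>l\<in>?L. if special l then 1 / real l else 0) = (\<Sum>l\<in>{l\<in>?L. special l}. 1 / real l)"
      using fL by (intro sum.inter_filter[symmetric])
    also have "\<dots> \<le> B_const" by (intro B_const_finite_sum_le finite_subset[OF _ fL]) auto
    finally show "(\<Sum>l\<in>?L. if special l then 1 / real l else 0) \<le> B_const" .
    show "(\<Sum>l\<in>?L. 1 / real l) \<le> powerful_sum"
      using powerful_finite_sum_le[of ?L "\<lambda>l. 1 / real l" 1] fL by (auto simp: powerful_def inverse_le_powr_three_quarters)
  qed (use P0 in auto)
  finally show ?thesis by simp
qed

text \<open>Restrict to special l \<le> sqrt x and to k primes \<le> z not dividing l, where z^k \<le> sqrt x, so that the
  product is at most x automatically. Excluding the prime divisors of l lowers the sum of the reciprocals by at most \<omega>(l).\<close>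

lemma log_density_lower:
  fixes x :: real and k :: nat
  assumes x: "x \<ge> 1"
  defines "z \<equiv> x powr (1 / (2 * (real k + 1)))"
  defines "P \<equiv> prime_recip_sum z"
  shows "fact k * log_density k x \<ge> (B_const - x powr (- 1 / 8) * powerful_sum) * P ^ k - (8 + real k) * powerful_sum * (real k * P ^ (k - 1))"
proof -
  have P0: "P \<ge> 0" unfolding P_def by (rule prime_recip_sum_nonneg)
  let ?e = "esym (\<lambda>p. 1 / real p)"
  let ?M = "{m. m > 0 \<and> real m \<le> x \<and> next_defect m = k}"
  let ?L = "{l. powerful l \<and> special l \<and> real l \<le> sqrt x}"
  define A where "A = (\<lambda>l. {p \<in> primes_le z. \<not> p dvd l})"
  let ?T = "SIGMA l:?L. {S. S \<subseteq> A l \<and> card S = k}"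
  let ?f = "\<lambda>(l::nat, S::nat set). \<Prod>S * l"
  have fA [simp]: "finite (A l)" for l by (simp add: A_def)
  have fL: "finite ?L" by (rule finite_subset[OF _ finite_nat_le[of "sqrt x"]]) (auto simp: powerful_def)
  have fT: "finite ?T" using fL by (intro finite_SigmaI) auto
  have fM: "finite ?M" by (rule finite_subset[OF _ finite_nat_le[of x]]) auto
  have T: "finite S \<and> (\<forall>p\<in>S. prime p \<and> \<not> p dvd l \<and> real p \<le> z) \<and> powerful l \<and> special l \<and> real l \<le> sqrt x \<and> card S = k"
    if "(l, S) \<in> ?T" for l S
  proof -
    have "S \<subseteq> A l" using that by auto
    then have "finite S" by (rule finite_subset) simp
    then show ?thesis using that by (auto simp: A_def primes_le_def)
  qed
  have inj: "inj_on ?f ?T"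
  proof (rule inj_onI)
    fix t t' assume t: "t \<in> ?T" "t' \<in> ?T" "?f t = ?f t'"
    obtain l S l' S' where tt: "t = (l, S)" "t' = (l', S')" by (cases t, cases t')
    have a: "(l, S) \<in> ?T" "(l', S') \<in> ?T" and eq: "\<Prod>S * l = \<Prod>S' * l'"
      using t unfolding tt prod.case by blast+
    have "S = S'" using simple_primes_compose[of S l] simple_primes_compose[of S' l'] T[OF a(1)] T[OF a(2)] eq by auto
    moreover have "l = l'" using powerful_part_compose[of S l] powerful_part_compose[of S' l'] T[OF a(1)] T[OF a(2)] eq by auto
    ultimately show "t = t'" unfolding tt by simp
  qed
  have zk: "z ^ k \<le> sqrt x"
  proof -
    have "z ^ k = x powr (1 / (2 * (real k + 1)) * real k)" using x by (simp add: z_def powr_powr flip: powr_realpow)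
    also have "\<dots> \<le> x powr (1 / 2)" using x by (intro powr_mono) (auto simp: field_simps)
    finally show ?thesis using x by (simp add: powr_half_sqrt)
  qed
  have sub: "?f ` ?T \<subseteq> ?M"
  proof
    fix y assume "y \<in> ?f ` ?T"
    then obtain l S where y: "(l, S) \<in> ?T" "y = \<Prod>S * l" by auto
    note t = T[OF y(1)]
    have "real (\<Prod>S) = (\<Prod>p\<in>S. real p)" by simp
    also have "\<dots> \<le> (\<Prod>p\<in>S. z)" using t by (intro prod_mono) auto
    also have "\<dots> = z ^ k" using t by simp
    finally have "real (\<Prod>S) * real l \<le> sqrt x * sqrt x" using zk t x by (intro mult_mono) auto
    then have "real y \<le> x" using x y by simp
    moreover have "l > 0" using t by (simp add: powerful_def)
    ultimately show "y \<in> ?M"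
      using next_defect_compose[of S l] compose_pos[of S l] t y special_iff_exp_defect[of l] by auto
  qed
  have main: "1 / real l * (P ^ k - real k * (real (prime_omega l) + real k) * P ^ (k - 1)) \<le> fact k * (1 / real l * ?e k (A l))"
    if l: "l \<in> ?L" for l
  proof -
    have l0: "l > 0" using l by (simp add: powerful_def)
    have "P = (\<Sum>p\<in>A l. 1 / real p) + (\<Sum>p\<in>primes_le z - A l. 1 / real p)"
      unfolding P_def prime_recip_sum_def by (subst sum.subset_diff[of "A l"]) (auto simp: A_def)
    also have "(\<Sum>p\<in>primes_le z - A l. 1 / real p) \<le> (\<Sum>p\<in>prime_factors l. 1)"
    proof (rule sum_mono2[THEN order_trans[rotated]])
      show "primes_le z - A l \<subseteq> prime_factors l" using l0 by (auto simp: A_def primes_le_def prime_factors_dvd)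
      show "(\<Sum>p\<in>primes_le z - A l. 1 / real p) \<le> (\<Sum>p\<in>primes_le z - A l. 1)" 
        by (intro sum_mono) (auto simp: primes_le_def dest: prime_ge_1_nat)
    qed auto
    also have "(\<Sum>p\<in>prime_factors l. 1) = real (prime_omega l)" by (simp add: prime_omega_def)
    finally have "P - (real (prime_omega l) + real k) \<le> (\<Sum>p\<in>A l. 1 / real p) - real k" by simp
    then have "max 0 (P - (real (prime_omega l) + real k)) ^ k \<le> (max 0 ((\<Sum>p\<in>A l. 1 / real p) - real k)) ^ k"
      by (intro power_mono) auto
    also have "\<dots> \<le> fact k * ?e k (A l)"
      by (intro esym_lower fA; auto simp: A_def primes_le_def dest: prime_ge_1_nat)
    finally have "P ^ k - real k * (real (prime_omega l) + real k) * P ^ (k - 1) \<le> fact k * ?e k (A l)"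
      using power_max_minus_ge[of P "real (prime_omega l) + real k" k] P0 by linarith
    then have "1 / real l * (P ^ k - real k * (real (prime_omega l) + real k) * P ^ (k - 1)) \<le> 1 / real l * (fact k * ?e k (A l))"
      by (intro mult_left_mono) auto
    then show ?thesis by (simp add: mult_ac)
  qed
  have omega_sum: "(\<Sum>l\<in>?L. (real (prime_omega l) + real k) / real l) \<le> (8 + real k) * powerful_sum"
  proof (rule powerful_finite_sum_le[OF fL])
    fix l assume l: "l \<in> ?L"
    then have l0: "l > 0" by (simp add: powerful_def)
    have "1 \<le> real l powr (1 / 4)" using l0 by (simp add: ge_one_powr_ge_zero)
    then have "real k * 1 \<le> real k * real l powr (1 / 4)" by (intro mult_left_mono) auto
    then have "real (prime_omega l) + real k \<le> (8 + real k) * real l powr (1 / 4)"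
      using prime_omega_le_powr[OF l0] by (simp add: algebra_simps)
    then have "(real (prime_omega l) + real k) / real l \<le> (8 + real k) * real l powr (1 / 4) / real l"
      by (intro divide_right_mono) auto
    also have "\<dots> = (8 + real k) * (real l powr (1 / 4) * real l powr (- 1))" using l0 by (simp add: powr_minus_divide)
    also have "real l powr (1 / 4) * real l powr (- 1) = real l powr (- 3 / 4)" by (simp only: powr_add[symmetric]) simp
    finally show "(real (prime_omega l) + real k) / real l \<le> (8 + real k) * real l powr (- 3 / 4)" .
  qed auto
  have tail: "B_const - x powr (- 1 / 8) * powerful_sum \<le> (\<Sum>l\<in>?L. 1 / real l)"
  proof -
    have "sqrt x powr (- 1 / 4) = x powr (- 1 / 8)" using x by (simp add: powr_half_sqrt[symmetric] powr_powr)
    then show ?thesis using B_const_tail[of "sqrt x"] x by simp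
  qed
  have "(B_const - x powr (- 1 / 8) * powerful_sum) * P ^ k - (8 + real k) * powerful_sum * (real k * P ^ (k - 1))
     \<le> (\<Sum>l\<in>?L. 1 / real l) * P ^ k - (\<Sum>l\<in>?L. (real (prime_omega l) + real k) / real l) * (real k * P ^ (k - 1))"
    using P0 by (intro diff_mono mult_right_mono tail omega_sum) auto
  also have "\<dots> = (\<Sum>l\<in>?L. 1 / real l * (P ^ k - real k * (real (prime_omega l) + real k) * P ^ (k - 1)))"
    unfolding sum_distrib_right sum_subtractf[symmetric]
    by (intro sum.cong refl) (simp add: algebra_simps add_divide_distrib diff_divide_distrib)
  also have "\<dots> \<le> (\<Sum>l\<in>?L. fact k * (1 / real l * ?e k (A l)))" by (rule sum_mono) (rule main)
  also have "\<dots> = fact k * (\<Sum>l\<in>?L. 1 / real l * ?e k (A l))" by (simp only: sum_distrib_left)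
  also have "(\<Sum>l\<in>?L. 1 / real l * ?e k (A l)) = (\<Sum>l\<in>?L. \<Sum>S | S \<subseteq> A l \<and> card S = k. 1 / real l * (\<Prod>p\<in>S. 1 / real p))"
    by (simp only: esym_def sum_distrib_left)
  also have "\<dots> = (\<Sum>(l, S)\<in>?T. 1 / real l * (\<Prod>p\<in>S. 1 / real p))"
    by (rule sum.Sigma) (use fL in auto)
  also have "\<dots> = (\<Sum>t\<in>?T. 1 / real (?f t))"
    by (intro sum.cong refl) (auto simp: prod_dividef)
  also have "\<dots> = (\<Sum>m\<in>?f ` ?T. 1 / real m)" by (simp only: sum.reindex[OF inj] o_def)
  also have "\<dots> \<le> log_density k x" unfolding log_density_def using fM sub by (intro sum_mono2) auto
  finally show ?thesis by simp
qed

text \<open>In the lower bound the primes go up to a fixed power z of x only; this changes log log by a constant and is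
  invisible at the precision required.\<close>

lemma log_density_asymptotic:
  obtains C x0 where "C \<ge> 0" "x0 \<ge> 3" "\<And>x. x \<ge> x0 \<Longrightarrow> ln (ln x) \<ge> 1"
    "\<And>x. x \<ge> x0 \<Longrightarrow> \<bar>log_density k x - B_const * ln (ln x) ^ k / fact k\<bar> \<le> C * (ln (ln x) ^ k / ln (ln x))"
proof -
  obtain M where M: "M \<ge> 0" "\<And>x. x \<ge> 3 \<Longrightarrow> \<bar>prime_recip_sum x - ln (ln x)\<bar> \<le> M"
    by (rule mertens_second, rule that; blast)
  define M' where "M' = M + ln (2 * (real k + 1))"
  have M'0: "M' \<ge> 0" using M by (simp add: M'_def)
  note ps = powerful_sum_nonneg
  define C1 where "C1 = B_const * (real k * M * (1 + M) ^ k) + powerful_sum * (real k * (2 + M) ^ k)"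
  define C2 where "C2 = B_const * (real k * M' * (1 + M') ^ k) + 8 * powerful_sum * (1 + M') ^ k
     + (8 + real k) * powerful_sum * (real k * (1 + M') ^ k)"
  have C10: "C1 \<ge> 0" and C20: "C2 \<ge> 0"
    unfolding C1_def C2_def using M M'0 ps B_const_pos by (auto intro!: add_nonneg_nonneg mult_nonneg_nonneg)
  define x0 :: real where "x0 = max (exp (exp 1)) (3 ^ (2 * (k + 1)))"
  have x03: "x0 \<ge> 3"
    unfolding x0_def using power_increasing[of 1 "2 * (k + 1)" "3::real"] by simp
  have llx: "ln (ln x) \<ge> 1" if "x \<ge> x0" for x
  proof -
    have "exp (exp 1) \<le> x" using that by (simp add: x0_def)
    then have "exp 1 \<le> ln x" by (meson exp_gt_zero less_le_trans ln_ge_iff)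
    then show ?thesis by (meson exp_gt_zero less_le_trans ln_ge_iff)
  qed
  have main: "\<bar>log_density k x - B_const * ln (ln x) ^ k / fact k\<bar> \<le> (C1 + C2) * (ln (ln x) ^ k / ln (ln x))" if x: "x \<ge> x0" for x
  proof -
    define b where "b = ln (ln x)"
    define e where "e = b ^ k / b"
    have b: "b \<ge> 1" using llx[OF x] by (simp add: b_def)
    have e0: "e \<ge> 0" using b by (simp add: e_def)
    have x3: "x \<ge> 3" using x x03 by simp
    note lx = ln_ln_pos[OF x3]
    define P where "P = prime_recip_sum x"
    have P: "\<bar>P - b\<bar> \<le> M" "P \<ge> 0" using M(2)[OF x3] prime_recip_sum_nonneg by (auto simp: P_def b_def)
    define z where "z = x powr (1 / (2 * (real k + 1)))"
    have lnz: "ln z = ln x / (2 * (real k + 1))" using x3 by (simp add: z_def ln_powr)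
    have z3: "z \<ge> 3"
    proof -
      have "(3 ^ (2 * (k + 1))) powr (1 / (2 * (real k + 1))) \<le> z"
        unfolding z_def using x by (intro powr_mono2) (auto simp: x0_def)
      also have "(3 ^ (2 * (k + 1)) :: real) = 3 powr (2 * (real k + 1))"
        by (subst powr_realpow[symmetric]) (auto simp: algebra_simps)
      also have "(3 powr (2 * (real k + 1))) powr (1 / (2 * (real k + 1))) = (3::real)"
        by (simp add: powr_powr)
      finally show ?thesis .
    qed
    define Q where "Q = prime_recip_sum z"
    have "ln (ln z) = b - ln (2 * (real k + 1))" unfolding lnz b_def using lx by (simp add: ln_div)
    moreover have "ln (2 * (real k + 1)) \<ge> 0" by simp
    ultimately have Q: "\<bar>Q - b\<bar> \<le> M'" "Q \<ge> 0"
      using M(2)[OF z3] prime_recip_sum_nonneg[of z] unfolding Q_def M'_def by linarith+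
    have f1: "fact k \<ge> (1::real)" by (rule fact_ge_1)
    have "log_density k x \<le> B_const * P ^ k / fact k + powerful_sum * (if k = 0 then 0 else (1 + P) ^ (k - 1))"
      unfolding P_def by (rule log_density_upper)
    also have "B_const * P ^ k / fact k \<le> B_const * b ^ k / fact k + B_const * (real k * M * (1 + M) ^ k) * e"
    proof -
      have "P ^ k - b ^ k \<le> real k * M * (1 + M) ^ k * e"
        using power_close(1)[OF P(2) b P(1), of k] by (simp add: e_def)
      then have "B_const * (P ^ k - b ^ k) \<le> B_const * (real k * M * (1 + M) ^ k * e)"
        using B_const_pos by (intro mult_left_mono) auto
      then have "B_const * (P ^ k - b ^ k) / fact k \<le> B_const * (real k * M * (1 + M) ^ k * e) / fact k"
        by (intro divide_right_mono) auto
      also have "\<dots> \<le> B_const * (real k * M * (1 + M) ^ k * e) / 1"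
        using f1 B_const_pos M e0 by (intro divide_left_mono) auto
      finally show ?thesis by (simp add: algebra_simps diff_divide_distrib)
    qed
    also have "(if k = 0 then 0 else (1 + P) ^ (k - 1)) \<le> real k * (2 + M) ^ k * e"
    proof (cases "k = 0")
      case False
      have "1 * (1 + P) ^ (k - 1) \<le> real k * (1 + P) ^ (k - 1)" using False P by (intro mult_right_mono) auto
      also have "\<dots> \<le> real k * (1 + (1 + M)) ^ k * e"
        unfolding e_def using P b by (intro power_close(3)) auto
      finally show ?thesis using False by (simp add: algebra_simps)
    qed simp
    finally have "log_density k x \<le> B_const * b ^ k / fact k + B_const * (real k * M * (1 + M) ^ k) * e + powerful_sum * (real k * (2 + M) ^ k * e)"
      using ps by (simp add: mult_left_mono)
    then have up: "log_density k x - B_const * b ^ k / fact k \<le> C1 * e" by (simp add: C1_def algebra_simps)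
    have t: "x powr (- 1 / 8) \<le> 8 / b"
    proof -
      have "b \<le> ln x" using ln_le_minus_one[of "ln x"] lx by (simp add: b_def)
      also have "\<dots> \<le> x powr (1 / 8) / (1 / 8)" using x3 by (intro ln_powr_bound) auto
      finally have "b \<le> 8 * x powr (1 / 8)" by simp
      then show ?thesis using b x3 by (simp add: powr_minus_divide field_simps)
    qed
    have "B_const * b ^ k - C2 * e \<le> (B_const - x powr (- 1 / 8) * powerful_sum) * Q ^ k - (8 + real k) * powerful_sum * (real k * Q ^ (k - 1))"
    proof -
      have "b ^ k - Q ^ k \<le> real k * M' * (1 + M') ^ k * e"
        using power_close(1)[OF Q(2) b Q(1), of k] by (simp add: e_def)
      then have 1: "B_const * (b ^ k - Q ^ k) \<le> B_const * (real k * M' * (1 + M') ^ k * e)"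
        using B_const_pos by (intro mult_left_mono) auto
      have "x powr (- 1 / 8) * powerful_sum * Q ^ k \<le> 8 / b * powerful_sum * ((1 + M') ^ k * b ^ k)"
        using t ps Q power_close(2)[OF Q(2) b Q(1), of k] b by (intro mult_mono) auto
      also have "\<dots> = 8 * powerful_sum * (1 + M') ^ k * e" by (simp add: e_def)
      finally have 2: "x powr (- 1 / 8) * powerful_sum * Q ^ k \<le> 8 * powerful_sum * (1 + M') ^ k * e" .
      have "real k * Q ^ (k - 1) \<le> real k * (1 + M') ^ k * e"
        unfolding e_def by (rule power_close(3)[OF Q(2) b Q(1)])
      then have 3: "(8 + real k) * powerful_sum * (real k * Q ^ (k - 1)) \<le> (8 + real k) * powerful_sum * (real k * (1 + M') ^ k * e)"
        using ps by (intro mult_left_mono) auto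
      show ?thesis using 1 2 3 by (simp add: C2_def algebra_simps)
    qed
    also have "\<dots> \<le> fact k * log_density k x"
      using log_density_lower[of x k] x3 unfolding Q_def z_def by simp
    finally have "B_const * b ^ k / fact k - C2 * e / fact k \<le> log_density k x"
      by (simp add: diff_divide_distrib[symmetric] pos_divide_le_eq mult.commute)
    moreover have "C2 * e / fact k \<le> C2 * e / 1" using f1 C20 e0 by (intro divide_left_mono) auto
    ultimately have lo: "B_const * b ^ k / fact k - log_density k x \<le> C2 * e" by simp
    have "C1 * e \<le> (C1 + C2) * e" "C2 * e \<le> (C1 + C2) * e" using C10 C20 e0 by (auto intro: mult_right_mono)
    with up lo show ?thesis by (simp add: abs_le_iff b_def e_def)
  qed
  show thesis by (rule that[OF add_nonneg_nonneg[OF C10 C20] x03 llx main])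
qed

section \<open>Weighting by the logarithms of the simple primes\<close>

definition defect_set :: "nat \<Rightarrow> real \<Rightarrow> nat set" where
  "defect_set k x = {n. n > 0 \<and> real n \<le> x \<and> exp_defect n = k}"

definition simple_log_sum :: "nat \<Rightarrow> real \<Rightarrow> real" where
  "simple_log_sum k x = (\<Sum>n\<in>defect_set k x. \<Sum>p\<in>simple_primes n. ln (real p))"

lemma finite_defect_set [simp]: "finite (defect_set k x)"
  by (rule finite_subset[OF _ finite_nat_le[of x]]) (auto simp: defect_set_def)

text \<open>Replace n = p m by the pair (m, p): p divides n exactly once if and only if it does not divide m, and
  then the defect of n is \<open>next_defect m\<close>.\<close>

lemma simple_log_sum_eq:
  "simple_log_sum k x = (\<Sum>m | m > 0 \<and> real m \<le> x \<and> next_defect m = k. \<Sum>p | p \<in> primes_le (x / real m) \<and> \<not> p dvd m. ln (real p))"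
proof -
  let ?M = "{m. m > 0 \<and> real m \<le> x \<and> next_defect m = k}"
  have fM: "finite ?M" by (rule finite_subset[OF _ finite_nat_le[of x]]) auto
  have "simple_log_sum k x = (\<Sum>(n, p)\<in>(SIGMA n:defect_set k x. simple_primes n). ln (real p))"
    unfolding simple_log_sum_def by (rule sum.Sigma) auto
  also have "\<dots> = (\<Sum>(m, p)\<in>(SIGMA m:?M. {p. p \<in> primes_le (x / real m) \<and> \<not> p dvd m}). ln (real p))"
  proof (rule sum.reindex_bij_witness[where i = "\<lambda>(m, p). (p * m, p)" and j = "\<lambda>(n, p). (n div p, p)"])
    fix y assume "y \<in> (SIGMA n:defect_set k x. simple_primes n)"
    then obtain n p where y: "y = (n, p)" "n > 0" "real n \<le> x" "exp_defect n = k" "p \<in> simple_primes n"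
      by (auto simp: defect_set_def)
    obtain m where m: "n = p * m" "\<not> p dvd m" "m > 0" using simple_primes_cofactor[OF y(5)] by metis
    have p: "prime p" "p > 0" using simple_primesD(1)[OF y(5)] by (auto simp: prime_gt_0_nat)
    have nd: "n div p = m" using m p by simp
    have "real p * real m \<le> x" using y m by simp
    have "1 * real m \<le> real p * real m" using p by (intro mult_right_mono) auto
    then have "real m \<le> x" using \<open>real p * real m \<le> x\<close> by linarith
    have "real p \<le> x / real m" using m \<open>real p * real m \<le> x\<close> by (simp add: pos_le_divide_eq)
    then show "(case y of (n, p) \<Rightarrow> (n div p, p)) \<in> (SIGMA m:?M. {p. p \<in> primes_le (x / real m) \<and> \<not> p dvd m})"
      using exp_defect_prime_mult(1)[OF m(3) p(1) m(2)] y m p nd \<open>real m \<le> x\<close> by (auto simp: primes_le_def)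
    show "(case case y of (n, p) \<Rightarrow> (n div p, p) of (m, p) \<Rightarrow> (p * m, p)) = y" using y m nd by simp
    show "(case case y of (n, p) \<Rightarrow> (n div p, p) of (m, p) \<Rightarrow> ln (real p)) = (case y of (n, p) \<Rightarrow> ln (real p))" using y by simp
  next
    fix y assume "y \<in> (SIGMA m:?M. {p. p \<in> primes_le (x / real m) \<and> \<not> p dvd m})"
    then obtain m p where y: "y = (m, p)" "m > 0" "real m \<le> x" "next_defect m = k" "prime p" "real p \<le> x / real m" "\<not> p dvd m"
      by (auto simp: primes_le_def)
    have p: "p > 0" using y by (simp add: prime_gt_0_nat)
    have "real (p * m) \<le> x" using y by (simp add: pos_le_divide_eq)
    then show "(case y of (m, p) \<Rightarrow> (p * m, p)) \<in> (SIGMA n:defect_set k x. simple_primes n)"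
      using exp_defect_prime_mult[OF y(2) y(5) y(7)] y p by (auto simp: defect_set_def)
    show "(case case y of (m, p) \<Rightarrow> (p * m, p) of (n, p) \<Rightarrow> (n div p, p)) = y" using y p by simp
  qed
  also have "\<dots> = (\<Sum>m\<in>?M. \<Sum>p | p \<in> primes_le (x / real m) \<and> \<not> p dvd m. ln (real p))"
    by (rule sum.Sigma[symmetric]) (use fM in auto)
  finally show ?thesis .
qed

text \<open>The left-hand side is part of the sum of the von Mangoldt function over the divisors of m.\<close>

lemma sum_ln_prime_divisors_le:
  assumes "m > 0"
  shows "(\<Sum>p\<in>prime_factors m. ln (real p)) \<le> ln (real m)"
proof -
  have "(\<Sum>p\<in>prime_factors m. ln (real p)) = (\<Sum>p\<in>prime_factors m. mangoldt p)"
    by (intro sum.cong refl) (simp add: in_prime_factors_imp_prime)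
  also have "\<dots> \<le> (\<Sum>d | d dvd m. mangoldt d)"
    using assms by (intro sum_mono2) (auto simp: mangoldt_nonneg)
  also have "\<dots> = ln (real m)" using mangoldt_sum[of m, where 'a = real] assms by simp
  finally show ?thesis .
qed

lemma theta_coprime_bounds:
  assumes "m > 0"
  shows "(\<Sum>p | p \<in> primes_le y \<and> \<not> p dvd m. ln (real p)) \<le> theta y"
    and "theta y - ln (real m) \<le> (\<Sum>p | p \<in> primes_le y \<and> \<not> p dvd m. ln (real p))"
    and "0 \<le> (\<Sum>p | p \<in> primes_le y \<and> \<not> p dvd m. ln (real p))"
proof -
  let ?A = "{p. p \<in> primes_le y \<and> \<not> p dvd m}" and ?B = "{p. p \<in> primes_le y \<and> p dvd m}"
  have eq: "theta y = (\<Sum>p\<in>?A. ln (real p)) + (\<Sum>p\<in>?B. ln (real p))"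
    unfolding theta_def by (subst sum.union_disjoint[symmetric]) (auto intro!: sum.cong)
  show "0 \<le> (\<Sum>p\<in>?A. ln (real p))" by (intro sum_nonneg ln_of_nat_nonneg)
  have "0 \<le> (\<Sum>p\<in>?B. ln (real p))" by (intro sum_nonneg ln_of_nat_nonneg)
  then show "(\<Sum>p\<in>?A. ln (real p)) \<le> theta y" using eq by linarith
  have "(\<Sum>p\<in>?B. ln (real p)) \<le> (\<Sum>p\<in>prime_factors m. ln (real p))"
    using assms by (intro sum_mono2) (auto simp: primes_le_def prime_factors_dvd ln_of_nat_nonneg)
  also have "\<dots> \<le> ln (real m)" by (rule sum_ln_prime_divisors_le[OF assms])
  finally show "theta y - ln (real m) \<le> (\<Sum>p\<in>?A. ln (real p))" using eq by linarith
qed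

lemma card_nat_le: "y \<ge> 0 \<Longrightarrow> real (card {n::nat. n > 0 \<and> real n \<le> y}) \<le> y"
proof -
  assume y: "y \<ge> 0"
  have "{n::nat. n > 0 \<and> real n \<le> y} \<subseteq> {1..nat \<lfloor>y\<rfloor>}" by (auto simp: le_nat_floor)
  then have "card {n::nat. n > 0 \<and> real n \<le> y} \<le> nat \<lfloor>y\<rfloor>" using card_mono[of "{1..nat \<lfloor>y\<rfloor>}"] by simp
  then show ?thesis using y by linarith
qed

text \<open>For m \<le> sqrt x the argument x/m is at least sqrt x and the prime number theorem applies with relative error
  O(1/log log x). For larger m the bound theta(x/m) = O(x/m) suffices: \<open>log_density\<close> changes little
  between sqrt x and x, because log log x and log log (sqrt x) differ by ln 2.\<close>

lemma simple_log_sum_asymptotic: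
  obtains C x0 where "C \<ge> 0" "x0 \<ge> 3" "\<And>x. x \<ge> x0 \<Longrightarrow> ln (ln x) \<ge> 1"
    "\<And>x. x \<ge> x0 \<Longrightarrow> \<bar>simple_log_sum k x - B_const * x * ln (ln x) ^ k / fact k\<bar> \<le> C * x * (ln (ln x) ^ k / ln (ln x))"
proof -
  obtain A where A: "A \<ge> 0" "\<And>x. x \<ge> 3 \<Longrightarrow> \<bar>theta x - x\<bar> \<le> A * x / ln (ln x)" "\<And>x. x \<ge> 0 \<Longrightarrow> theta x \<le> A * x"
    by (rule theta_asymptotic, rule that; blast)
  obtain D x0 where D: "D \<ge> 0" "x0 \<ge> 3" "\<And>x. x \<ge> x0 \<Longrightarrow> ln (ln x) \<ge> 1"
    "\<And>x. x \<ge> x0 \<Longrightarrow> \<bar>log_density k x - B_const * ln (ln x) ^ k / fact k\<bar> \<le> D * (ln (ln x) ^ k / ln (ln x))"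
    by (rule log_density_asymptotic[of k], rule that; blast)
  define T where "T = 3 * D + B_const * (real k * 2 ^ k)"
  define C where "C = A * (2 * (B_const + D)) + 16 + (A + 1) * T + D"
  have B0: "B_const \<ge> 0" using B_const_pos by simp
  have T0: "T \<ge> 0" using D B0 by (simp add: T_def)
  have C0: "C \<ge> 0" using A D B0 T0 by (simp add: C_def)
  have x0sq: "x0\<^sup>2 \<ge> x0" using D(2) by (simp add: power2_eq_square)
  have main: "\<bar>simple_log_sum k x - B_const * x * ln (ln x) ^ k / fact k\<bar> \<le> C * x * (ln (ln x) ^ k / ln (ln x))"
    if x: "x \<ge> x0\<^sup>2" for x
  proof -
    have xx0: "x \<ge> x0" using x x0sq by simp
    have x3: "x \<ge> 3" using xx0 D(2) by simp
    define r where "r = sqrt x"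
    have r: "r \<ge> x0" unfolding r_def using x by (rule real_le_rsqrt)
    have rr: "r * r = x" "r > 0" using x3 r D(2) by (auto simp: r_def)
    have rx: "r \<le> x" using mult_left_mono[of 1 r r] rr r D(2) by simp
    note lx = ln_ln_pos[OF x3]
    define b b' where "b = ln (ln x)" and "b' = ln (ln r)"
    have b: "b \<ge> 1" and b': "b' \<ge> 1" using D(3) xx0 r by (auto simp: b_def b'_def)
    have "ln r = ln x / 2" using x3 by (simp add: r_def ln_sqrt)
    moreover have "ln (ln x / 2) = ln (ln x) - ln 2" using lx by (simp add: ln_div)
    ultimately have bb': "b' = b - ln 2" by (simp only: b_def b'_def)
    have ln2: "0 \<le> ln (2::real)" "ln 2 \<le> (1::real)" using ln_2_less_1 by auto
    define e e' where "e = b ^ k / b" and "e' = b' ^ k / b'"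
    have e1: "e \<ge> 1 / b" using b by (simp add: e_def divide_right_mono)
    have e0: "e \<ge> 0" using b by (simp add: e_def)
    have e'e: "e' \<le> 2 * e"
    proof -
      have "b \<le> 2 * b'" using bb' b' ln2 by linarith
      then have "1 / b' \<le> 2 / b" using b b' by (simp add: field_simps)
      moreover have "b' ^ k \<le> b ^ k" using bb' b' ln2 by (intro power_mono) auto
      ultimately have "b' ^ k * (1 / b') \<le> b ^ k * (2 / b)" using b b' by (intro mult_mono) auto
      then show ?thesis by (simp add: e_def e'_def mult.commute)
    qed
    let ?M = "{m. m > 0 \<and> real m \<le> x \<and> next_defect m = k}"
    let ?M1 = "{m. m > 0 \<and> real m \<le> r \<and> next_defect m = k}"
    have fM: "finite ?M" by (rule finite_subset[OF _ finite_nat_le[of x]]) auto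
    have fM1: "finite ?M1" by (rule finite_subset[OF _ finite_nat_le[of r]]) auto
    have M1M: "?M1 \<subseteq> ?M" using rx by auto
    \<comment> \<open>The inner sum of \<open>simple_log_sum_eq\<close>; it is close to x/m for m \<le> r and of order at most x/m for all m.\<close>
    define w where "w = (\<lambda>m. \<Sum>p | p \<in> primes_le (x / real m) \<and> \<not> p dvd m. ln (real p))"
    have L: "log_density k x = (\<Sum>m\<in>?M. 1 / real m)" and L1: "log_density k r = (\<Sum>m\<in>?M1. 1 / real m)"
      by (simp_all add: log_density_def)
    have L2: "log_density k x - log_density k r = (\<Sum>m\<in>?M - ?M1. 1 / real m)"
      unfolding L L1 using sum.subset_diff[OF M1M fM, of "\<lambda>m. 1 / real m"] by simp
    have near: "\<bar>w m - x / real m\<bar> \<le> A * x / b' * (1 / real m) + ln x" if m: "m \<in> ?M1" for m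
    proof -
      have m0: "m > 0" "real m \<le> r" using m by auto
      have "r * real m \<le> r * r" using m0 rr by (intro mult_left_mono) auto
      then have xm: "x / real m \<ge> r" using m0 rr by (simp add: pos_le_divide_eq)
      then have xm3: "x / real m \<ge> 3" using r D(2) by linarith
      have "ln r \<le> ln (x / real m)" using xm rr by (subst ln_le_cancel_iff) auto
      moreover have "ln r > 1" using ln_ln_pos(2)[of r] r D(2) by simp
      ultimately have "b' \<le> ln (ln (x / real m))" unfolding b'_def by (subst ln_le_cancel_iff) auto
      then have "A * (x / real m) / ln (ln (x / real m)) \<le> A * (x / real m) / b'"
        using b' A x3 by (intro divide_left_mono mult_pos_pos) auto
      then have "\<bar>theta (x / real m) - x / real m\<bar> \<le> A * x / b' * (1 / real m)"
        using A(2)[OF xm3] by (simp add: mult.commute)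
      moreover have "ln (real m) \<le> ln x" using m0 rx rr by (subst ln_le_cancel_iff) auto
      ultimately show ?thesis
        using theta_coprime_bounds(1,2)[OF m0(1), of "x / real m"] ln_of_nat_nonneg[of m] unfolding w_def
        by (simp only: abs_le_iff) linarith
    qed
    have far: "\<bar>w m - x / real m\<bar> \<le> (A + 1) * x * (1 / real m)" if m: "m \<in> ?M - ?M1" for m
    proof -
      have m0: "m > 0" using m by auto
      have "w m \<le> A * (x / real m)"
        using theta_coprime_bounds(1)[OF m0, of "x / real m"] A(3)[of "x / real m"] x3 unfolding w_def by simp
      moreover have "w m \<ge> 0" unfolding w_def by (rule theta_coprime_bounds(3)[OF m0])
      moreover have "0 \<le> x / real m" "0 \<le> A * (x / real m)" using x3 A by auto
      ultimately have "\<bar>w m - x / real m\<bar> \<le> A * (x / real m) + x / real m" by (simp add: abs_le_iff)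
      then show ?thesis by (simp add: algebra_simps)
    qed
    have "\<bar>simple_log_sum k x - x * log_density k x\<bar> = \<bar>\<Sum>m\<in>?M. w m - x / real m\<bar>"
      unfolding simple_log_sum_eq L by (simp add: w_def sum_subtractf sum_distrib_left)
    also have "\<dots> \<le> (\<Sum>m\<in>?M. \<bar>w m - x / real m\<bar>)" by (rule sum_abs)
    also have "\<dots> = (\<Sum>m\<in>?M - ?M1. \<bar>w m - x / real m\<bar>) + (\<Sum>m\<in>?M1. \<bar>w m - x / real m\<bar>)"
      by (rule sum.subset_diff[OF M1M fM])
    also have "\<dots> \<le> (\<Sum>m\<in>?M - ?M1. (A + 1) * x * (1 / real m)) + (\<Sum>m\<in>?M1. A * x / b' * (1 / real m) + ln x)"
      by (intro add_mono sum_mono near far)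
    also have "\<dots> = (A + 1) * x * (log_density k x - log_density k r) + (A * x / b' * log_density k r + real (card ?M1) * ln x)"
      unfolding L2 unfolding L1 by (simp add: sum.distrib sum_distrib_left)
    finally have 1: "\<bar>simple_log_sum k x - x * log_density k x\<bar> \<le>
      (A + 1) * x * (log_density k x - log_density k r) + (A * x / b' * log_density k r + real (card ?M1) * ln x)" .
    have f1: "fact k \<ge> (1::real)" by (rule fact_ge_1)
    have Dx: "\<bar>log_density k x - B_const * b ^ k / fact k\<bar> \<le> D * e" using D(4)[OF xx0] by (simp add: b_def e_def)
    have Dr: "\<bar>log_density k r - B_const * b' ^ k / fact k\<bar> \<le> D * e'" using D(4)[OF r] by (simp add: b'_def e'_def)
    have De': "D * e' \<le> D * (2 * e)" using e'e D by (intro mult_left_mono) auto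
    have bpow: "B_const * b ^ k / fact k - B_const * b' ^ k / fact k \<le> B_const * (real k * 2 ^ k) * e"
    proof -
      have "b ^ k - b' ^ k \<le> real k * 1 * (1 + 1) ^ k * e"
        using power_close(1)[of b' b 1 k] b b' bb' ln2 by (simp add: e_def abs_le_iff)
      then have "B_const * (b ^ k - b' ^ k) \<le> B_const * (real k * 2 ^ k * e)" using B0 by (intro mult_left_mono) auto
      then have "B_const * (b ^ k - b' ^ k) / fact k \<le> B_const * (real k * 2 ^ k * e) / fact k" by (rule divide_right_mono) simp
      also have "\<dots> \<le> B_const * (real k * 2 ^ k * e) / 1" using f1 B0 e0 by (intro divide_left_mono) auto
      finally show ?thesis by (simp add: algebra_simps diff_divide_distrib)
    qed
    have "log_density k x - log_density k r \<le> T * e"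
      using Dx Dr De' bpow by (simp add: T_def algebra_simps abs_le_iff)
    then have 2: "(A + 1) * x * (log_density k x - log_density k r) \<le> (A + 1) * x * (T * e)"
      using A x3 by (intro mult_left_mono) auto
    have "log_density k r \<le> B_const * b' ^ k / fact k + D * e'" using Dr by (simp add: abs_le_iff)
    also have "B_const * b' ^ k / fact k \<le> B_const * b' ^ k / 1" using f1 B0 b' by (intro divide_left_mono) auto
    also have "D * e' \<le> D * b' ^ k"
    proof -
      have "b' ^ k / b' \<le> b' ^ k / 1" using b' by (intro divide_left_mono) auto
      then have "e' \<le> b' ^ k" by (simp add: e'_def)
      then show ?thesis by (rule mult_left_mono[OF _ D(1)])
    qed
    finally have "log_density k r \<le> (B_const + D) * b' ^ k" by (simp add: algebra_simps)
    then have "A * x / b' * log_density k r \<le> A * x / b' * ((B_const + D) * b' ^ k)"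
      using A x3 b' by (intro mult_left_mono) auto
    also have "\<dots> = A * x * (B_const + D) * e'" by (simp add: e'_def)
    also have "\<dots> \<le> A * x * (B_const + D) * (2 * e)" using A x3 B0 D e'e by (intro mult_left_mono) auto
    finally have 3: "A * x / b' * log_density k r \<le> A * x * (B_const + D) * (2 * e)" .
    have 4: "real (card ?M1) * ln x \<le> 16 * x * e"
    proof -
      have "card ?M1 \<le> card {n::nat. n > 0 \<and> real n \<le> r}" by (intro card_mono finite_nat_le) auto
      then have "real (card ?M1) \<le> r" using card_nat_le[of r] rr by linarith
      then have c: "real (card ?M1) * ln x \<le> r * ln x" using lx by (intro mult_right_mono) auto
      have l4: "ln x \<le> 4 * x powr (1 / 4)" using ln_powr_bound[of x "1/4"] x3 by simp
      have bl: "b \<le> ln x" using ln_le_minus_one[of "ln x"] lx by (simp add: b_def)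
      then have "b \<le> 4 * x powr (1 / 4)" using l4 by linarith
      then have "r * ln x * b \<le> r * (4 * x powr (1 / 4)) * (4 * x powr (1 / 4))"
        using l4 b rr lx by (intro mult_mono) auto
      also have "\<dots> = 16 * (r * (x powr (1 / 4) * x powr (1 / 4)))" by simp
      also have "x powr (1 / 4) * x powr (1 / 4) = r" using x3 by (simp add: r_def powr_half_sqrt flip: powr_add)
      finally have "r * ln x * b \<le> 16 * x" using rr by simp
      then have "r * ln x \<le> 16 * x * (1 / b)" using b by (simp add: pos_le_divide_eq)
      also have "\<dots> \<le> 16 * x * e" using e1 x3 by (intro mult_left_mono) auto
      finally show ?thesis using c by linarith
    qed
    have 5: "\<bar>x * log_density k x - x * (B_const * b ^ k / fact k)\<bar> \<le> x * (D * e)"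
      unfolding right_diff_distrib[symmetric] abs_mult using mult_left_mono[OF Dx, of x] x3 by simp
    have "\<bar>simple_log_sum k x - x * (B_const * b ^ k / fact k)\<bar> \<le> C * x * e"
    proof -
      have "C * x * e = (A + 1) * x * (T * e) + (A * x * (B_const + D) * (2 * e) + 16 * x * e) + x * (D * e)"
        by (simp add: C_def algebra_simps)
      then show ?thesis using 1 2 3 4 5 by linarith
    qed
    then show ?thesis by (simp add: b_def e_def mult_ac)
  qed
  show thesis
  proof (rule that[OF C0 _ _ main])
    show "x0\<^sup>2 \<ge> 3" using x0sq D(2) by linarith
    show "ln (ln x) \<ge> 1" if "x \<ge> x0\<^sup>2" for x using D(3) that x0sq by simp
  qed
qed

section \<open>From the weighted sum to the count\<close>

lemma sum_ln_simple_primes: "(\<Sum>p\<in>simple_primes n. ln (real p)) = ln (real (\<Prod>(simple_primes n)))"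
proof -
  have "(\<Sum>p\<in>simple_primes n. ln (real p)) = ln (\<Prod>p\<in>simple_primes n. real p)"
    by (intro ln_prod[symmetric]) (auto dest: simple_primesD(1) simp: prime_gt_0_nat)
  then show ?thesis by simp
qed

text \<open>The powerful part of n divides n, and at most x/l integers up to x are divisible by l.\<close>

lemma card_large_powerful_part:
  assumes "Y > 0" "x \<ge> 0"
  shows "real (card {n. n > 0 \<and> real n \<le> x \<and> real (powerful_part n) > Y}) \<le> x * (Y powr (- 1 / 4) * powerful_sum)"
proof -
  let ?L = "{l. powerful l \<and> real l \<le> x \<and> real l > Y}"
  have fL: "finite ?L" by (rule finite_subset[OF _ finite_nat_le[of x]]) (auto simp: powerful_def)
  have fin: "finite {n. n > 0 \<and> real n \<le> x \<and> l dvd n}" for l by (rule finite_subset[OF _ finite_nat_le[of x]]) auto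
  have "{n. n > 0 \<and> real n \<le> x \<and> real (powerful_part n) > Y} \<subseteq> (\<Union>l\<in>?L. {n. n > 0 \<and> real n \<le> x \<and> l dvd n})"
  proof
    fix n assume "n \<in> {n. n > 0 \<and> real n \<le> x \<and> real (powerful_part n) > Y}"
    then have n: "n > 0" "real n \<le> x" "real (powerful_part n) > Y" by auto
    have d: "powerful_part n dvd n" using prod_simple_primes_mult_powerful_part[OF n(1)] by (metis dvd_triv_right)
    then have "powerful_part n \<le> n" using n(1) by (rule dvd_imp_le)
    then have "powerful_part n \<in> ?L" using n powerful_powerful_part by simp
    then show "n \<in> (\<Union>l\<in>?L. {n. n > 0 \<and> real n \<le> x \<and> l dvd n})" using d n by blast
  qed
  then have "card {n. n > 0 \<and> real n \<le> x \<and> real (powerful_part n) > Y} \<le> card (\<Union>l\<in>?L. {n. n > 0 \<and> real n \<le> x \<and> l dvd n})"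
    using fL fin by (intro card_mono) auto
  also have "\<dots> \<le> (\<Sum>l\<in>?L. card {n. n > 0 \<and> real n \<le> x \<and> l dvd n})" by (rule card_UN_le[OF fL])
  finally have "real (card {n. n > 0 \<and> real n \<le> x \<and> real (powerful_part n) > Y}) \<le> real (\<Sum>l\<in>?L. card {n. n > 0 \<and> real n \<le> x \<and> l dvd n})"
    by (rule of_nat_mono)
  also have "\<dots> = (\<Sum>l\<in>?L. real (card {n. n > 0 \<and> real n \<le> x \<and> l dvd n}))" by simp
  also have "\<dots> \<le> (\<Sum>l\<in>?L. x * (1 / real l))"
  proof (rule sum_mono)
    fix l assume l: "l \<in> ?L"
    then have l0: "l > 0" by (auto simp: powerful_def)
    have "card {n. n > 0 \<and> real n \<le> x \<and> l dvd n} = card ((\<lambda>j. l * j) ` {j. j > 0 \<and> real j \<le> x / real l})"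
      using l0 by (intro arg_cong[where f = card]) (auto simp: pos_le_divide_eq mult.commute elim!: dvdE)
    also have "\<dots> \<le> card {j::nat. j > 0 \<and> real j \<le> x / real l}" by (intro card_image_le finite_nat_le)
    finally have "real (card {n. n > 0 \<and> real n \<le> x \<and> l dvd n}) \<le> real (card {j::nat. j > 0 \<and> real j \<le> x / real l})" by simp
    also have "\<dots> \<le> x / real l" using assms by (intro card_nat_le) auto
    finally show "real (card {n. n > 0 \<and> real n \<le> x \<and> l dvd n}) \<le> x * (1 / real l)" by simp
  qed
  also have "\<dots> = x * (\<Sum>l\<in>?L. 1 / real l)" by (simp only: sum_distrib_left)
  also have "\<dots> \<le> x * (Y powr (- 1 / 4) * powerful_sum)"
    using assms fL by (intro mult_left_mono powerful_inverse_tail) auto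
  finally show ?thesis .
qed

lemma simple_log_sum_le_card:
  assumes "x \<ge> 1"
  shows "simple_log_sum k x \<le> real (card (defect_set k x)) * ln x"
proof -
  have "simple_log_sum k x \<le> (\<Sum>n\<in>defect_set k x. ln x)" unfolding simple_log_sum_def
  proof (rule sum_mono)
    fix n assume n: "n \<in> defect_set k x"
    have "(\<Sum>p\<in>simple_primes n. ln (real p)) \<le> (\<Sum>p\<in>prime_factors n. ln (real p))"
      by (intro sum_mono2) (auto simp: simple_primes_def ln_of_nat_nonneg)
    also have "\<dots> \<le> ln (real n)" using n by (intro sum_ln_prime_divisors_le) (auto simp: defect_set_def)
    also have "\<dots> \<le> ln x" using n assms by (subst ln_le_cancel_iff) (auto simp: defect_set_def)
    finally show "(\<Sum>p\<in>simple_primes n. ln (real p)) \<le> ln x" .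
  qed
  then show ?thesis by simp
qed

text \<open>Unless n \<le> x / (log x)^4 or the powerful part of n exceeds (log x)^8, the product of the simple primes of n
  is at least x / (log x)^12, so n contributes at least log x - 12 log log x to \<open>simple_log_sum\<close>. With the exponents 4 and 8
  both exceptional sets have size O(x / (log x)^2).\<close>

lemma card_defect_set_le:
  assumes x: "x \<ge> 3" and big: "24 * ln (ln x) \<le> ln x"
  shows "real (card (defect_set k x)) \<le> simple_log_sum k x / (ln x - 12 * ln (ln x)) + (1 + powerful_sum) * x / (ln x)\<^sup>2"
proof -
  note lx = ln_ln_pos[OF x]
  define b where "b = ln (ln x)"
  define G where "G = {n \<in> defect_set k x. real (\<Prod>(simple_primes n)) \<ge> x / ln x ^ 12}"
  let ?E1 = "{n. n > 0 \<and> real n \<le> x / ln x ^ 4}" and ?E2 = "{n. n > 0 \<and> real n \<le> x \<and> real (powerful_part n) > ln x ^ 8}"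
  have d: "ln x - 12 * b > 0" using big lx by (simp add: b_def)
  have fG: "finite G" by (simp add: G_def)
  have fE2: "finite ?E2" by (rule finite_subset[OF _ finite_nat_le[of x]]) auto
  have cover: "defect_set k x \<subseteq> G \<union> (?E1 \<union> ?E2)"
  proof
    fix n assume n: "n \<in> defect_set k x"
    show "n \<in> G \<union> (?E1 \<union> ?E2)"
    proof (cases "n \<in> ?E1 \<union> ?E2")
      case False
      have n0: "n > 0" "real n \<le> x" using n by (auto simp: defect_set_def)
      then have f: "real n > x / ln x ^ 4" "real (powerful_part n) \<le> ln x ^ 8" using False by auto
      have "real n = real (\<Prod>(simple_primes n)) * real (powerful_part n)"
        using prod_simple_primes_mult_powerful_part[OF n0(1)] by (metis of_nat_mult)
      also have "\<dots> \<le> real (\<Prod>(simple_primes n)) * ln x ^ 8" by (intro mult_left_mono f(2) of_nat_0_le_iff)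
      finally have "x / ln x ^ 4 \<le> real (\<Prod>(simple_primes n)) * ln x ^ 8" using f(1) by linarith
      then have "x \<le> real (\<Prod>(simple_primes n)) * ln x ^ 8 * ln x ^ 4" using lx by (simp add: pos_divide_le_eq)
      also have "\<dots> = real (\<Prod>(simple_primes n)) * ln x ^ 12" by (simp only: mult.assoc power_add[symmetric]) simp
      finally have "real (\<Prod>(simple_primes n)) \<ge> x / ln x ^ 12" using lx by (simp add: pos_divide_le_eq)
      then show ?thesis using n by (simp add: G_def)
    qed simp
  qed
  have "card (defect_set k x) \<le> card (G \<union> (?E1 \<union> ?E2))"
    using fG fE2 finite_nat_le cover by (intro card_mono) auto
  also have "\<dots> \<le> card G + (card ?E1 + card ?E2)"
    using card_Un_le[of G "?E1 \<union> ?E2"] card_Un_le[of ?E1 ?E2] by linarith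
  finally have "real (card (defect_set k x)) \<le> real (card G) + (real (card ?E1) + real (card ?E2))" by linarith
  moreover have "real (card G) \<le> simple_log_sum k x / (ln x - 12 * b)"
  proof -
    have "real (card G) * (ln x - 12 * b) = (\<Sum>n\<in>G. ln x - 12 * b)" by simp
    also have "\<dots> \<le> (\<Sum>n\<in>G. \<Sum>p\<in>simple_primes n. ln (real p))"
    proof (rule sum_mono)
      fix n assume n: "n \<in> G"
      have "ln x - 12 * b = ln (x / ln x ^ 12)" using lx x by (simp add: ln_div ln_realpow b_def)
      also have "\<dots> \<le> ln (real (\<Prod>(simple_primes n)))"
      proof -
        have "0 < x / ln x ^ 12" "x / ln x ^ 12 \<le> real (\<Prod>(simple_primes n))" using n lx x by (auto simp: G_def)
        then show ?thesis by (subst ln_le_cancel_iff) linarith+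
      qed
      finally show "ln x - 12 * b \<le> (\<Sum>p\<in>simple_primes n. ln (real p))" by (simp only: sum_ln_simple_primes)
    qed
    also have "\<dots> \<le> simple_log_sum k x"
      unfolding simple_log_sum_def by (intro sum_mono2 sum_nonneg) (auto simp: G_def ln_of_nat_nonneg)
    finally show ?thesis using d by (simp add: pos_le_divide_eq)
  qed
  moreover have "real (card ?E1) \<le> x / (ln x)\<^sup>2"
  proof -
    have "real (card ?E1) \<le> x / ln x ^ 4" using x lx by (intro card_nat_le) auto
    also have "\<dots> \<le> x / (ln x)\<^sup>2" using x lx by (intro divide_left_mono power_increasing) auto
    finally show ?thesis .
  qed
  moreover have "real (card ?E2) \<le> powerful_sum * x / (ln x)\<^sup>2"
  proof -
    have "real (card ?E2) \<le> x * ((ln x ^ 8) powr (- 1 / 4) * powerful_sum)"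
      using x lx by (intro card_large_powerful_part) auto
    also have "(ln x ^ 8) powr (- 1 / 4) = ln x powr (- 2)" using lx by (simp add: powr_powr flip: powr_numeral)
    also have "\<dots> = 1 / (ln x)\<^sup>2" using lx by (simp add: powr_minus_divide powr_numeral)
    finally show ?thesis by (simp add: mult_ac)
  qed
  ultimately show ?thesis by (simp add: b_def[symmetric] add_divide_distrib distrib_right)
qed

text \<open>Dividing \<open>simple_log_sum\<close> by log x or by log x - 12 log log x gives the same result up to a
  relative error of order log log x / log x.\<close>

lemma defect_count_asymptotic:
  obtains C x0 where "C \<ge> 0" "x0 \<ge> 3"
    "\<And>x. x \<ge> x0 \<Longrightarrow> \<bar>real (defect_count k x) - B_const * x * ln (ln x) ^ k / (fact k * ln x)\<bar> \<le> C * (x * ln (ln x) ^ k / (ln (ln x) * ln x))"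
proof -
  obtain A x0 where A: "A \<ge> 0" "x0 \<ge> 3" "\<And>x. x \<ge> x0 \<Longrightarrow> ln (ln x) \<ge> 1"
    "\<And>x. x \<ge> x0 \<Longrightarrow> \<bar>simple_log_sum k x - B_const * x * ln (ln x) ^ k / fact k\<bar> \<le> A * x * (ln (ln x) ^ k / ln (ln x))"
    by (rule simple_log_sum_asymptotic[of k], rule that; blast)
  have "eventually (\<lambda>x::real. 24 * ln (ln x) \<le> ln x) at_top" by real_asymp
  moreover have "eventually (\<lambda>x::real. (ln (ln x))\<^sup>2 \<le> ln x) at_top" by real_asymp
  ultimately have "eventually (\<lambda>x::real. 24 * ln (ln x) \<le> ln x \<and> (ln (ln x))\<^sup>2 \<le> ln x) at_top" by (rule eventually_conj)
  then obtain x1 :: real where x1: "\<And>x. x \<ge> x1 \<Longrightarrow> 24 * ln (ln x) \<le> ln x \<and> (ln (ln x))\<^sup>2 \<le> ln x"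
    by (auto simp: eventually_at_top_linorder)
  note ps = powerful_sum_nonneg
  have B0: "B_const \<ge> 0" using B_const_pos by simp
  define C where "C = A + 24 * (B_const + A) + (1 + powerful_sum)"
  have C0: "C \<ge> 0" using A B0 ps by (simp add: C_def)
  show thesis
  proof (rule that[OF C0, of "max x0 x1"])
    show "max x0 x1 \<ge> 3" using A(2) by simp
    fix x assume "x \<ge> max x0 x1"
    then have x: "x \<ge> x0" "x \<ge> x1" by auto
    have x3: "x \<ge> 3" using x A by simp
    define b l N S where "b = ln (ln x)" and "l = ln x" and "N = real (card (defect_set k x))" and "S = simple_log_sum k x"
    have b: "b \<ge> 1" "24 * b \<le> l" "b\<^sup>2 \<le> l" using A(3)[OF x(1)] x1[OF x(2)] by (auto simp: b_def l_def)
    have l: "l > 1" using ln_ln_pos(2)[OF x3] by (simp add: l_def)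
    define e where "e = b ^ k / b"
    have e: "e \<ge> 1 / b" "e \<ge> 0" "e \<le> b ^ k" using b by (auto simp: e_def divide_right_mono divide_le_eq mult_ge1_I)
    have f1: "fact k \<ge> (1::real)" by (rule fact_ge_1)
    have SA: "\<bar>S - B_const * x * b ^ k / fact k\<bar> \<le> A * x * e" using A(4)[OF x(1)] by (simp add: S_def b_def e_def)
    have S0: "S \<ge> 0" unfolding S_def simple_log_sum_def by (intro sum_nonneg ln_of_nat_nonneg)
    have Sup: "S \<le> (B_const + A) * x * b ^ k"
    proof -
      have "B_const * x * b ^ k / fact k \<le> B_const * x * b ^ k / 1" using f1 B0 x3 b by (intro divide_left_mono) auto
      moreover have "A * x * e \<le> A * x * b ^ k" using e A x3 by (intro mult_left_mono) auto
      ultimately show ?thesis using SA by (simp add: abs_le_iff algebra_simps)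
    qed
    have N1: "S / l \<le> N" using simple_log_sum_le_card[of x k] x3 l by (simp add: N_def S_def l_def pos_divide_le_eq)
    have "N \<le> S / (l - 12 * b) + (1 + powerful_sum) * x / l\<^sup>2"
      using card_defect_set_le[OF x3, of k] b by (simp add: N_def S_def l_def b_def)
    also have "S / (l - 12 * b) = S / l + S * (12 * b) / (l * (l - 12 * b))"
      using l b by (simp add: field_simps)
    also have "S * (12 * b) / (l * (l - 12 * b)) \<le> S * (12 * b) / (l * (l / 2))"
      using l b S0 by (intro divide_left_mono mult_left_mono mult_pos_pos) auto
    also have "\<dots> = 24 * S * b / l\<^sup>2" using l by (simp add: power2_eq_square field_simps)
    also have "\<dots> \<le> 24 * (B_const + A) * (x * e / l)"
    proof -
      have "S * b \<le> (B_const + A) * x * b ^ k * b" using Sup b by (intro mult_right_mono) auto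
      also have "\<dots> = (B_const + A) * x * e * b\<^sup>2" using b by (simp add: e_def power2_eq_square)
      also have "\<dots> \<le> (B_const + A) * x * e * l" using b B0 A x3 e by (intro mult_left_mono) auto
      finally have "S * b / l\<^sup>2 \<le> (B_const + A) * x * e * l / l\<^sup>2" by (rule divide_right_mono) simp
      also have "\<dots> = (B_const + A) * (x * e / l)" using l by (simp add: power2_eq_square)
      finally have "24 * (S * b / l\<^sup>2) \<le> 24 * ((B_const + A) * (x * e / l))" by simp
      then show ?thesis by (simp only: mult.assoc times_divide_eq_right)
    qed
    also have "(1 + powerful_sum) * x / l\<^sup>2 \<le> (1 + powerful_sum) * (x * e / l)"
    proof -
      have "b * 1 \<le> b * b" using b by (intro mult_left_mono) auto
      then have "b \<le> l" using b by (simp add: power2_eq_square)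
      then have "1 / l \<le> 1 / b" using b by (intro divide_left_mono) auto
      then have "1 / l \<le> e" using e by linarith
      then have "(1 + powerful_sum) * x / l * (1 / l) \<le> (1 + powerful_sum) * x / l * e"
        using ps x3 l by (intro mult_left_mono) auto
      then show ?thesis by (simp add: power2_eq_square)
    qed
    finally have N2: "N \<le> S / l + 24 * (B_const + A) * (x * e / l) + (1 + powerful_sum) * (x * e / l)" by simp
    have S3: "\<bar>S / l - B_const * x * b ^ k / (fact k * l)\<bar> \<le> A * (x * e / l)"
    proof -
      have "S / l - B_const * x * b ^ k / (fact k * l) = (S - B_const * x * b ^ k / fact k) / l"
        using l by (simp add: diff_divide_distrib)
      then have "\<bar>S / l - B_const * x * b ^ k / (fact k * l)\<bar> = \<bar>S - B_const * x * b ^ k / fact k\<bar> / l" using l by simp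
      also have "\<dots> \<le> A * x * e / l" using SA l by (intro divide_right_mono) auto
      finally show ?thesis by simp
    qed
    have pos: "x * e / l \<ge> 0" using x3 e l by simp
    have split: "C * (x * e / l) = A * (x * e / l) + 24 * (B_const + A) * (x * e / l) + (1 + powerful_sum) * (x * e / l)"
      by (simp only: C_def distrib_right)
    have "0 \<le> 24 * (B_const + A) * (x * e / l)" by (rule mult_nonneg_nonneg[OF _ pos]) (use B0 A(1) in simp)
    moreover have "0 \<le> (1 + powerful_sum) * (x * e / l)" by (rule mult_nonneg_nonneg[OF _ pos]) (use ps in simp)
    ultimately have Nb: "\<bar>N - B_const * x * b ^ k / (fact k * l)\<bar> \<le> C * (x * e / l)"
      using S3 N1 N2 split by (simp only: abs_le_iff) linarith
    have "x * e / l = x * b ^ k / (b * l)" by (simp add: e_def)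
    with Nb have "\<bar>N - B_const * x * b ^ k / (fact k * l)\<bar> \<le> C * (x * b ^ k / (b * l))" by (simp only:)
    then show "\<bar>real (defect_count k x) - B_const * x * ln (ln x) ^ k / (fact k * ln x)\<bar> \<le> C * (x * ln (ln x) ^ k / (ln (ln x) * ln x))"
      by (simp only: N_def b_def l_def defect_count_def defect_set_def)
  qed
qed

theorem theorem1p4:
  fixes k :: nat
  shows "\<exists>C::real. \<forall>x::real. x \<ge> 3 \<longrightarrow>
    (\<exists>E::real. \<bar>E\<bar> \<le> C * (1 / ln (ln x)) \<and>
      real (defect_count k x) =
        B_const * x * (ln (ln x)) ^ k / (fact k * ln x) * (1 + E))"
proof -
  obtain A x0 where A: "A \<ge> 0" "x0 \<ge> 3"
    "\<And>x. x \<ge> x0 \<Longrightarrow> \<bar>real (defect_count k x) - B_const * x * ln (ln x) ^ k / (fact k * ln x)\<bar> \<le> A * (x * ln (ln x) ^ k / (ln (ln x) * ln x))"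
    by (rule defect_count_asymptotic[of k], rule that; blast)
  note B = B_const_pos
  \<comment> \<open>On the bounded range 3 \<le> x < x0 the trivial bound x for the count suffices, since log log x stays
    above the positive number log log 3.\<close>
  define K where "K = fact k * ln x0 / (B_const * ln (ln 3) ^ k)"
  have ll3: "ln (ln 3) > (0::real)" using ln_ln_pos(1)[of 3] by simp
  have lx0: "ln (ln x0) > 0" "ln x0 > 1" using ln_ln_pos[OF A(2)] by auto
  have K0: "K \<ge> 0" using B ll3 lx0 by (simp add: K_def)
  define C where "C = A * fact k / B_const + (K + 1) * ln (ln x0)"
  have "\<exists>E::real. \<bar>E\<bar> \<le> C * (1 / ln (ln x)) \<and>
      real (defect_count k x) = B_const * x * (ln (ln x)) ^ k / (fact k * ln x) * (1 + E)" if x: "x \<ge> 3" for x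
  proof -
    note lx = ln_ln_pos[OF x]
    define b where "b = ln (ln x)"
    have b: "b > 0" using lx by (simp add: b_def)
    define m where "m = B_const * x * b ^ k / (fact k * ln x)"
    have m: "m > 0" using B x b lx by (simp add: m_def)
    define E where "E = real (defect_count k x) / m - 1"
    have "\<bar>E\<bar> \<le> C / b"
    proof (cases "x \<ge> x0")
      case True
      have "\<bar>E\<bar> = \<bar>real (defect_count k x) - m\<bar> / m" using m by (simp add: E_def field_simps abs_if)
      also have "\<dots> \<le> A * (x * b ^ k / (b * ln x)) / m"
        using A(3)[OF True] m by (intro divide_right_mono) (auto simp: m_def b_def)
      also have "\<dots> = (A * fact k / B_const) / b" using B x b lx by (simp add: m_def field_simps)
      also have "\<dots> \<le> C / b" using b K0 lx0 by (intro divide_right_mono) (auto simp: C_def)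
      finally show ?thesis .
    next
      case False
      have "real (defect_count k x) \<le> x"
      proof -
        have "defect_count k x \<le> card {n::nat. n > 0 \<and> real n \<le> x}"
          unfolding defect_count_def by (intro card_mono finite_nat_le) auto
        then show ?thesis using card_nat_le[of x] x by linarith
      qed
      then have "real (defect_count k x) / m \<le> x / m" using m by (intro divide_right_mono) auto
      also have "\<dots> = fact k * ln x / (B_const * b ^ k)" using x by (simp add: m_def)
      also have "\<dots> \<le> K" unfolding K_def
      proof (rule frac_le)
        show "fact k * ln x \<le> fact k * ln x0" using False x by (intro mult_left_mono) auto
        have "ln 3 \<le> ln x" using x by simp
        then have "ln (ln 3) \<le> b" unfolding b_def using ln_ln_pos(2)[of 3] by (subst ln_le_cancel_iff) auto
        then show "B_const * ln (ln 3) ^ k \<le> B_const * b ^ k" using B ll3 by (intro mult_left_mono power_mono) auto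
        show "0 < B_const * ln (ln 3) ^ k" using B ll3 by simp
      qed (use lx0 in auto)
      finally have "real (defect_count k x) / m \<le> K" .
      moreover have "0 \<le> real (defect_count k x) / m" using m by simp
      ultimately have "\<bar>E\<bar> \<le> K + 1" unfolding E_def by linarith
      also have "\<dots> \<le> (K + 1) * ln (ln x0) / b"
      proof -
        have "ln x \<le> ln x0" using False x by simp
        then have "b \<le> ln (ln x0)" unfolding b_def using lx by (subst ln_le_cancel_iff) auto
        then show ?thesis using K0 b by (simp add: pos_le_divide_eq mult_left_mono)
      qed
      also have "\<dots> \<le> C / b" using b A B by (intro divide_right_mono) (auto simp: C_def)
      finally show ?thesis .
    qed
    moreover have "real (defect_count k x) = m * (1 + E)" using m by (simp add: E_def)
    ultimately show ?thesis by (intro exI[of _ E]) (simp add: m_def b_def)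
  qed
  then show ?thesis by blast
qed

end
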